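(* Let $A$ be an associative unital ring and $m$ an integer. Given an $m$-connected map $X\to Y$ of $A$-perfect $A[t]$-chain complexes, there is a factorization in $A[t]$-chain complexes $$X\to X_{m+1}\to X_{m+2}\to\cdots\to X_n\xrightarrow{\ \sim\ }Y$$ in which, with $X_m:=X$, the maps $X_{q-1}\to X_q$ ($m<q\le n$) are levelwise injective, each $X_q/X_{q-1}$ has homology that is finitely generated projective over $A$ and concentrated in degree $q$, and the last map $X_n\to Y$ is a quasi-isomorphism. (Therefore every term of the factorization is $A$-perfect.)
   Context: Modules are right modules; in $A[t]$ the indeterminate commutes with $A$; an $A[t]$-module is the same as an $A$-module with an $A$-linear endomorphism. Chain complexes are non-negatively graded. A complex of $A$-modules is strictly perfect if it is bounded and finitely generated projective over $A$ in each degree. An $A[t]$-chain complex is $A$-perfect if it is connected by a zig-zag of $A$-linear quasi-isomorphisms to a strictly perfect $A$-complex. A map of chain complexes $X\to Y$ is $m$-connected if $H_q(Y,X)=0$ for all $q\le m$, where $H_*(Y,X)$ is the homology of the mapping cone. *)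

theory Defs
  imports "HOL-Algebra.AbelCoset"
begin

text \<open>
  The library's locale for modules assumes a commutative ring, so right modules over an
  arbitrary unital ring are set up here. As for the library's module record, the abelian group of
  a module is the additive part of a ring record; the multiplicative fields are never used.
\<close>

record ('a, 'm) rmodule = "'m ring" +
  rsmult :: "['m, 'a] \<Rightarrow> 'm"  (infixl "\<triangleleft>\<index>" 70)

locale right_module = R?: ring R + M?: abelian_group M
  for R (structure) and M :: "('a, 'm, 'c) rmodule_scheme" (structure) +
  assumes rsmult_closed:
      "\<lbrakk> x \<in> carrier M; a \<in> carrier R \<rbrakk> \<Longrightarrow> x \<triangleleft>\<^bsub>M\<^esub> a \<in> carrier M"
    and rsmult_add_left:
      "\<lbrakk> x \<in> carrier M; y \<in> carrier M; a \<in> carrier R \<rbrakk> \<Longrightarrow>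
        (x \<oplus>\<^bsub>M\<^esub> y) \<triangleleft>\<^bsub>M\<^esub> a = (x \<triangleleft>\<^bsub>M\<^esub> a) \<oplus>\<^bsub>M\<^esub> (y \<triangleleft>\<^bsub>M\<^esub> a)"
    and rsmult_add_right:
      "\<lbrakk> x \<in> carrier M; a \<in> carrier R; b \<in> carrier R \<rbrakk> \<Longrightarrow>
        x \<triangleleft>\<^bsub>M\<^esub> (a \<oplus>\<^bsub>R\<^esub> b) = (x \<triangleleft>\<^bsub>M\<^esub> a) \<oplus>\<^bsub>M\<^esub> (x \<triangleleft>\<^bsub>M\<^esub> b)"
    and rsmult_assoc:
      "\<lbrakk> x \<in> carrier M; a \<in> carrier R; b \<in> carrier R \<rbrakk> \<Longrightarrow>
        x \<triangleleft>\<^bsub>M\<^esub> (a \<otimes>\<^bsub>R\<^esub> b) = (x \<triangleleft>\<^bsub>M\<^esub> a) \<triangleleft>\<^bsub>M\<^esub> b"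
    and rsmult_one: "x \<in> carrier M \<Longrightarrow> x \<triangleleft>\<^bsub>M\<^esub> \<one>\<^bsub>R\<^esub> = x"

definition linear_maps ::
  "('a, 'b) ring_scheme \<Rightarrow> ('a, 'm, 'c) rmodule_scheme \<Rightarrow> ('a, 'n, 'd) rmodule_scheme \<Rightarrow> ('m \<Rightarrow> 'n) set"
  where "linear_maps A M N =
    {f. f \<in> carrier M \<rightarrow> carrier N
      \<and> (\<forall>x\<in>carrier M. \<forall>y\<in>carrier M. f (x \<oplus>\<^bsub>M\<^esub> y) = f x \<oplus>\<^bsub>N\<^esub> f y)
      \<and> (\<forall>x\<in>carrier M. \<forall>a\<in>carrier A. f (x \<triangleleft>\<^bsub>M\<^esub> a) = f x \<triangleleft>\<^bsub>N\<^esub> a)}"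

definition zero_module :: "('a, 'm, 'c) rmodule_scheme \<Rightarrow> bool"
  where "zero_module M \<longleftrightarrow> carrier M = {\<zero>\<^bsub>M\<^esub>}"

definition sum_module ::
  "('a, 'm, 'c) rmodule_scheme \<Rightarrow> ('a, 'n, 'd) rmodule_scheme \<Rightarrow> ('a, 'm \<times> 'n) rmodule"
  where "sum_module M N =
    \<lparr>carrier = carrier M \<times> carrier N, mult = undefined, one = undefined,
     zero = (\<zero>\<^bsub>M\<^esub>, \<zero>\<^bsub>N\<^esub>),
     add = (\<lambda>(x, y) (x', y'). (x \<oplus>\<^bsub>M\<^esub> x', y \<oplus>\<^bsub>N\<^esub> y')),
     rsmult = (\<lambda>(x, y) a. (x \<triangleleft>\<^bsub>M\<^esub> a, y \<triangleleft>\<^bsub>N\<^esub> a))\<rparr>"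

definition quotient_module :: "('a, 'm, 'c) rmodule_scheme \<Rightarrow> 'm set \<Rightarrow> ('a, 'm set) rmodule"
  where "quotient_module M N =
    \<lparr>carrier = a_rcosets\<^bsub>M\<^esub> N, mult = undefined, one = undefined,
     zero = N,
     add = (\<lambda>K L. K <+>\<^bsub>M\<^esub> L),
     rsmult = (\<lambda>K a. N <+>\<^bsub>M\<^esub> ((\<lambda>x. x \<triangleleft>\<^bsub>M\<^esub> a) ` K))\<rparr>"

definition free_module :: "('a, 'b) ring_scheme \<Rightarrow> 'i set \<Rightarrow> ('a, 'i \<Rightarrow> 'a) rmodule"
  where "free_module A I =
    \<lparr>carrier = {c. (\<forall>i\<in>I. c i \<in> carrier A) \<and> (\<forall>i. i \<notin> I \<longrightarrow> c i = \<zero>\<^bsub>A\<^esub>) \<and> finite {i. c i \<noteq> \<zero>\<^bsub>A\<^esub>}},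
     mult = undefined, one = undefined,
     zero = (\<lambda>i. \<zero>\<^bsub>A\<^esub>),
     add = (\<lambda>c d i. c i \<oplus>\<^bsub>A\<^esub> d i),
     rsmult = (\<lambda>c a i. c i \<otimes>\<^bsub>A\<^esub> a)\<rparr>"

definition finitely_generated :: "('a, 'b) ring_scheme \<Rightarrow> ('a, 'm, 'c) rmodule_scheme \<Rightarrow> bool"
  where "finitely_generated A M \<longleftrightarrow>
    (\<exists>S. finite S \<and> S \<subseteq> carrier M \<and>
      (\<forall>x\<in>carrier M. \<exists>c\<in>S \<rightarrow> carrier A. x = (\<Oplus>\<^bsub>M\<^esub>s\<in>S. s \<triangleleft>\<^bsub>M\<^esub> c s)))"

text \<open>
  A module is projective if it is a direct summand of a free module. Index sets inside the type of
  the module suffice, because a projective module is a direct summand of the free module on its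
  own underlying set.
\<close>

definition projective :: "('a, 'b) ring_scheme \<Rightarrow> ('a, 'm, 'c) rmodule_scheme \<Rightarrow> bool"
  where "projective A M \<longleftrightarrow>
    (\<exists>I :: 'm set. \<exists>s \<in> linear_maps A M (free_module A I). \<exists>p \<in> linear_maps A (free_module A I) M.
      \<forall>x\<in>carrier M. p (s x) = x)"

definition fg_projective :: "('a, 'b) ring_scheme \<Rightarrow> ('a, 'm, 'c) rmodule_scheme \<Rightarrow> bool"
  where "fg_projective A M \<longleftrightarrow> finitely_generated A M \<and> projective A M"

text \<open>
  Non-negatively graded complexes are indexed by the integers and vanish in negative degrees. An
  \<open>A[t]\<close>-module is an \<open>A\<close>-module with an \<open>A\<close>-linear endomorphism, so an \<open>A[t]\<close>-complex is an
  \<open>A\<close>-complex with an endomorphism \<open>tact\<close>, the action of \<open>t\<close>. By record extension, all notions for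
  \<open>A\<close>-complexes apply to the underlying \<open>A\<close>-complex of an \<open>A[t]\<close>-complex.
\<close>

record ('a, 'm) cpx =
  obj :: "int \<Rightarrow> ('a, 'm) rmodule"
  bdry :: "int \<Rightarrow> 'm \<Rightarrow> 'm"

record ('a, 'm) tcpx = "('a, 'm) cpx" +
  tact :: "int \<Rightarrow> 'm \<Rightarrow> 'm"

definition A_complex :: "('a, 'b) ring_scheme \<Rightarrow> ('a, 'm, 'c) cpx_scheme \<Rightarrow> bool"
  where "A_complex A C \<longleftrightarrow>
    (\<forall>i. right_module A (obj C i))
    \<and> (\<forall>i. bdry C i \<in> linear_maps A (obj C i) (obj C (i - 1)))
    \<and> (\<forall>i. \<forall>x\<in>carrier (obj C i). bdry C (i - 1) (bdry C i x) = \<zero>\<^bsub>obj C (i - 2)\<^esub>)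
    \<and> (\<forall>i<0. zero_module (obj C i))"

definition A_map ::
  "('a, 'b) ring_scheme \<Rightarrow> (int \<Rightarrow> 'm \<Rightarrow> 'n) \<Rightarrow> ('a, 'm, 'c) cpx_scheme \<Rightarrow> ('a, 'n, 'd) cpx_scheme \<Rightarrow> bool"
  where "A_map A f C D \<longleftrightarrow>
    (\<forall>i. f i \<in> linear_maps A (obj C i) (obj D i))
    \<and> (\<forall>i. \<forall>x\<in>carrier (obj C i). f (i - 1) (bdry C i x) = bdry D i (f i x))"

definition At_complex :: "('a, 'b) ring_scheme \<Rightarrow> ('a, 'm) tcpx \<Rightarrow> bool"
  where "At_complex A C \<longleftrightarrow> A_complex A C \<and> A_map A (tact C) C C"

definition At_map ::
  "('a, 'b) ring_scheme \<Rightarrow> (int \<Rightarrow> 'm \<Rightarrow> 'n) \<Rightarrow> ('a, 'm) tcpx \<Rightarrow> ('a, 'n) tcpx \<Rightarrow> bool"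
  where "At_map A f C D \<longleftrightarrow>
    A_map A f C D \<and> (\<forall>i. \<forall>x\<in>carrier (obj C i). f i (tact C i x) = tact D i (f i x))"

definition cycles :: "('a, 'm, 'c) cpx_scheme \<Rightarrow> int \<Rightarrow> 'm set"
  where "cycles C i = {x \<in> carrier (obj C i). bdry C i x = \<zero>\<^bsub>obj C (i - 1)\<^esub>}"

definition boundaries :: "('a, 'm, 'c) cpx_scheme \<Rightarrow> int \<Rightarrow> 'm set"
  where "boundaries C i = bdry C (i + 1) ` carrier (obj C (i + 1))"

definition homology :: "('a, 'm, 'c) cpx_scheme \<Rightarrow> int \<Rightarrow> ('a, 'm set) rmodule"
  where "homology C i = quotient_module ((obj C i)\<lparr>carrier := cycles C i\<rparr>) (boundaries C i)"

definition homology_map ::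
  "(int \<Rightarrow> 'm \<Rightarrow> 'n) \<Rightarrow> ('a, 'n, 'd) cpx_scheme \<Rightarrow> int \<Rightarrow> 'm set \<Rightarrow> 'n set"
  where "homology_map f D i K = boundaries D i <+>\<^bsub>obj D i\<^esub> (f i ` K)"

definition quasi_iso ::
  "('a, 'b) ring_scheme \<Rightarrow> (int \<Rightarrow> 'm \<Rightarrow> 'n) \<Rightarrow> ('a, 'm, 'c) cpx_scheme \<Rightarrow> ('a, 'n, 'd) cpx_scheme \<Rightarrow> bool"
  where "quasi_iso A f C D \<longleftrightarrow>
    A_map A f C D
    \<and> (\<forall>i. bij_betw (homology_map f D i) (carrier (homology C i)) (carrier (homology D i)))"

definition mapping_cone ::
  "(int \<Rightarrow> 'm \<Rightarrow> 'n) \<Rightarrow> ('a, 'm, 'c) cpx_scheme \<Rightarrow> ('a, 'n, 'd) cpx_scheme \<Rightarrow> ('a, 'n \<times> 'm) cpx"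
  where "mapping_cone f C D =
    \<lparr>obj = (\<lambda>i. sum_module (obj D i) (obj C (i - 1))),
     bdry = (\<lambda>i (y, x). (bdry D i y \<oplus>\<^bsub>obj D (i - 1)\<^esub> f (i - 1) x,
                         \<ominus>\<^bsub>obj C (i - 2)\<^esub> bdry C (i - 1) x))\<rparr>"

definition connected_map ::
  "int \<Rightarrow> (int \<Rightarrow> 'm \<Rightarrow> 'n) \<Rightarrow> ('a, 'm, 'c) cpx_scheme \<Rightarrow> ('a, 'n, 'd) cpx_scheme \<Rightarrow> bool"
  where "connected_map m f C D \<longleftrightarrow> (\<forall>q\<le>m. zero_module (homology (mapping_cone f C D) q))"

definition strictly_perfect :: "('a, 'b) ring_scheme \<Rightarrow> ('a, 'm, 'c) cpx_scheme \<Rightarrow> bool"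
  where "strictly_perfect A P \<longleftrightarrow>
    A_complex A P \<and> (\<exists>d. \<forall>i>d. zero_module (obj P i)) \<and> (\<forall>i. fg_projective A (obj P i))"

definition qi_edge ::
  "('a, 'b) ring_scheme \<Rightarrow> ('a, 'm, 'c) cpx_scheme \<Rightarrow> ('a, 'n, 'd) cpx_scheme \<Rightarrow> bool"
  where "qi_edge A C D \<longleftrightarrow>
    A_complex A C \<and> A_complex A D \<and> ((\<exists>f. quasi_iso A f C D) \<or> (\<exists>f. quasi_iso A f D C))"

text \<open>
  Quantification over all complexes would range over types. The type argument fixes the type
  \<open>'z\<close> in which the members of the zig-zag after \<open>X\<close> itself live. As a hypothesis of a theorem that
  holds for all \<open>'z\<close>, this amounts to perfectness with no restriction on the zig-zag: any zig-zag
  can be copied into a common type, and a strictly perfect \<open>X\<close> is joined to a copy of itself.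
\<close>

definition A_perfect :: "'z itself \<Rightarrow> ('a, 'b) ring_scheme \<Rightarrow> ('a, 'm, 'c) cpx_scheme \<Rightarrow> bool"
  where "A_perfect TYPE('z) A X \<longleftrightarrow>
    (\<exists>(W :: ('a, 'z) cpx) (P :: ('a, 'z) cpx).
      qi_edge A X W \<and> (qi_edge A)\<^sup>*\<^sup>* W P \<and> strictly_perfect A P)"

text \<open>
  The quotient of \<open>D\<close> by the image of \<open>f\<close>, as an \<open>A\<close>-complex.
\<close>

definition quotient_complex ::
  "(int \<Rightarrow> 'm \<Rightarrow> 'n) \<Rightarrow> ('a, 'm, 'c) cpx_scheme \<Rightarrow> ('a, 'n, 'd) cpx_scheme \<Rightarrow> ('a, 'n set) cpx"
  where "quotient_complex f C D =
    \<lparr>obj = (\<lambda>i. quotient_module (obj D i) (f i ` carrier (obj C i))),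
     bdry = (\<lambda>i K. (f (i - 1) ` carrier (obj C (i - 1))) <+>\<^bsub>obj D (i - 1)\<^esub> (bdry D i ` K))\<rparr>"

definition fg_projective_homology_in_degree ::
  "('a, 'b) ring_scheme \<Rightarrow> int \<Rightarrow> ('a, 'm, 'c) cpx_scheme \<Rightarrow> bool"
  where "fg_projective_homology_in_degree A q C \<longleftrightarrow>
    (\<forall>i. fg_projective A (homology C i)) \<and> (\<forall>i. i \<noteq> q \<longrightarrow> zero_module (homology C i))"

definition filtration_step ::
  "('a, 'b) ring_scheme \<Rightarrow> int \<Rightarrow> (int \<Rightarrow> 'm \<Rightarrow> 'n) \<Rightarrow> ('a, 'm) tcpx \<Rightarrow> ('a, 'n) tcpx \<Rightarrow> bool"
  where "filtration_step A q f C D \<longleftrightarrow>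
    At_map A f C D
    \<and> (\<forall>i. inj_on (f i) (carrier (obj C i)))
    \<and> fg_projective_homology_in_degree A q (quotient_complex f C D)"

text \<open>
  An existence statement has to name a type for the elements of the new complexes. They are obtained
  from \<open>X\<close> by adding, in each degree, an \<open>A\<close>-module that embeds in a free \<open>A\<close>-module of countable
  rank, so pairs of an element of \<open>X\<close> and a sequence in \<open>A\<close> suffice.
\<close>

type_synonym ('a, 'x) attached = "'x \<times> (nat \<Rightarrow> 'a)"

end

theory Submission
  imports Defs "HOL-Library.Nat_Bijection"
begin

text \<open>
  Let \<open>C\<close> be the cone of \<open>\<phi>\<close>. A filtration as required comes from a filtration of a model of \<open>C\<close>:
  if \<open>T\<close> is an \<open>A[t]\<close>-complex with an \<open>A[t]\<close>-linear map \<open>g : T \<rightarrow> C\<close>, then the composite of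
  \<open>g\<close> with the projection of \<open>C\<close> to the shifted \<open>X\<close> twists the differential of \<open>X \<oplus> T\<close>, the other component
  of \<open>g\<close> extends \<open>\<phi>\<close> to a map \<open>X \<oplus> T \<rightarrow> Y\<close>, and this map is a quasi-isomorphism if \<open>g\<close> is one
  (\<open>attach_map_weak_equiv\<close>). So it suffices to find a good filtered model \<open>T\<close> of \<open>C\<close>, and all cells can be
  attached at once, not one dimension after the other.

  Over \<open>A\<close> alone such a model exists. A zig-zag of quasi-isomorphisms ending at a strictly perfect complex
  collapses to one quasi-isomorphism out of it, because maps out of bounded below complexes of projectives
  lift through quasi-isomorphisms up to homotopy (\<open>lift_through_weak_equiv\<close>, \<open>A_perfect_resolved\<close>). Resolutions
  of \<open>X\<close> and \<open>Y\<close> combine to a resolution of \<open>C\<close> (\<open>twisted_resolved\<close>), and since \<open>C\<close> has no homology in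
  degrees up to \<open>m\<close>, the part of the resolution in these degrees splits off (\<open>truncated_resolution\<close>). The
  result is a strictly perfect \<open>P\<close> with \<open>P\<^sub>i = 0\<close> for \<open>i \<le> m\<close> and a quasi-isomorphism \<open>f : P \<rightarrow> C\<close>.

  The action of \<open>t\<close> on \<open>C\<close> lifts to \<open>P\<close> only up to homotopy: there are a chain map \<open>\<tau> : P \<rightarrow> P\<close> and a homotopy
  \<open>h\<close> between \<open>f \<tau>\<close> and \<open>t f\<close>. These are exactly the data that define an \<open>A[t]\<close>-linear map to \<open>C\<close> from the
  algebraic mapping telescope, the cone \<open>T\<close> of \<open>t - \<tau> : P[t] \<rightarrow> P[t]\<close>. The inclusion of \<open>P\<close> as constant
  polynomials is a quasi-isomorphism \<open>P \<rightarrow> T\<close>, because polynomials can be divided by \<open>t - \<tau>\<close> with a unique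
  constant remainder (\<open>telescope_incl_weak_equiv\<close>). Hence \<open>T \<rightarrow> C\<close> is a quasi-isomorphism as well
  (\<open>telescope_map_weak_equiv\<close>).

  The chain map \<open>\<tau>\<close> preserves the skeleta of \<open>P\<close>, the truncations that keep \<open>P\<^sub>i\<close> for \<open>i \<le> q\<close>. Their telescopes
  filter \<open>T\<close>, and \<open>X\<^sub>q\<close> is \<open>X\<close> with the telescope of the \<open>q\<close>-skeleton attached. The quotient of
  \<open>X\<^sub>q\<close> by \<open>X\<^sub>q\<^sub>-\<^sub>1\<close> is the complex \<open>t - \<tau> : P\<^sub>q[t] \<rightarrow> P\<^sub>q[t]\<close> in degrees \<open>q + 1\<close> and \<open>q\<close>, whose
  homology is \<open>P\<^sub>q\<close> in degree \<open>q\<close> (\<open>stage_surj\<close>, \<open>stage_kernel\<close>, \<open>stage_other\<close>). Each \<open>X\<^sub>q\<close> is perfect, being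
  built from \<open>X\<close> and a complex quasi-isomorphic to a skeleton of \<open>P\<close>.
\<close>


section \<open>Right modules and linear maps\<close>

lemma (in abelian_group) minus_zero_eq: "\<ominus> \<zero> = \<zero>"
  using minus_equality[of "\<zero>" "\<zero>"] by simp

text \<open>
  With these rules the method \<open>algebra\<close> decides identities in the additive group of a module.
\<close>

lemmas (in abelian_group) abelian_group_simprules
  [algebra abelian_group "zero G" "add G" "a_inv G" "a_minus G"] =
  a_closed zero_closed a_inv_closed minus_closed a_assoc l_zero l_neg a_comm minus_eq
  r_zero r_neg r_neg2 r_neg1 minus_add minus_minus minus_zero_eq a_lcomm

lemma (in abelian_group) minus_eq_zeroD:
  "\<lbrakk>x \<ominus> y = \<zero>; x \<in> carrier G; y \<in> carrier G\<rbrakk> \<Longrightarrow> x = y"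
  using minus_equality[of x "\<ominus> y"] by (simp add: minus_eq)

lemma (in abelian_group) add_eq_zeroD:
  "\<lbrakk>x \<oplus> y = \<zero>; x \<in> carrier G; y \<in> carrier G\<rbrakk> \<Longrightarrow> x = \<ominus> y"
  using minus_equality by simp

lemma (in abelian_group) double_zeroD: "\<lbrakk>x \<oplus> x = x; x \<in> carrier G\<rbrakk> \<Longrightarrow> x = \<zero>"
  using add.l_cancel_one by blast

lemma right_moduleI:
  assumes "ring A" and "\<zero>\<^bsub>M\<^esub> \<in> carrier M"
    and "\<And>x y. \<lbrakk>x \<in> carrier M; y \<in> carrier M\<rbrakk> \<Longrightarrow> x \<oplus>\<^bsub>M\<^esub> y \<in> carrier M"
    and "\<And>x y z. \<lbrakk>x \<in> carrier M; y \<in> carrier M; z \<in> carrier M\<rbrakk> \<Longrightarrow> (x \<oplus>\<^bsub>M\<^esub> y) \<oplus>\<^bsub>M\<^esub> z = x \<oplus>\<^bsub>M\<^esub> (y \<oplus>\<^bsub>M\<^esub> z)"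
    and "\<And>x y. \<lbrakk>x \<in> carrier M; y \<in> carrier M\<rbrakk> \<Longrightarrow> x \<oplus>\<^bsub>M\<^esub> y = y \<oplus>\<^bsub>M\<^esub> x"
    and "\<And>x. x \<in> carrier M \<Longrightarrow> \<zero>\<^bsub>M\<^esub> \<oplus>\<^bsub>M\<^esub> x = x"
    and "\<And>x. x \<in> carrier M \<Longrightarrow> \<exists>y\<in>carrier M. y \<oplus>\<^bsub>M\<^esub> x = \<zero>\<^bsub>M\<^esub>"
    and "\<And>x a. \<lbrakk>x \<in> carrier M; a \<in> carrier A\<rbrakk> \<Longrightarrow> x \<triangleleft>\<^bsub>M\<^esub> a \<in> carrier M"
    and "\<And>x y a. \<lbrakk>x \<in> carrier M; y \<in> carrier M; a \<in> carrier A\<rbrakk> \<Longrightarrow> (x \<oplus>\<^bsub>M\<^esub> y) \<triangleleft>\<^bsub>M\<^esub> a = (x \<triangleleft>\<^bsub>M\<^esub> a) \<oplus>\<^bsub>M\<^esub> (y \<triangleleft>\<^bsub>M\<^esub> a)"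
    and "\<And>x a b. \<lbrakk>x \<in> carrier M; a \<in> carrier A; b \<in> carrier A\<rbrakk> \<Longrightarrow> x \<triangleleft>\<^bsub>M\<^esub> (a \<oplus>\<^bsub>A\<^esub> b) = (x \<triangleleft>\<^bsub>M\<^esub> a) \<oplus>\<^bsub>M\<^esub> (x \<triangleleft>\<^bsub>M\<^esub> b)"
    and "\<And>x a b. \<lbrakk>x \<in> carrier M; a \<in> carrier A; b \<in> carrier A\<rbrakk> \<Longrightarrow> x \<triangleleft>\<^bsub>M\<^esub> (a \<otimes>\<^bsub>A\<^esub> b) = (x \<triangleleft>\<^bsub>M\<^esub> a) \<triangleleft>\<^bsub>M\<^esub> b"
    and "\<And>x. x \<in> carrier M \<Longrightarrow> x \<triangleleft>\<^bsub>M\<^esub> \<one>\<^bsub>A\<^esub> = x"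
  shows "right_module A M"
  by (intro right_module.intro right_module_axioms.intro abelian_groupI) (use assms in auto)

lemma right_module_ring: "right_module A M \<Longrightarrow> ring A"
  by (simp add: right_module_def)

context right_module
begin

lemma zero_rsmult:
  assumes "a \<in> carrier R" shows "\<zero>\<^bsub>M\<^esub> \<triangleleft>\<^bsub>M\<^esub> a = \<zero>\<^bsub>M\<^esub>"
  using rsmult_add_left[of "\<zero>\<^bsub>M\<^esub>" "\<zero>\<^bsub>M\<^esub>" a] assms rsmult_closed
  by (metis M.double_zeroD M.l_zero M.zero_closed)

lemma rsmult_zero:
  assumes "x \<in> carrier M" shows "x \<triangleleft>\<^bsub>M\<^esub> \<zero>\<^bsub>R\<^esub> = \<zero>\<^bsub>M\<^esub>"
  using rsmult_add_right[of x "\<zero>\<^bsub>R\<^esub>" "\<zero>\<^bsub>R\<^esub>"] assms rsmult_closed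
  by (metis M.double_zeroD R.l_zero R.zero_closed)

lemma rsmult_minus_one:
  assumes "x \<in> carrier M" shows "x \<triangleleft>\<^bsub>M\<^esub> (\<ominus>\<^bsub>R\<^esub> \<one>\<^bsub>R\<^esub>) = \<ominus>\<^bsub>M\<^esub> x"
proof -
  have "x \<triangleleft>\<^bsub>M\<^esub> (\<ominus>\<^bsub>R\<^esub> \<one>\<^bsub>R\<^esub>) \<oplus>\<^bsub>M\<^esub> x = x \<triangleleft>\<^bsub>M\<^esub> (\<ominus>\<^bsub>R\<^esub> \<one>\<^bsub>R\<^esub> \<oplus>\<^bsub>R\<^esub> \<one>\<^bsub>R\<^esub>)"
    using assms by (simp add: rsmult_add_right rsmult_one)
  also have "\<dots> = \<zero>\<^bsub>M\<^esub>" using assms by (simp add: R.l_neg rsmult_zero)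
  finally show ?thesis using assms by (simp add: M.minus_equality rsmult_closed)
qed

lemma minus_rsmult:
  assumes "x \<in> carrier M" "a \<in> carrier R"
  shows "(\<ominus>\<^bsub>M\<^esub> x) \<triangleleft>\<^bsub>M\<^esub> a = \<ominus>\<^bsub>M\<^esub> (x \<triangleleft>\<^bsub>M\<^esub> a)"
proof -
  have "(\<ominus>\<^bsub>M\<^esub> x) \<triangleleft>\<^bsub>M\<^esub> a \<oplus>\<^bsub>M\<^esub> x \<triangleleft>\<^bsub>M\<^esub> a = \<zero>\<^bsub>M\<^esub>"
    using assms by (metis M.a_inv_closed M.l_neg rsmult_add_left zero_rsmult)
  then show ?thesis using assms by (simp add: M.minus_equality rsmult_closed)
qed

end

definition submodule :: "('a, 'b) ring_scheme \<Rightarrow> ('a, 'm, 'c) rmodule_scheme \<Rightarrow> 'm set \<Rightarrow> bool"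
  where "submodule A M S \<longleftrightarrow> S \<subseteq> carrier M \<and> \<zero>\<^bsub>M\<^esub> \<in> S
    \<and> (\<forall>x\<in>S. \<forall>y\<in>S. x \<oplus>\<^bsub>M\<^esub> y \<in> S) \<and> (\<forall>x\<in>S. \<forall>a\<in>carrier A. x \<triangleleft>\<^bsub>M\<^esub> a \<in> S)"

lemma submodule_minus:
  assumes "right_module A M" "submodule A M S" "x \<in> S" shows "\<ominus>\<^bsub>M\<^esub> x \<in> S"
proof -
  interpret right_module A M by fact
  have "\<ominus>\<^bsub>M\<^esub> x = x \<triangleleft>\<^bsub>M\<^esub> (\<ominus>\<^bsub>A\<^esub> \<one>\<^bsub>A\<^esub>)"
    using assms rsmult_minus_one[of x] by (auto simp: submodule_def)
  then show ?thesis using assms by (auto simp: submodule_def)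
qed

lemma right_module_restrict:
  assumes M: "right_module A M" and S: "submodule A M S"
  shows "right_module A (M\<lparr>carrier := S\<rparr>)"
proof -
  interpret right_module A M by fact
  have sub: "x \<in> carrier M" if "x \<in> S" for x using S that by (auto simp: submodule_def)
  have "\<exists>y\<in>S. y \<oplus>\<^bsub>M\<^esub> x = \<zero>\<^bsub>M\<^esub>" if "x \<in> S" for x
    using submodule_minus[OF M S that] sub[OF that] M.l_neg by blast
  then show ?thesis
    using S R.ring_axioms
    by (intro right_moduleI)
       (auto simp: submodule_def M.a_ac rsmult_add_left rsmult_add_right rsmult_assoc
          rsmult_one dest!: sub)
qed

lemma submodule_zero: "right_module A M \<Longrightarrow> submodule A M {\<zero>\<^bsub>M\<^esub>}"
  using right_module.zero_rsmult abelian_groupE(2) abelian_groupE(5)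
  by (fastforce simp: submodule_def right_module_def)

text \<open>
  Quotients and transported modules are both images of a given module under a map that respects the
  operations, so this covers both.
\<close>

lemma right_module_image:
  assumes M: "right_module A M" and carr: "carrier H = q ` carrier M" and zero: "\<zero>\<^bsub>H\<^esub> = q \<zero>\<^bsub>M\<^esub>"
    and add: "\<And>x y. \<lbrakk>x \<in> carrier M; y \<in> carrier M\<rbrakk> \<Longrightarrow> q (x \<oplus>\<^bsub>M\<^esub> y) = q x \<oplus>\<^bsub>H\<^esub> q y"
    and smult: "\<And>x a. \<lbrakk>x \<in> carrier M; a \<in> carrier A\<rbrakk> \<Longrightarrow> q (x \<triangleleft>\<^bsub>M\<^esub> a) = q x \<triangleleft>\<^bsub>H\<^esub> a"
  shows "right_module A H"
proof -
  interpret right_module A M by fact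
  note hom = add[symmetric] smult[symmetric] zero
  show ?thesis
  proof (rule right_moduleI)
    fix x assume "x \<in> carrier H"
    then obtain u where u: "u \<in> carrier M" "x = q u" unfolding carr by blast
    then have "q (\<ominus>\<^bsub>M\<^esub> u) \<oplus>\<^bsub>H\<^esub> x = \<zero>\<^bsub>H\<^esub>" by (simp add: hom M.l_neg)
    then show "\<exists>y\<in>carrier H. y \<oplus>\<^bsub>H\<^esub> x = \<zero>\<^bsub>H\<^esub>" using u carr by blast
  qed (auto simp: carr hom R.ring_axioms rsmult_closed rsmult_add_left rsmult_add_right rsmult_assoc
      rsmult_one M.a_ac)
qed

lemma linear_mapsI:
  assumes "\<And>x. x \<in> carrier M \<Longrightarrow> f x \<in> carrier N"
    and "\<And>x y. \<lbrakk>x \<in> carrier M; y \<in> carrier M\<rbrakk> \<Longrightarrow> f (x \<oplus>\<^bsub>M\<^esub> y) = f x \<oplus>\<^bsub>N\<^esub> f y"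
    and "\<And>x a. \<lbrakk>x \<in> carrier M; a \<in> carrier A\<rbrakk> \<Longrightarrow> f (x \<triangleleft>\<^bsub>M\<^esub> a) = f x \<triangleleft>\<^bsub>N\<^esub> a"
  shows "f \<in> linear_maps A M N"
  using assms by (auto simp: linear_maps_def)

lemma lin_closed: "f \<in> linear_maps A M N \<Longrightarrow> x \<in> carrier M \<Longrightarrow> f x \<in> carrier N"
  by (auto simp: linear_maps_def)

lemma lin_add: "f \<in> linear_maps A M N \<Longrightarrow> x \<in> carrier M \<Longrightarrow> y \<in> carrier M \<Longrightarrow>
    f (x \<oplus>\<^bsub>M\<^esub> y) = f x \<oplus>\<^bsub>N\<^esub> f y"
  by (auto simp: linear_maps_def)

lemma lin_smult: "f \<in> linear_maps A M N \<Longrightarrow> x \<in> carrier M \<Longrightarrow> a \<in> carrier A \<Longrightarrow>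
    f (x \<triangleleft>\<^bsub>M\<^esub> a) = f x \<triangleleft>\<^bsub>N\<^esub> a"
  by (auto simp: linear_maps_def)

lemma lin_zero:
  assumes "f \<in> linear_maps A M N" "right_module A M" "right_module A N"
  shows "f \<zero>\<^bsub>M\<^esub> = \<zero>\<^bsub>N\<^esub>"
proof -
  interpret M: right_module A M by fact
  interpret N: right_module A N by fact
  show ?thesis
    using lin_add[OF assms(1), of "\<zero>\<^bsub>M\<^esub>" "\<zero>\<^bsub>M\<^esub>"] lin_closed[OF assms(1), of "\<zero>\<^bsub>M\<^esub>"]
    by (metis M.M.l_zero M.M.zero_closed N.M.double_zeroD)
qed

lemma lin_minus:
  assumes "f \<in> linear_maps A M N" "right_module A M" "right_module A N" "x \<in> carrier M"
  shows "f (\<ominus>\<^bsub>M\<^esub> x) = \<ominus>\<^bsub>N\<^esub> f x"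
proof -
  interpret M: right_module A M by fact
  interpret N: right_module A N by fact
  show ?thesis
    using lin_smult[OF assms(1,4), of "\<ominus>\<^bsub>A\<^esub> \<one>\<^bsub>A\<^esub>"] lin_closed[OF assms(1,4)]
    by (simp add: M.rsmult_minus_one N.rsmult_minus_one assms(4))
qed

lemma lin_diff:
  assumes "f \<in> linear_maps A M N" "right_module A M" "right_module A N"
    and "x \<in> carrier M" "y \<in> carrier M"
  shows "f (x \<ominus>\<^bsub>M\<^esub> y) = f x \<ominus>\<^bsub>N\<^esub> f y"
proof -
  interpret M: right_module A M by fact
  show ?thesis using assms by (simp add: a_minus_def lin_add lin_minus)
qed

lemma lin_comp: "f \<in> linear_maps A M N \<Longrightarrow> g \<in> linear_maps A N K \<Longrightarrow> (\<lambda>x. g (f x)) \<in> linear_maps A M K"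
  by (intro linear_mapsI) (simp_all add: lin_closed lin_add lin_smult)

lemma lin_id: "(\<lambda>x. x) \<in> linear_maps A M M"
  by (auto simp: linear_maps_def)

lemma lin_plus:
  assumes "f \<in> linear_maps A M N" "g \<in> linear_maps A M N" "right_module A N"
  shows "(\<lambda>x. f x \<oplus>\<^bsub>N\<^esub> g x) \<in> linear_maps A M N"
proof -
  interpret N: right_module A N by fact
  show ?thesis
    using assms
    by (intro linear_mapsI) (auto simp: lin_closed lin_add lin_smult N.rsmult_add_left N.M.a_ac)
qed

lemma lin_neg:
  assumes "f \<in> linear_maps A M N" "right_module A N"
  shows "(\<lambda>x. f x \<triangleleft>\<^bsub>N\<^esub> (\<ominus>\<^bsub>A\<^esub> \<one>\<^bsub>A\<^esub>)) \<in> linear_maps A M N"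
proof -
  interpret N: right_module A N by fact
  show ?thesis using assms
    by (intro linear_mapsI)
       (auto simp: lin_closed lin_add lin_smult N.rsmult_closed N.rsmult_minus_one N.minus_rsmult N.M.minus_add N.M.a_comm)
qed

lemma lin_const_zero:
  assumes "right_module A N"
  shows "(\<lambda>x. \<zero>\<^bsub>N\<^esub>) \<in> linear_maps A M N"
proof -
  interpret N: right_module A N by fact
  show ?thesis by (auto simp: linear_maps_def N.zero_rsmult)
qed

lemma lin_cong:
  assumes "f \<in> linear_maps A M N" "right_module A M" "\<And>x. x \<in> carrier M \<Longrightarrow> f x = g x"
  shows "g \<in> linear_maps A M N"
proof -
  interpret M: right_module A M by fact
  show ?thesis using assms(1) assms(3)[symmetric]
    by (auto simp: linear_maps_def M.rsmult_closed)
qed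

lemma lin_restrict_dom:
  "f \<in> linear_maps A M N \<Longrightarrow> S \<subseteq> carrier M \<Longrightarrow> f \<in> linear_maps A (M\<lparr>carrier := S\<rparr>) N"
  by (intro linear_mapsI) (auto simp: lin_closed lin_add lin_smult subset_iff)

lemma lin_restrict_cod:
  "f \<in> linear_maps A M N \<Longrightarrow> (\<And>x. x \<in> carrier M \<Longrightarrow> f x \<in> S) \<Longrightarrow> f \<in> linear_maps A M (N\<lparr>carrier := S\<rparr>)"
  by (auto simp: linear_maps_def)

lemma submodule_image:
  assumes "f \<in> linear_maps A M N" "right_module A M" "right_module A N"
  shows "submodule A N (f ` carrier M)"
proof -
  interpret M: right_module A M by fact
  show ?thesis unfolding submodule_def
  proof (intro conjI ballI)
    show "\<zero>\<^bsub>N\<^esub> \<in> f ` carrier M" using lin_zero[OF assms] by (metis M.M.zero_closed imageI)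
  next
    fix x y assume "x \<in> f ` carrier M" "y \<in> f ` carrier M"
    then show "x \<oplus>\<^bsub>N\<^esub> y \<in> f ` carrier M"
      using lin_add[OF assms(1)] by (metis (no_types, lifting) M.M.a_closed imageE imageI)
  next
    fix x a assume "x \<in> f ` carrier M" "a \<in> carrier A"
    then show "x \<triangleleft>\<^bsub>N\<^esub> a \<in> f ` carrier M"
      using lin_smult[OF assms(1)] M.rsmult_closed by (metis (no_types, lifting) imageE imageI)
  qed (auto simp: lin_closed[OF assms(1)])
qed

lemma submodule_kernel:
  assumes "f \<in> linear_maps A M N" "right_module A M" "right_module A N"
  shows "submodule A M {x \<in> carrier M. f x = \<zero>\<^bsub>N\<^esub>}"
proof -
  interpret M: right_module A M by fact
  interpret N: right_module A N by fact
  show ?thesis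
    using assms by (auto simp: submodule_def lin_zero lin_add lin_smult N.zero_rsmult M.rsmult_closed)
qed

lemma sum_module_simps [simp]:
  "carrier (sum_module M N) = carrier M \<times> carrier N"
  "\<zero>\<^bsub>sum_module M N\<^esub> = (\<zero>\<^bsub>M\<^esub>, \<zero>\<^bsub>N\<^esub>)"
  "(x, y) \<oplus>\<^bsub>sum_module M N\<^esub> (x', y') = (x \<oplus>\<^bsub>M\<^esub> x', y \<oplus>\<^bsub>N\<^esub> y')"
  "(x, y) \<triangleleft>\<^bsub>sum_module M N\<^esub> a = (x \<triangleleft>\<^bsub>M\<^esub> a, y \<triangleleft>\<^bsub>N\<^esub> a)"
  by (auto simp: sum_module_def)

lemma right_module_sum:
  assumes "right_module A M" "right_module A N"
  shows "right_module A (sum_module M N)"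
proof -
  interpret M: right_module A M by fact
  interpret N: right_module A N by fact
  show ?thesis
  proof (rule right_moduleI)
    fix x assume "x \<in> carrier (sum_module M N)"
    then show "\<exists>y\<in>carrier (sum_module M N). y \<oplus>\<^bsub>sum_module M N\<^esub> x = \<zero>\<^bsub>sum_module M N\<^esub>"
      by (intro bexI[of _ "(\<ominus>\<^bsub>M\<^esub> fst x, \<ominus>\<^bsub>N\<^esub> snd x)"]) (auto simp: M.M.l_neg N.M.l_neg)
  qed (use right_module_ring[OF assms(1)] in \<open>auto simp: M.M.a_ac N.M.a_ac M.rsmult_closed N.rsmult_closed
      M.rsmult_add_left M.rsmult_add_right M.rsmult_assoc M.rsmult_one N.rsmult_add_left N.rsmult_add_right
      N.rsmult_assoc N.rsmult_one\<close>)
qed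

subsection \<open>Quotient modules\<close>

context
  fixes A :: "('a, 'b) ring_scheme" and M :: "('a, 'm, 'c) rmodule_scheme" and N :: "'m set"
  assumes M: "right_module A M" and N: "submodule A M N"
begin

interpretation M: right_module A M by (rule M)

interpretation abelian_subgroup N M
proof (rule abelian_subgroupI3)
  show "additive_subgroup N M"
    using N submodule_minus[OF M N]
    by (intro additive_subgroupI subgroup.intro) (auto simp: submodule_def a_inv_def)
  show "abelian_group M" by (rule M.M.abelian_group_axioms)
qed

lemma quotient_module_carrier: "carrier (quotient_module M N) = (\<lambda>x. N +>\<^bsub>M\<^esub> x) ` carrier M"
  by (auto simp: quotient_module_def A_RCOSETS_def')

lemma quotient_module_zero: "\<zero>\<^bsub>quotient_module M N\<^esub> = N +>\<^bsub>M\<^esub> \<zero>\<^bsub>M\<^esub>"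
  using N by (simp add: quotient_module_def submodule_def)

lemma coset_add:
  "x \<in> carrier M \<Longrightarrow> y \<in> carrier M \<Longrightarrow>
    N +>\<^bsub>M\<^esub> (x \<oplus>\<^bsub>M\<^esub> y) = (N +>\<^bsub>M\<^esub> x) \<oplus>\<^bsub>quotient_module M N\<^esub> (N +>\<^bsub>M\<^esub> y)"
  by (simp add: quotient_module_def a_rcos_sum)

lemma coset_eq_iff:
  assumes "x \<in> carrier M" "y \<in> carrier M"
  shows "N +>\<^bsub>M\<^esub> x = N +>\<^bsub>M\<^esub> y \<longleftrightarrow> x \<ominus>\<^bsub>M\<^esub> y \<in> N"
proof
  assume "N +>\<^bsub>M\<^esub> x = N +>\<^bsub>M\<^esub> y"
  then have "x \<in> N +>\<^bsub>M\<^esub> y" using a_rcos_self[OF assms(1)] by simp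
  then show "x \<ominus>\<^bsub>M\<^esub> y \<in> N" using a_rcos_module[OF assms(2,1)] by (simp add: M.M.minus_eq)
next
  assume "x \<ominus>\<^bsub>M\<^esub> y \<in> N"
  then have "x \<in> N +>\<^bsub>M\<^esub> y" using a_rcos_module[OF assms(2,1)] by (simp add: M.M.minus_eq)
  then show "N +>\<^bsub>M\<^esub> x = N +>\<^bsub>M\<^esub> y" using a_repr_independence'[OF _ assms(2)] by metis
qed

lemma quotient_module_smult:
  assumes "x \<in> carrier M" "a \<in> carrier A"
  shows "(N +>\<^bsub>M\<^esub> x) \<triangleleft>\<^bsub>quotient_module M N\<^esub> a = N +>\<^bsub>M\<^esub> (x \<triangleleft>\<^bsub>M\<^esub> a)"
proof -
  have sub: "\<And>n. n \<in> N \<Longrightarrow> n \<in> carrier M" and cl: "\<And>n n'. n \<in> N \<Longrightarrow> n' \<in> N \<Longrightarrow> n \<oplus>\<^bsub>M\<^esub> n' \<in> N"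
    and sm: "\<And>n. n \<in> N \<Longrightarrow> n \<triangleleft>\<^bsub>M\<^esub> a \<in> N" and z: "\<zero>\<^bsub>M\<^esub> \<in> N"
    using N assms(2) by (auto simp: submodule_def)
  have xa: "x \<triangleleft>\<^bsub>M\<^esub> a \<in> carrier M" using assms by (rule M.rsmult_closed)
  have "n \<oplus>\<^bsub>M\<^esub> ((n' \<oplus>\<^bsub>M\<^esub> x) \<triangleleft>\<^bsub>M\<^esub> a) = (n \<oplus>\<^bsub>M\<^esub> n' \<triangleleft>\<^bsub>M\<^esub> a) \<oplus>\<^bsub>M\<^esub> x \<triangleleft>\<^bsub>M\<^esub> a"
    if "n \<in> N" "n' \<in> N" for n n'
    using that assms xa sm[of n'] by (simp add: M.rsmult_add_left sub M.M.a_assoc)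
  then have 1: "n \<oplus>\<^bsub>M\<^esub> ((n' \<oplus>\<^bsub>M\<^esub> x) \<triangleleft>\<^bsub>M\<^esub> a) \<in> N +>\<^bsub>M\<^esub> (x \<triangleleft>\<^bsub>M\<^esub> a)"
    if "n \<in> N" "n' \<in> N" for n n'
    using that cl[OF that(1) sm[OF that(2)]] by (auto simp: a_r_coset_def')
  have 2: "\<exists>n1 n2. n \<oplus>\<^bsub>M\<^esub> (x \<triangleleft>\<^bsub>M\<^esub> a) = n1 \<oplus>\<^bsub>M\<^esub> ((n2 \<oplus>\<^bsub>M\<^esub> x) \<triangleleft>\<^bsub>M\<^esub> a) \<and> n1 \<in> N \<and> n2 \<in> N"
    if "n \<in> N" for n
    using that assms z by (intro exI[of _ n] exI[of _ "\<zero>\<^bsub>M\<^esub>"]) simp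
  have "(N +>\<^bsub>M\<^esub> x) \<triangleleft>\<^bsub>quotient_module M N\<^esub> a
      = {n \<oplus>\<^bsub>M\<^esub> ((n' \<oplus>\<^bsub>M\<^esub> x) \<triangleleft>\<^bsub>M\<^esub> a) | n n'. n \<in> N \<and> n' \<in> N}"
    by (auto simp: quotient_module_def set_add_def' a_r_coset_def')
  also have "\<dots> = N +>\<^bsub>M\<^esub> (x \<triangleleft>\<^bsub>M\<^esub> a)"
    (is "?L = ?R")
  proof
    show "?L \<subseteq> ?R" using 1 by blast
    show "?R \<subseteq> ?L" unfolding a_r_coset_def' using 2 by blast
  qed
  finally show ?thesis .
qed

lemma right_module_quotient: "right_module A (quotient_module M N)"
  by (rule right_module_image[OF M quotient_module_carrier quotient_module_zero coset_add])
     (simp_all add: quotient_module_smult)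

lemma lin_coset: "(\<lambda>x. N +>\<^bsub>M\<^esub> x) \<in> linear_maps A M (quotient_module M N)"
  by (rule linear_mapsI) (simp_all add: quotient_module_carrier coset_add quotient_module_smult)

lemma coset_eq_zero_iff:
  assumes "x \<in> carrier M"
  shows "N +>\<^bsub>M\<^esub> x = \<zero>\<^bsub>quotient_module M N\<^esub> \<longleftrightarrow> x \<in> N"
proof -
  have "x \<ominus>\<^bsub>M\<^esub> \<zero>\<^bsub>M\<^esub> = x" using assms by algebra
  then show ?thesis using coset_eq_iff[OF assms M.M.zero_closed] by (simp add: quotient_module_zero)
qed

text \<open>
  Induced maps on homology and on quotient complexes send a coset to \<open>N\<close> plus its image; this identifies
  the result as a coset.
\<close>

lemma coset_set_add:
  assumes "x \<in> carrier M" "K \<subseteq> N" "\<zero>\<^bsub>M\<^esub> \<in> K"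
  shows "N <+>\<^bsub>M\<^esub> (K +>\<^bsub>M\<^esub> x) = N +>\<^bsub>M\<^esub> x"
proof -
  have sub: "\<And>n. n \<in> N \<Longrightarrow> n \<in> carrier M" and cl: "\<And>n n'. n \<in> N \<Longrightarrow> n' \<in> K \<Longrightarrow> n \<oplus>\<^bsub>M\<^esub> n' \<in> N"
    using N assms(2) by (auto simp: submodule_def)
  have "n \<oplus>\<^bsub>M\<^esub> (n' \<oplus>\<^bsub>M\<^esub> x) = (n \<oplus>\<^bsub>M\<^esub> n') \<oplus>\<^bsub>M\<^esub> x" if "n \<in> N" "n' \<in> K" for n n'
    using that assms sub by (subst M.M.a_assoc) auto
  then have 1: "n \<oplus>\<^bsub>M\<^esub> (n' \<oplus>\<^bsub>M\<^esub> x) \<in> N +>\<^bsub>M\<^esub> x" if "n \<in> N" "n' \<in> K" for n n'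
    using that cl by (auto simp: a_r_coset_def')
  have 2: "\<exists>n' k. n \<oplus>\<^bsub>M\<^esub> x = n' \<oplus>\<^bsub>M\<^esub> (k \<oplus>\<^bsub>M\<^esub> x) \<and> n' \<in> N \<and> k \<in> K" if "n \<in> N" for n
    using that assms by (intro exI[of _ n] exI[of _ "\<zero>\<^bsub>M\<^esub>"]) simp
  have "N <+>\<^bsub>M\<^esub> (K +>\<^bsub>M\<^esub> x) = {n \<oplus>\<^bsub>M\<^esub> (n' \<oplus>\<^bsub>M\<^esub> x) | n n'. n \<in> N \<and> n' \<in> K}"
    by (auto simp: set_add_def' a_r_coset_def')
  also have "\<dots> = N +>\<^bsub>M\<^esub> x"
    (is "?L = ?R")
  proof
    show "?L \<subseteq> ?R" using 1 by blast
    show "?R \<subseteq> ?L" unfolding a_r_coset_def' using 2 by blast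
  qed
  finally show ?thesis .
qed

end



section \<open>Finitely generated projective modules\<close>

lemma free_module_simps [simp]:
  "\<zero>\<^bsub>free_module A I\<^esub> = (\<lambda>i. \<zero>\<^bsub>A\<^esub>)"
  "c \<oplus>\<^bsub>free_module A I\<^esub> d = (\<lambda>i. c i \<oplus>\<^bsub>A\<^esub> d i)"
  "c \<triangleleft>\<^bsub>free_module A I\<^esub> a = (\<lambda>i. c i \<otimes>\<^bsub>A\<^esub> a)"
  by (auto simp: free_module_def)

lemma carrier_free_module:
  "c \<in> carrier (free_module A I) \<longleftrightarrow>
    (\<forall>i\<in>I. c i \<in> carrier A) \<and> (\<forall>i. i \<notin> I \<longrightarrow> c i = \<zero>\<^bsub>A\<^esub>) \<and> finite {i. c i \<noteq> \<zero>\<^bsub>A\<^esub>}"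
  by (simp add: free_module_def)

lemma free_module_coeff:
  assumes "ring A" "c \<in> carrier (free_module A I)" shows "c i \<in> carrier A"
  using assms abelian_groupE(2) ring.is_abelian_group by (cases "i \<in> I") (auto simp: carrier_free_module)

lemma right_module_free:
  fixes A :: "('a, 'b) ring_scheme" and I :: "'i set"
  assumes "ring A" shows "right_module A (free_module A I)"
proof -
  interpret A: ring A by fact
  note cl = free_module_coeff[OF assms]
  have fin: "finite {i. h (c i) (d i) \<noteq> \<zero>\<^bsub>A\<^esub>}"
    if "finite {i. c i \<noteq> \<zero>\<^bsub>A\<^esub>}" "finite {i. d i \<noteq> \<zero>\<^bsub>A\<^esub>}" "h \<zero>\<^bsub>A\<^esub> \<zero>\<^bsub>A\<^esub> = \<zero>\<^bsub>A\<^esub>" for c d :: "'i \<Rightarrow> 'a" and h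
    by (rule finite_subset[OF _ finite_UnI[OF that(1,2)]]) (use that(3) in auto)
  show ?thesis
  proof (rule right_moduleI)
    fix c :: "'i \<Rightarrow> 'a" assume c: "c \<in> carrier (free_module A I)"
    have "(\<lambda>i. \<ominus>\<^bsub>A\<^esub> c i) \<in> carrier (free_module A I)"
      using c fin[of c c "\<lambda>x _. \<ominus>\<^bsub>A\<^esub> x"] by (auto simp: carrier_free_module)
    then show "\<exists>y\<in>carrier (free_module A I). y \<oplus>\<^bsub>free_module A I\<^esub> c = \<zero>\<^bsub>free_module A I\<^esub>"
      using c cl[OF c] by (auto simp: A.l_neg intro!: bexI[of _ "\<lambda>i. \<ominus>\<^bsub>A\<^esub> c i"])
  next
    fix c d :: "'i \<Rightarrow> 'a" assume "c \<in> carrier (free_module A I)" "d \<in> carrier (free_module A I)"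
    then show "c \<oplus>\<^bsub>free_module A I\<^esub> d \<in> carrier (free_module A I)"
      using fin[of c d "add A"] by (auto simp: carrier_free_module)
  next
    fix c :: "'i \<Rightarrow> 'a" and a assume "c \<in> carrier (free_module A I)" "a \<in> carrier A"
    then show "c \<triangleleft>\<^bsub>free_module A I\<^esub> a \<in> carrier (free_module A I)"
      using fin[of c c "\<lambda>x _. x \<otimes>\<^bsub>A\<^esub> a"] by (auto simp: carrier_free_module)
  qed (auto simp: assms fun_eq_iff cl A.a_ac A.m_assoc A.l_distr A.r_distr, auto simp: carrier_free_module)
qed

definition unit_vector :: "('a, 'b) ring_scheme \<Rightarrow> 'i \<Rightarrow> 'i \<Rightarrow> 'a"
  where "unit_vector A i = (\<lambda>j. if j = i then \<one>\<^bsub>A\<^esub> else \<zero>\<^bsub>A\<^esub>)"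

lemma unit_vector_carrier:
  assumes "ring A" "i \<in> I" shows "unit_vector A i \<in> carrier (free_module A I)"
proof -
  interpret A: ring A by fact
  have "finite {j. unit_vector A i j \<noteq> \<zero>\<^bsub>A\<^esub>}"
    by (rule finite_subset[of _ "{i}"]) (auto simp: unit_vector_def)
  then show ?thesis using assms by (auto simp: carrier_free_module unit_vector_def)
qed

lemma free_module_induct [consumes 2, case_names zero add]:
  assumes A: "ring A" and c: "c \<in> carrier (free_module A I)"
    and zero: "P (\<lambda>i. \<zero>\<^bsub>A\<^esub>)"
    and add: "\<And>c i a. \<lbrakk>c \<in> carrier (free_module A I); P c; i \<in> I; a \<in> carrier A\<rbrakk> \<Longrightarrow>
      P (c \<oplus>\<^bsub>free_module A I\<^esub> (unit_vector A i \<triangleleft>\<^bsub>free_module A I\<^esub> a))"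
  shows "P c"
proof -
  interpret A: ring A by fact
  have "P c" if "finite F" "c \<in> carrier (free_module A I)" "{i. c i \<noteq> \<zero>\<^bsub>A\<^esub>} = F" for F c
    using that
  proof (induction F arbitrary: c rule: finite_induct)
    case empty
    then have "c = (\<lambda>i. \<zero>\<^bsub>A\<^esub>)" by auto
    then show ?case using zero by simp
  next
    case (insert i F)
    have cl: "c j \<in> carrier A" for j using free_module_coeff[OF A insert.prems(1)] .
    have i: "i \<in> I" "c i \<noteq> \<zero>\<^bsub>A\<^esub>" using insert.prems by (auto simp: carrier_free_module)
    have supp: "{j. (c(i := \<zero>\<^bsub>A\<^esub>)) j \<noteq> \<zero>\<^bsub>A\<^esub>} = F" using insert.prems(2) insert.hyps(2) by auto
    have c': "c(i := \<zero>\<^bsub>A\<^esub>) \<in> carrier (free_module A I)"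
      using insert.prems(1) insert.hyps(1) unfolding carrier_free_module supp by auto
    have "c = c(i := \<zero>\<^bsub>A\<^esub>) \<oplus>\<^bsub>free_module A I\<^esub> (unit_vector A i \<triangleleft>\<^bsub>free_module A I\<^esub> c i)"
      using cl by (auto simp: fun_eq_iff unit_vector_def)
    then show ?case using add[OF c' insert.IH[OF c' supp] i(1) cl[of i]] by simp
  qed
  then show ?thesis using c by (auto simp: carrier_free_module)
qed

lemma free_module_maps_eq:
  assumes f: "f \<in> linear_maps A (free_module A I) M" and g: "g \<in> linear_maps A (free_module A I) M"
    and M: "right_module A M" and eq: "\<And>i. i \<in> I \<Longrightarrow> f (unit_vector A i) = g (unit_vector A i)"
    and c: "c \<in> carrier (free_module A I)"
  shows "f c = g c"
proof -
  have A: "ring A" by (rule right_module_ring[OF M])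
  have F: "right_module A (free_module A I)" by (rule right_module_free[OF A])
  show ?thesis using A c
  proof (induction rule: free_module_induct)
    case zero
    then show ?case using lin_zero[OF f F M] lin_zero[OF g F M] by simp
  next
    case (add c i a)
    note u = unit_vector_carrier[OF A add.hyps(2)]
    have "f (unit_vector A i \<triangleleft>\<^bsub>free_module A I\<^esub> a) = g (unit_vector A i \<triangleleft>\<^bsub>free_module A I\<^esub> a)"
      using lin_smult[OF f u add.hyps(3)] lin_smult[OF g u add.hyps(3)] eq[OF add.hyps(2)] by simp
    then show ?case
      using lin_add[OF f add.hyps(1) right_module.rsmult_closed[OF F u add.hyps(3)]]
        lin_add[OF g add.hyps(1) right_module.rsmult_closed[OF F u add.hyps(3)]] add.IH by simp
  qed
qed

definition linear_extension ::
  "('a, 'b) ring_scheme \<Rightarrow> ('a, 'm, 'c) rmodule_scheme \<Rightarrow> ('i \<Rightarrow> 'm) \<Rightarrow> ('i \<Rightarrow> 'a) \<Rightarrow> 'm"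
  where "linear_extension A M g c = (\<Oplus>\<^bsub>M\<^esub>i\<in>{i. c i \<noteq> \<zero>\<^bsub>A\<^esub>}. g i \<triangleleft>\<^bsub>M\<^esub> c i)"

context
  fixes A :: "('a, 'b) ring_scheme" and M :: "('a, 'm, 'c) rmodule_scheme"
    and I :: "'i set" and g :: "'i \<Rightarrow> 'm"
  assumes M: "right_module A M" and g: "\<And>i. i \<in> I \<Longrightarrow> g i \<in> carrier M"
begin

interpretation M: right_module A M by (rule M)

lemma linear_extension_superset:
  assumes c: "c \<in> carrier (free_module A I)" and T: "finite T" "{i. c i \<noteq> \<zero>\<^bsub>A\<^esub>} \<subseteq> T" "T \<subseteq> I"
  shows "linear_extension A M g c = (\<Oplus>\<^bsub>M\<^esub>i\<in>T. g i \<triangleleft>\<^bsub>M\<^esub> c i)"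
proof -
  have cl: "c j \<in> carrier A" for j using free_module_coeff[OF right_module_ring[OF M] c] .
  have "(\<lambda>i. g i \<triangleleft>\<^bsub>M\<^esub> c i) \<in> T \<rightarrow> carrier M"
    by (intro Pi_I M.rsmult_closed g cl) (use T in auto)
  then show ?thesis unfolding linear_extension_def
    using T g M.rsmult_zero
    by (intro M.M.add.finprod_mono_neutral_cong_left) auto
qed

lemma linear_extension_linear: "linear_extension A M g \<in> linear_maps A (free_module A I) M"
proof (rule linear_mapsI)
  have A: "ring A" by (rule right_module_ring[OF M])
  interpret F: right_module A "free_module A I" by (rule right_module_free[OF A])
  have supp: "finite {i. c i \<noteq> \<zero>\<^bsub>A\<^esub>}" "{i. c i \<noteq> \<zero>\<^bsub>A\<^esub>} \<subseteq> I" if "c \<in> carrier (free_module A I)" for c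
    using that by (auto simp: carrier_free_module)
  note cl = free_module_coeff[OF A]
  have gc: "(\<lambda>i. g i \<triangleleft>\<^bsub>M\<^esub> c i) \<in> T \<rightarrow> carrier M" if "T \<subseteq> I" "c \<in> carrier (free_module A I)" for T c
    by (intro Pi_I M.rsmult_closed g cl[OF that(2)]) (use that in auto)
  {
    fix c assume c: "c \<in> carrier (free_module A I)"
    show "linear_extension A M g c \<in> carrier M"
      unfolding linear_extension_def using gc[OF supp(2)[OF c] c] by (rule M.M.finsum_closed)
    fix a assume a: "a \<in> carrier A"
    let ?T = "{i. c i \<noteq> \<zero>\<^bsub>A\<^esub>}"
    have fin: "(\<Oplus>\<^bsub>M\<^esub>i\<in>T. g i \<triangleleft>\<^bsub>M\<^esub> (c i \<otimes>\<^bsub>A\<^esub> a)) = (\<Oplus>\<^bsub>M\<^esub>i\<in>T. g i \<triangleleft>\<^bsub>M\<^esub> c i) \<triangleleft>\<^bsub>M\<^esub> a"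
      if "finite T" "T \<subseteq> I" for T
      using that
    proof (induction T rule: finite_induct)
      case empty
      show ?case by (simp add: M.zero_rsmult a)
    next
      case (insert i T)
      have 1: "(\<lambda>i. g i \<triangleleft>\<^bsub>M\<^esub> (c i \<otimes>\<^bsub>A\<^esub> a)) \<in> T \<rightarrow> carrier M"
        by (intro Pi_I M.rsmult_closed g M.R.m_closed cl[OF c] a) (use insert.prems in auto)
      show ?case
        using insert gc[OF _ c, of T] 1 g cl[OF c] a
        by (simp add: M.M.finsum_insert M.rsmult_add_left M.rsmult_assoc M.rsmult_closed M.M.finsum_closed)
    qed
    have ca: "c \<triangleleft>\<^bsub>free_module A I\<^esub> a \<in> carrier (free_module A I)" using c a by (rule F.rsmult_closed)
    have sub: "{i. (c \<triangleleft>\<^bsub>free_module A I\<^esub> a) i \<noteq> \<zero>\<^bsub>A\<^esub>} \<subseteq> ?T"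
    proof
      fix i assume "i \<in> {i. (c \<triangleleft>\<^bsub>free_module A I\<^esub> a) i \<noteq> \<zero>\<^bsub>A\<^esub>}"
      then show "i \<in> ?T" using M.R.l_null[OF a] by (cases "c i = \<zero>\<^bsub>A\<^esub>") auto
    qed
    have "linear_extension A M g (c \<triangleleft>\<^bsub>free_module A I\<^esub> a) = (\<Oplus>\<^bsub>M\<^esub>i\<in>?T. g i \<triangleleft>\<^bsub>M\<^esub> (c i \<otimes>\<^bsub>A\<^esub> a))"
      using linear_extension_superset[OF ca supp(1)[OF c] sub supp(2)[OF c]] by simp
    also have "\<dots> = linear_extension A M g c \<triangleleft>\<^bsub>M\<^esub> a"
      using fin[OF supp[OF c]] by (simp add: linear_extension_def)
    finally show "linear_extension A M g (c \<triangleleft>\<^bsub>free_module A I\<^esub> a) = linear_extension A M g c \<triangleleft>\<^bsub>M\<^esub> a" .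
  }
  fix c d assume c: "c \<in> carrier (free_module A I)" and d: "d \<in> carrier (free_module A I)"
  let ?T = "{i. c i \<noteq> \<zero>\<^bsub>A\<^esub>} \<union> {i. d i \<noteq> \<zero>\<^bsub>A\<^esub>}"
  have T: "finite ?T" "?T \<subseteq> I" using supp[OF c] supp[OF d] by auto
  have cd: "c \<oplus>\<^bsub>free_module A I\<^esub> d \<in> carrier (free_module A I)" using c d by (rule F.M.a_closed)
  have sub: "{i. (c \<oplus>\<^bsub>free_module A I\<^esub> d) i \<noteq> \<zero>\<^bsub>A\<^esub>} \<subseteq> ?T"
  proof
    fix i assume "i \<in> {i. (c \<oplus>\<^bsub>free_module A I\<^esub> d) i \<noteq> \<zero>\<^bsub>A\<^esub>}"
    then show "i \<in> ?T" by (cases "c i = \<zero>\<^bsub>A\<^esub> \<and> d i = \<zero>\<^bsub>A\<^esub>") auto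
  qed
  have "linear_extension A M g (c \<oplus>\<^bsub>free_module A I\<^esub> d) = (\<Oplus>\<^bsub>M\<^esub>i\<in>?T. g i \<triangleleft>\<^bsub>M\<^esub> (c i \<oplus>\<^bsub>A\<^esub> d i))"
    using linear_extension_superset[OF cd T(1) sub T(2)] by simp
  also have "\<dots> = (\<Oplus>\<^bsub>M\<^esub>i\<in>?T. g i \<triangleleft>\<^bsub>M\<^esub> c i \<oplus>\<^bsub>M\<^esub> g i \<triangleleft>\<^bsub>M\<^esub> d i)"
    using T(2) g cl[OF c] cl[OF d]
    by (intro M.M.finsum_cong') (auto intro!: M.rsmult_add_right M.rsmult_closed M.M.a_closed)
  also have "\<dots> = linear_extension A M g c \<oplus>\<^bsub>M\<^esub> linear_extension A M g d"
    using linear_extension_superset[OF c T(1) _ T(2)] linear_extension_superset[OF d T(1) _ T(2)]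
      M.M.finsum_addf[OF gc[OF T(2) c] gc[OF T(2) d]] by auto
  finally show "linear_extension A M g (c \<oplus>\<^bsub>free_module A I\<^esub> d)
    = linear_extension A M g c \<oplus>\<^bsub>M\<^esub> linear_extension A M g d" .
qed

lemma linear_extension_unit_vector:
  assumes "i \<in> I" shows "linear_extension A M g (unit_vector A i) = g i"
proof -
  have "linear_extension A M g (unit_vector A i) = (\<Oplus>\<^bsub>M\<^esub>j\<in>{i}. g j \<triangleleft>\<^bsub>M\<^esub> unit_vector A i j)"
    using assms right_module_ring[OF M]
    by (intro linear_extension_superset unit_vector_carrier) (auto simp: unit_vector_def)
  also have "\<dots> = g i" using assms g by (simp add: unit_vector_def M.rsmult_one)
  finally show ?thesis .
qed

end

definition retract_of ::
  "('a, 'b) ring_scheme \<Rightarrow> ('a, 'm, 'c) rmodule_scheme \<Rightarrow> ('a, 'n, 'd) rmodule_scheme \<Rightarrow> bool"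
  where "retract_of A M N \<longleftrightarrow> (\<exists>s\<in>linear_maps A M N. \<exists>p\<in>linear_maps A N M. \<forall>x\<in>carrier M. p (s x) = x)"

lemma retract_of_trans: "retract_of A M N \<Longrightarrow> retract_of A N K \<Longrightarrow> retract_of A M K"
proof -
  assume "retract_of A M N" "retract_of A N K"
  then obtain s p s' p' where s: "s \<in> linear_maps A M N" "s' \<in> linear_maps A N K"
    and p: "p \<in> linear_maps A N M" "p' \<in> linear_maps A K N"
    and ps: "\<forall>x\<in>carrier M. p (s x) = x" "\<forall>x\<in>carrier N. p' (s' x) = x"
    unfolding retract_of_def by blast
  then have "\<forall>x\<in>carrier M. p (p' (s' (s x))) = x" using lin_closed[OF s(1)] by simp
  then show "retract_of A M K" unfolding retract_of_def
    by (intro bexI[OF _ lin_comp[OF s]] bexI[OF _ lin_comp[OF p(2,1)]])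
qed

text \<open>
  Preimages chosen for the basis vectors extend linearly to the free module, and the section of the retraction
  restricts this extension to the retract.
\<close>

lemma retract_of_free_lift:
  assumes ret: "retract_of A P (free_module A I)" and P: "right_module A P"
    and L: "right_module A L" and N: "right_module A N"
    and \<beta>: "\<beta> \<in> linear_maps A L N" and \<alpha>: "\<alpha> \<in> linear_maps A P N"
    and im: "\<And>x. x \<in> carrier P \<Longrightarrow> \<alpha> x \<in> \<beta> ` carrier L"
  shows "\<exists>\<gamma>\<in>linear_maps A P L. \<forall>x\<in>carrier P. \<beta> (\<gamma> x) = \<alpha> x"
proof -
  have A: "ring A" by (rule right_module_ring[OF P])
  obtain s p where s: "s \<in> linear_maps A P (free_module A I)" and p: "p \<in> linear_maps A (free_module A I) P"
    and ps: "\<And>x. x \<in> carrier P \<Longrightarrow> p (s x) = x"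
    using ret unfolding retract_of_def by blast
  have "\<forall>i\<in>I. \<exists>l\<in>carrier L. \<beta> l = \<alpha> (p (unit_vector A i))"
    using im[OF lin_closed[OF p unit_vector_carrier[OF A]]] by (metis imageE)
  then obtain g where g: "\<And>i. i \<in> I \<Longrightarrow> g i \<in> carrier L"
    and \<beta>g: "\<And>i. i \<in> I \<Longrightarrow> \<beta> (g i) = \<alpha> (p (unit_vector A i))"
    by metis
  let ?E = "linear_extension A L g"
  have E: "?E \<in> linear_maps A (free_module A I) L" by (rule linear_extension_linear[OF L g])
  have "\<beta> (?E c) = \<alpha> (p c)" if "c \<in> carrier (free_module A I)" for c
    by (rule free_module_maps_eq[OF lin_comp[OF E \<beta>] lin_comp[OF p \<alpha>] N _ that])
       (simp add: linear_extension_unit_vector[OF L g] \<beta>g)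
  then show ?thesis
    using lin_comp[OF s E] lin_closed[OF s] ps by (intro bexI[of _ "\<lambda>x. ?E (s x)"]) auto
qed

text \<open>
  For a surjection \<open>p\<close> from a free module, the images of the basis vectors generate: the span of these images
  is itself the image of a linear map, hence a submodule, and it contains the value of \<open>p\<close> at each basis vector.
  So sums need not be regrouped when basis vectors have equal images.
\<close>

lemma finitely_generated_iff:
  assumes M: "right_module A M"
  shows "finitely_generated A M \<longleftrightarrow>
    (\<exists>n::nat. \<exists>p\<in>linear_maps A (free_module A {..<n}) M. p ` carrier (free_module A {..<n}) = carrier M)"
proof
  interpret M: right_module A M by fact
  assume "finitely_generated A M"
  then obtain S where S: "finite S" "S \<subseteq> carrier M"
    and gen: "\<And>x. x \<in> carrier M \<Longrightarrow> \<exists>c\<in>S \<rightarrow> carrier A. x = (\<Oplus>\<^bsub>M\<^esub>s\<in>S. s \<triangleleft>\<^bsub>M\<^esub> c s)"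
    unfolding finitely_generated_def by blast
  obtain n :: nat and h where h: "bij_betw h {..<n} S"
    using S(1) ex_bij_betw_nat_finite[of S] by (auto simp: atLeast0LessThan)
  have hS: "h i \<in> carrier M" if "i \<in> {..<n}" for i using bij_betwE[OF h] that S by blast
  let ?E = "linear_extension A M h"
  have E: "?E \<in> linear_maps A (free_module A {..<n}) M" by (rule linear_extension_linear[OF M hS])
  have "x \<in> ?E ` carrier (free_module A {..<n})" if x: "x \<in> carrier M" for x
  proof -
    obtain c where c: "c \<in> S \<rightarrow> carrier A" and xc: "x = (\<Oplus>\<^bsub>M\<^esub>s\<in>S. s \<triangleleft>\<^bsub>M\<^esub> c s)" using gen[OF x] by blast
    define d where "d i = (if i < n then c (h i) else \<zero>\<^bsub>A\<^esub>)" for i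
    have "finite {i. d i \<noteq> \<zero>\<^bsub>A\<^esub>}" by (rule finite_subset[of _ "{..<n}"]) (auto simp: d_def)
    then have d: "d \<in> carrier (free_module A {..<n})"
      using c bij_betwE[OF h] by (auto simp: carrier_free_module d_def)
    have "?E d = (\<Oplus>\<^bsub>M\<^esub>i\<in>{..<n}. h i \<triangleleft>\<^bsub>M\<^esub> d i)"
      by (rule linear_extension_superset[OF M hS d]) (auto simp: d_def)
    also have "\<dots> = (\<Oplus>\<^bsub>M\<^esub>i\<in>{..<n}. h i \<triangleleft>\<^bsub>M\<^esub> c (h i))"
      using bij_betwE[OF h] c hS by (intro M.M.finsum_cong') (auto simp: d_def intro!: M.rsmult_closed)
    also have "\<dots> = (\<Oplus>\<^bsub>M\<^esub>s\<in>h ` {..<n}. s \<triangleleft>\<^bsub>M\<^esub> c s)"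
      using h c S by (intro M.M.finsum_reindex[symmetric])
        (auto simp: bij_betw_def intro!: M.rsmult_closed)
    also have "\<dots> = x" using h xc by (simp add: bij_betw_def)
    finally show ?thesis using d by blast
  qed
  then show "\<exists>n::nat. \<exists>p\<in>linear_maps A (free_module A {..<n}) M. p ` carrier (free_module A {..<n}) = carrier M"
    using E lin_closed[OF E] by blast
next
  interpret M: right_module A M by fact
  have A: "ring A" by (rule right_module_ring[OF M])
  assume "\<exists>n::nat. \<exists>p\<in>linear_maps A (free_module A {..<n}) M. p ` carrier (free_module A {..<n}) = carrier M"
  then obtain n :: nat and p where p: "p \<in> linear_maps A (free_module A {..<n}) M"
    and surj: "p ` carrier (free_module A {..<n}) = carrier M" by blast
  define S where "S = (\<lambda>i. p (unit_vector A i)) ` {..<n}"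
  have S: "S \<subseteq> carrier M" "finite S" using lin_closed[OF p unit_vector_carrier[OF A]] by (auto simp: S_def)
  then have idS: "\<And>s. s \<in> S \<Longrightarrow> s \<in> carrier M" by auto
  let ?E = "linear_extension A M (\<lambda>s. s)"
  have E: "?E \<in> linear_maps A (free_module A S) M" by (rule linear_extension_linear[OF M idS])
  define T where "T = ?E ` carrier (free_module A S)"
  have sub: "submodule A M T" unfolding T_def
    by (rule submodule_image[OF E right_module_free[OF A] M])
  have pT: "p c \<in> T" if "c \<in> carrier (free_module A {..<n})" for c
    using A that
  proof (induction rule: free_module_induct)
    case zero
    show ?case using lin_zero[OF p right_module_free[OF A] M] sub by (simp add: submodule_def)
  next
    case (add c i a)
    note u = unit_vector_carrier[OF A add.hyps(2)]
    have pS: "p (unit_vector A i) \<in> S" using add.hyps(2) by (auto simp: S_def)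
    have "p (unit_vector A i) \<in> T" unfolding T_def
      by (rule image_eqI[OF _ unit_vector_carrier[OF A pS]])
         (rule linear_extension_unit_vector[OF M idS pS, symmetric])
    then show ?case
      using lin_add[OF p add.hyps(1) right_module.rsmult_closed[OF right_module_free[OF A] u add.hyps(3)]]
        lin_smult[OF p u add.hyps(3)] add.IH add.hyps(3) sub by (simp add: submodule_def)
  qed
  have gen: "x \<in> T" if "x \<in> carrier M" for x
    using that pT unfolding surj[symmetric] by blast
  show "finitely_generated A M" unfolding finitely_generated_def
  proof (intro exI[of _ S] conjI ballI)
    fix x assume "x \<in> carrier M"
    then obtain c where c: "c \<in> carrier (free_module A S)" "x = ?E c"
      using gen[of x] unfolding T_def by (metis imageE)
    have "x = (\<Oplus>\<^bsub>M\<^esub>s\<in>S. s \<triangleleft>\<^bsub>M\<^esub> c s)" unfolding c(2)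
      using c(1) S(2) by (intro linear_extension_superset[OF M idS c(1)]) (auto simp: carrier_free_module)
    then show "\<exists>c\<in>S \<rightarrow> carrier A. x = (\<Oplus>\<^bsub>M\<^esub>s\<in>S. s \<triangleleft>\<^bsub>M\<^esub> c s)"
      using c(1) by (intro bexI[of _ c]) (auto simp: carrier_free_module)
  qed (use S in auto)
qed

text \<open>
  The index set of the free module no longer lives in the type of \<open>M\<close>, which makes retracts, direct sums and
  changes of the underlying type easy to treat.
\<close>

lemma retract_of_free_finite_rank:
  fixes A :: "('a, 'b) ring_scheme" and M :: "('a, 'm, 'c) rmodule_scheme"
  assumes M: "right_module A M"
  shows "fg_projective A M \<longleftrightarrow> (\<exists>n::nat. retract_of A M (free_module A {..<n}))"
proof
  have A: "ring A" by (rule right_module_ring[OF M])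
  assume fgp: "fg_projective A M"
  then obtain n :: nat and p where p: "p \<in> linear_maps A (free_module A {..<n}) M"
    and surj: "p ` carrier (free_module A {..<n}) = carrier M"
    unfolding fg_projective_def finitely_generated_iff[OF M] by blast
  obtain I :: "'m set" where "retract_of A M (free_module A I)"
    using fgp unfolding fg_projective_def projective_def retract_of_def by blast
  then obtain s where "s \<in> linear_maps A M (free_module A {..<n})" "\<forall>x\<in>carrier M. p (s x) = x"
    using retract_of_free_lift[OF _ M right_module_free[OF A] M p lin_id] surj by blast
  then show "\<exists>n::nat. retract_of A M (free_module A {..<n})"
    using p unfolding retract_of_def by blast
next
  have A: "ring A" by (rule right_module_ring[OF M])
  assume "\<exists>n::nat. retract_of A M (free_module A {..<n})"
  then obtain n :: nat where ret: "retract_of A M (free_module A {..<n})" by blast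
  then obtain s p where s: "s \<in> linear_maps A M (free_module A {..<n})" and p: "p \<in> linear_maps A (free_module A {..<n}) M"
    and ps: "\<And>x. x \<in> carrier M \<Longrightarrow> p (s x) = x" unfolding retract_of_def by blast
  have "p ` carrier (free_module A {..<n}) = carrier M"
    using lin_closed[OF p] lin_closed[OF s] ps by (metis image_subset_iff subsetI subset_antisym imageI)
  then have fg: "finitely_generated A M" using finitely_generated_iff[OF M] p by blast
  \<comment> \<open>The index set in the definition has to consist of elements of \<open>M\<close>: use all of them.\<close>
  let ?E = "linear_extension A M id :: ('m \<Rightarrow> 'a) \<Rightarrow> 'm"
  have E: "?E \<in> linear_maps A (free_module A (carrier M)) M"
    by (rule linear_extension_linear[OF M]) simp
  have "x \<in> ?E ` carrier (free_module A (carrier M))" if "x \<in> carrier M" for x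
    using linear_extension_unit_vector[OF M, of "carrier M" id x] that unit_vector_carrier[OF A that]
    by (metis id_apply imageI)
  then obtain s' where "s' \<in> linear_maps A M (free_module A (carrier M))" "\<forall>x\<in>carrier M. ?E (s' x) = x"
    using retract_of_free_lift[OF ret M right_module_free[OF A] M E lin_id] by blast
  then have "projective A M" unfolding projective_def using E by blast
  then show "fg_projective A M" using fg by (simp add: fg_projective_def)
qed

lemma fg_projective_retract:
  assumes "fg_projective A N" "retract_of A M N" "right_module A M" "right_module A N"
  shows "fg_projective A M"
proof -
  obtain n :: nat where "retract_of A N (free_module A {..<n})"
    using assms(1) retract_of_free_finite_rank[OF assms(4)] by blast
  then have "retract_of A M (free_module A {..<n})" by (rule retract_of_trans[OF assms(2)])
  then show ?thesis using retract_of_free_finite_rank[OF assms(3)] by blast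
qed

lemma fg_projective_lift:
  assumes "fg_projective A P" "right_module A P" "right_module A L" "right_module A N"
    and "\<beta> \<in> linear_maps A L N" "\<alpha> \<in> linear_maps A P N"
    and "\<And>x. x \<in> carrier P \<Longrightarrow> \<alpha> x \<in> \<beta> ` carrier L"
  shows "\<exists>\<gamma>\<in>linear_maps A P L. \<forall>x\<in>carrier P. \<beta> (\<gamma> x) = \<alpha> x"
proof -
  obtain n :: nat where "retract_of A P (free_module A {..<n})"
    using assms(1) retract_of_free_finite_rank[OF assms(2)] by blast
  then show ?thesis by (rule retract_of_free_lift[OF _ assms(2-7)])
qed

lemma fg_projective_zero:
  assumes M: "right_module A M" and "zero_module M" shows "fg_projective A M"
proof -
  have "retract_of A M (free_module A {..<0::nat})" unfolding retract_of_def
    using assms(2) lin_const_zero[OF M] lin_const_zero[OF right_module_free[OF right_module_ring[OF M]]]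
    by (intro bexI[of _ "\<lambda>x. \<zero>\<^bsub>free_module A {..<0::nat}\<^esub>"] bexI[of _ "\<lambda>x. \<zero>\<^bsub>M\<^esub>"]) (auto simp: zero_module_def)
  then show ?thesis using retract_of_free_finite_rank[OF M] by blast
qed

lemma fg_projective_sum:
  assumes M: "right_module A M" and N: "right_module A N" and "fg_projective A M" "fg_projective A N"
  shows "fg_projective A (sum_module M N)"
proof -
  have A: "ring A" by (rule right_module_ring[OF M])
  interpret A: ring A by fact
  obtain k :: nat and s p where s: "s \<in> linear_maps A M (free_module A {..<k})" and p: "p \<in> linear_maps A (free_module A {..<k}) M"
    and ps: "\<And>x. x \<in> carrier M \<Longrightarrow> p (s x) = x"
    using assms retract_of_free_finite_rank[OF M] unfolding retract_of_def by blast
  obtain l :: nat and s' p' where s': "s' \<in> linear_maps A N (free_module A {..<l})" and p': "p' \<in> linear_maps A (free_module A {..<l}) N"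
    and ps': "\<And>x. x \<in> carrier N \<Longrightarrow> p' (s' x) = x"
    using assms retract_of_free_finite_rank[OF N] unfolding retract_of_def by blast
  have fin: "finite {i::nat. c i \<noteq> \<zero>\<^bsub>A\<^esub>} \<longleftrightarrow> True" if "\<And>i. i \<ge> n \<Longrightarrow> c i = \<zero>\<^bsub>A\<^esub>" for c n
  proof -
    have "{i. c i \<noteq> \<zero>\<^bsub>A\<^esub>} \<subseteq> {..<n}" using that by (auto simp: not_le[symmetric])
    then show ?thesis by (simp add: finite_subset)
  qed
  have carr: "c \<in> carrier (free_module A {..<n}) \<longleftrightarrow> (\<forall>i<n. c i \<in> carrier A) \<and> (\<forall>i\<ge>n. c i = \<zero>\<^bsub>A\<^esub>)"
    for c :: "nat \<Rightarrow> 'a" and n :: nat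
    using fin[of n c] by (auto simp: carrier_free_module not_less)
  define S where "S = (\<lambda>(x, y) i. if i < k then s x i else s' y (i - k))"
  define Q where "Q = (\<lambda>c. (p (\<lambda>i. if i < k then c i else \<zero>\<^bsub>A\<^esub>), p' (\<lambda>i. c (i + k))))"
  have sc: "s x i \<in> carrier A" "i \<ge> k \<Longrightarrow> s x i = \<zero>\<^bsub>A\<^esub>" if "x \<in> carrier M" for x i
    using lin_closed[OF s that] free_module_coeff[OF A lin_closed[OF s that]] by (auto simp: carr)
  have sc': "s' x i \<in> carrier A" "i \<ge> l \<Longrightarrow> s' x i = \<zero>\<^bsub>A\<^esub>" if "x \<in> carrier N" for x i
    using lin_closed[OF s' that] free_module_coeff[OF A lin_closed[OF s' that]] by (auto simp: carr)
  have "S \<in> linear_maps A (sum_module M N) (free_module A {..<k + l})"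
    by (rule linear_mapsI)
       (auto simp: S_def carr sc sc' fun_eq_iff lin_add[OF s] lin_add[OF s'] lin_smult[OF s] lin_smult[OF s'])
  moreover have "Q \<in> linear_maps A (free_module A {..<k + l}) (sum_module M N)"
  proof (rule linear_mapsI)
    have cut: "(\<lambda>i. if i < k then c i else \<zero>\<^bsub>A\<^esub>) \<in> carrier (free_module A {..<k})"
      "(\<lambda>i. c (i + k)) \<in> carrier (free_module A {..<l})"
      if "c \<in> carrier (free_module A {..<k + l})" for c using that by (auto simp: carr)
    fix c assume c: "c \<in> carrier (free_module A {..<k + l})"
    then show "Q c \<in> carrier (sum_module M N)"
      using cut[OF c] lin_closed[OF p] lin_closed[OF p'] by (simp add: Q_def)
    {
      fix d assume d: "d \<in> carrier (free_module A {..<k + l})"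
      have "(\<lambda>i. if i < k then c i \<oplus>\<^bsub>A\<^esub> d i else \<zero>\<^bsub>A\<^esub>)
        = (\<lambda>i. if i < k then c i else \<zero>\<^bsub>A\<^esub>) \<oplus>\<^bsub>free_module A {..<k}\<^esub> (\<lambda>i. if i < k then d i else \<zero>\<^bsub>A\<^esub>)"
        by (auto simp: fun_eq_iff)
      then show "Q (c \<oplus>\<^bsub>free_module A {..<k + l}\<^esub> d) = Q c \<oplus>\<^bsub>sum_module M N\<^esub> Q d"
        using lin_add[OF p cut(1)[OF c] cut(1)[OF d]] lin_add[OF p' cut(2)[OF c] cut(2)[OF d]]
        by (simp add: Q_def)
    }
    {
      fix a assume a: "a \<in> carrier A"
      have "(\<lambda>i. if i < k then c i \<otimes>\<^bsub>A\<^esub> a else \<zero>\<^bsub>A\<^esub>)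
        = (\<lambda>i. if i < k then c i else \<zero>\<^bsub>A\<^esub>) \<triangleleft>\<^bsub>free_module A {..<k}\<^esub> a"
        using a by (auto simp: fun_eq_iff)
      then show "Q (c \<triangleleft>\<^bsub>free_module A {..<k + l}\<^esub> a) = Q c \<triangleleft>\<^bsub>sum_module M N\<^esub> a"
        using lin_smult[OF p cut(1)[OF c] a] lin_smult[OF p' cut(2)[OF c] a]
        by (simp add: Q_def)
    }
  qed
  moreover have "Q (S z) = z" if zc: "z \<in> carrier (sum_module M N)" for z
  proof -
    obtain x y where z: "z = (x, y)" "x \<in> carrier M" "y \<in> carrier N"
      using zc by auto
    have "(\<lambda>i. if i < k then s x i else \<zero>\<^bsub>A\<^esub>) = s x" using sc[OF z(2)] by (auto simp: fun_eq_iff)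
    then show ?thesis using z by (simp add: Q_def S_def ps ps' cong: if_cong)
  qed
  ultimately show ?thesis
    unfolding retract_of_free_finite_rank[OF right_module_sum[OF M N]] retract_of_def by blast
qed


lemma lin_pair:
  "f \<in> linear_maps A M N \<Longrightarrow> g \<in> linear_maps A M K \<Longrightarrow> (\<lambda>x. (f x, g x)) \<in> linear_maps A M (sum_module N K)"
  by (intro linear_mapsI) (auto simp: lin_closed lin_add lin_smult)

lemma lin_fst: "fst \<in> linear_maps A (sum_module M N) M"
  by (rule linear_mapsI) auto

lemma lin_snd: "snd \<in> linear_maps A (sum_module M N) N"
  by (rule linear_mapsI) auto

lemma lin_on_fst: "f \<in> linear_maps A M K \<Longrightarrow> (\<lambda>z. f (fst z)) \<in> linear_maps A (sum_module M N) K"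
  by (rule lin_comp[OF lin_fst])

lemma lin_on_snd: "f \<in> linear_maps A N K \<Longrightarrow> (\<lambda>z. f (snd z)) \<in> linear_maps A (sum_module M N) K"
  by (rule lin_comp[OF lin_snd])

lemma lin_diff_maps:
  assumes "f \<in> linear_maps A M N" "g \<in> linear_maps A M N" "right_module A M" "right_module A N"
  shows "(\<lambda>x. f x \<ominus>\<^bsub>N\<^esub> g x) \<in> linear_maps A M N"
  by (rule lin_cong[OF lin_plus[OF assms(1) lin_neg[OF assms(2,4)] assms(4)] assms(3)])
     (simp add: right_module.rsmult_minus_one[OF assms(4)] lin_closed[OF assms(2)] a_minus_def)



section \<open>Chain complexes and quasi-isomorphisms\<close>

lemma cpx_module: "A_complex A C \<Longrightarrow> right_module A (obj C i)"
  by (simp add: A_complex_def)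

lemma cpx_lin: "A_complex A C \<Longrightarrow> bdry C i \<in> linear_maps A (obj C i) (obj C (i - 1))"
  by (simp add: A_complex_def)

lemma cpx_closed:
  "A_complex A C \<Longrightarrow> x \<in> carrier (obj C i) \<Longrightarrow> bdry C i x \<in> carrier (obj C (i - 1))"
  by (rule lin_closed[OF cpx_lin])

lemma cpx_closed':
  "A_complex A C \<Longrightarrow> x \<in> carrier (obj C (i + 1)) \<Longrightarrow> bdry C (i + 1) x \<in> carrier (obj C i)"
  using cpx_closed[of A C x "i + 1"] by simp

lemma cpx_dd:
  "A_complex A C \<Longrightarrow> x \<in> carrier (obj C i) \<Longrightarrow> bdry C (i - 1) (bdry C i x) = \<zero>\<^bsub>obj C (i - 2)\<^esub>"
  by (simp add: A_complex_def)

lemma cpx_dd':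
  "A_complex A C \<Longrightarrow> x \<in> carrier (obj C (i + 1)) \<Longrightarrow> bdry C i (bdry C (i + 1) x) = \<zero>\<^bsub>obj C (i - 1)\<^esub>"
  using cpx_dd[of A C x "i + 1"] by simp

lemma cpx_d_zero: "A_complex A C \<Longrightarrow> bdry C i \<zero>\<^bsub>obj C i\<^esub> = \<zero>\<^bsub>obj C (i - 1)\<^esub>"
  by (rule lin_zero[OF cpx_lin cpx_module cpx_module])

lemma cpx_zero_closed: "A_complex A C \<Longrightarrow> \<zero>\<^bsub>obj C i\<^esub> \<in> carrier (obj C i)"
  using cpx_module by (metis abelian_groupE(2) right_module_def)

lemma cpx_negative: "A_complex A C \<Longrightarrow> i < 0 \<Longrightarrow> x \<in> carrier (obj C i) \<Longrightarrow> x = \<zero>\<^bsub>obj C i\<^esub>"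
  by (auto simp: A_complex_def zero_module_def)

lemma map_lin: "A_map A f C D \<Longrightarrow> f i \<in> linear_maps A (obj C i) (obj D i)"
  by (simp add: A_map_def)

lemma map_closed: "A_map A f C D \<Longrightarrow> x \<in> carrier (obj C i) \<Longrightarrow> f i x \<in> carrier (obj D i)"
  by (rule lin_closed[OF map_lin])

lemma map_bdry: "A_map A f C D \<Longrightarrow> x \<in> carrier (obj C i) \<Longrightarrow> f (i - 1) (bdry C i x) = bdry D i (f i x)"
  by (simp add: A_map_def)

lemma map_bdry':
  "A_map A f C D \<Longrightarrow> x \<in> carrier (obj C (i + 1)) \<Longrightarrow> f i (bdry C (i + 1) x) = bdry D (i + 1) (f (i + 1) x)"
  using map_bdry[of A f C D x "i + 1"] by simp

lemma map_comp: "A_map A f C D \<Longrightarrow> A_map A g D E \<Longrightarrow> A_map A (\<lambda>i x. g i (f i x)) C E"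
  unfolding A_map_def using lin_comp by (metis lin_closed)

lemma submodule_cycles: "A_complex A C \<Longrightarrow> submodule A (obj C i) (cycles C i)"
  unfolding cycles_def by (rule submodule_kernel[OF cpx_lin cpx_module cpx_module])

lemma submodule_boundaries: "A_complex A C \<Longrightarrow> submodule A (obj C i) (boundaries C i)"
  unfolding boundaries_def
  using submodule_image[OF cpx_lin cpx_module cpx_module, of A C "i + 1"] by simp

lemma boundaries_subset_cycles: "A_complex A C \<Longrightarrow> boundaries C i \<subseteq> cycles C i"
  by (auto simp: boundaries_def cycles_def cpx_closed' cpx_dd')

lemma right_module_cycles: "A_complex A C \<Longrightarrow> right_module A ((obj C i)\<lparr>carrier := cycles C i\<rparr>)"
  by (rule right_module_restrict[OF cpx_module submodule_cycles])

lemma submodule_boundaries_cycles: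
  "A_complex A C \<Longrightarrow> submodule A ((obj C i)\<lparr>carrier := cycles C i\<rparr>) (boundaries C i)"
  using submodule_boundaries[of A C i] boundaries_subset_cycles[of A C i] by (auto simp: submodule_def)

lemma right_module_homology: "A_complex A C \<Longrightarrow> right_module A (homology C i)"
  unfolding homology_def by (rule right_module_quotient[OF right_module_cycles submodule_boundaries_cycles])

definition hclass :: "('a, 'm, 'c) cpx_scheme \<Rightarrow> int \<Rightarrow> 'm \<Rightarrow> 'm set"
  where "hclass C i x = boundaries C i +>\<^bsub>obj C i\<^esub> x"

lemma hclass_restrict: "hclass C i = (\<lambda>x. boundaries C i +>\<^bsub>(obj C i)\<lparr>carrier := S\<rparr>\<^esub> x)"
  by (simp add: hclass_def a_r_coset_def' fun_eq_iff)

lemma lin_hclass: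
  "A_complex A C \<Longrightarrow> hclass C i \<in> linear_maps A ((obj C i)\<lparr>carrier := cycles C i\<rparr>) (homology C i)"
  unfolding hclass_restrict[of C i "cycles C i"] homology_def
  by (rule lin_coset[OF right_module_cycles submodule_boundaries_cycles])

lemma homology_carrier: "A_complex A C \<Longrightarrow> carrier (homology C i) = hclass C i ` cycles C i"
  unfolding hclass_restrict[of C i "cycles C i"] homology_def
  by (simp add: quotient_module_carrier[OF right_module_cycles submodule_boundaries_cycles])

lemma hclass_eq_iff:
  assumes C: "A_complex A C" and x: "x \<in> cycles C i" and y: "y \<in> cycles C i"
  shows "hclass C i x = hclass C i y \<longleftrightarrow> (\<exists>w\<in>carrier (obj C (i + 1)). x \<ominus>\<^bsub>obj C i\<^esub> y = bdry C (i + 1) w)"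
  unfolding hclass_def using coset_eq_iff[OF cpx_module[OF C] submodule_boundaries[OF C]] x y
  by (auto simp: cycles_def boundaries_def)

lemma hclass_eq_zero_iff:
  assumes C: "A_complex A C" and x: "x \<in> cycles C i"
  shows "hclass C i x = \<zero>\<^bsub>homology C i\<^esub> \<longleftrightarrow> x \<in> boundaries C i"
  unfolding hclass_restrict[of C i "cycles C i"] homology_def
  using coset_eq_zero_iff[OF right_module_cycles[OF C] submodule_boundaries_cycles[OF C]] x by simp

lemma zero_homology_iff:
  assumes C: "A_complex A C"
  shows "zero_module (homology C i) \<longleftrightarrow> cycles C i \<subseteq> boundaries C i"
proof
  assume z: "zero_module (homology C i)"
  show "cycles C i \<subseteq> boundaries C i"
  proof
    fix x assume x: "x \<in> cycles C i"
    then have "hclass C i x \<in> carrier (homology C i)" by (simp add: homology_carrier[OF C])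
    then show "x \<in> boundaries C i" using z by (simp add: zero_module_def hclass_eq_zero_iff[OF C x])
  qed
next
  assume *: "cycles C i \<subseteq> boundaries C i"
  have "\<zero>\<^bsub>obj C i\<^esub> \<in> cycles C i" using submodule_cycles[OF C, of i] by (simp add: submodule_def)
  then show "zero_module (homology C i)"
    using * hclass_eq_zero_iff[OF C, of _ i] homology_carrier[OF C, of i] by (auto simp: zero_module_def)
qed

lemma homology_map_hclass:
  assumes C: "A_complex A C" and D: "A_complex A D" and f: "A_map A f C D" and x: "x \<in> cycles C i"
  shows "homology_map f D i (hclass C i x) = hclass D i (f i x)"
proof -
  interpret Ci: right_module A "obj C i" by (rule cpx_module[OF C])
  have xc: "x \<in> carrier (obj C i)" using x by (simp add: cycles_def)
  have B: "b \<in> carrier (obj C i)" if "b \<in> boundaries C i" for b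
    using that submodule_boundaries[OF C, of i] by (auto simp: submodule_def)
  have "f i ` boundaries C i \<subseteq> boundaries D i"
    using map_bdry'[OF f] map_closed[OF f] by (auto simp: boundaries_def)
  moreover have "\<zero>\<^bsub>obj D i\<^esub> \<in> f i ` boundaries C i"
    using lin_zero[OF map_lin[OF f] cpx_module[OF C] cpx_module[OF D], of i, symmetric]
      submodule_boundaries[OF C, of i] by (auto simp: submodule_def)
  moreover have "f i ` hclass C i x = (f i ` boundaries C i) +>\<^bsub>obj D i\<^esub> f i x"
    by (simp add: hclass_def a_r_coset_def' image_UN lin_add[OF map_lin[OF f] B xc] cong: SUP_cong_simp)
  ultimately show ?thesis
    unfolding homology_map_def hclass_def[of D]
    using coset_set_add[OF cpx_module[OF D] submodule_boundaries[OF D] map_closed[OF f xc]] by simp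
qed

text \<open>
  This says, in terms of elements, that the mapping cone of \<open>f\<close> is acyclic: the pair of \<open>y\<close> and \<open>- x\<close> is a cycle
  of the cone, and the conclusion says that it is a boundary.
\<close>

definition weak_equiv :: "(int \<Rightarrow> 'm \<Rightarrow> 'n) \<Rightarrow> ('a, 'm, 'c) cpx_scheme \<Rightarrow> ('a, 'n, 'd) cpx_scheme \<Rightarrow> bool"
  where "weak_equiv f C D \<longleftrightarrow>
    (\<forall>i. \<forall>x\<in>carrier (obj C i). \<forall>y\<in>carrier (obj D (i + 1)).
      bdry C i x = \<zero>\<^bsub>obj C (i - 1)\<^esub> \<longrightarrow> f i x = bdry D (i + 1) y \<longrightarrow>
      (\<exists>x'\<in>carrier (obj C (i + 1)). \<exists>y'\<in>carrier (obj D (i + 2)).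
        bdry C (i + 1) x' = x \<and> y = f (i + 1) x' \<oplus>\<^bsub>obj D (i + 1)\<^esub> bdry D (i + 2) y'))"

lemma weak_equivD:
  assumes "weak_equiv f C D" "x \<in> carrier (obj C i)" "y \<in> carrier (obj D (i + 1))"
    and "bdry C i x = \<zero>\<^bsub>obj C (i - 1)\<^esub>" "f i x = bdry D (i + 1) y"
  obtains x' y' where "x' \<in> carrier (obj C (i + 1))" "y' \<in> carrier (obj D (i + 2))"
    and "bdry C (i + 1) x' = x" "y = f (i + 1) x' \<oplus>\<^bsub>obj D (i + 1)\<^esub> bdry D (i + 2) y'"
  using assms unfolding weak_equiv_def by blast

text \<open>
  The case of the cycle \<open>0\<close> in the cone condition one degree lower.
\<close>

lemma weak_equiv_surj:
  assumes "weak_equiv f C D" "A_complex A C" "A_complex A D" "A_map A f C D"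
    and "y \<in> carrier (obj D i)" "bdry D i y = \<zero>\<^bsub>obj D (i - 1)\<^esub>"
  obtains x y' where "x \<in> carrier (obj C i)" "bdry C i x = \<zero>\<^bsub>obj C (i - 1)\<^esub>" "y' \<in> carrier (obj D (i + 1))"
    and "y = f i x \<oplus>\<^bsub>obj D i\<^esub> bdry D (i + 1) y'"
proof -
  have "\<zero>\<^bsub>obj C (i - 1)\<^esub> \<in> carrier (obj C (i - 1))"
    "bdry C (i - 1) \<zero>\<^bsub>obj C (i - 1)\<^esub> = \<zero>\<^bsub>obj C (i - 1 - 1)\<^esub>"
    using assms(2) by (auto simp: cpx_zero_closed cpx_d_zero)
  moreover have "y \<in> carrier (obj D (i - 1 + 1))" "f (i - 1) \<zero>\<^bsub>obj C (i - 1)\<^esub> = bdry D (i - 1 + 1) y"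
    using assms lin_zero[OF map_lin[OF assms(4)] cpx_module cpx_module, of "i - 1"] by auto
  ultimately obtain x y' where "x \<in> carrier (obj C (i - 1 + 1))" "y' \<in> carrier (obj D (i - 1 + 2))"
    "bdry C (i - 1 + 1) x = \<zero>\<^bsub>obj C (i - 1)\<^esub>" "y = f (i - 1 + 1) x \<oplus>\<^bsub>obj D (i - 1 + 1)\<^esub> bdry D (i - 1 + 2) y'"
    using weak_equivD[OF assms(1)] by metis
  then show thesis using that[of x y'] by (simp add: add.commute)
qed

lemma cpx_closed'':
  "A_complex A C \<Longrightarrow> x \<in> carrier (obj C (i + 2)) \<Longrightarrow> bdry C (i + 2) x \<in> carrier (obj C (i + 1))"
  using cpx_closed[of A C x "i + 2"] by (simp add: add.commute)

lemma cpx_lin': "A_complex A C \<Longrightarrow> bdry C (i + 1) \<in> linear_maps A (obj C (i + 1)) (obj C i)"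
  using cpx_lin[of A C "i + 1"] by simp

lemma cpx_lin'': "A_complex A C \<Longrightarrow> bdry C (i + 2) \<in> linear_maps A (obj C (i + 2)) (obj C (i + 1))"
  using cpx_lin[of A C "i + 2"] by (simp add: add.commute)

lemma quasi_iso_iff_weak_equiv:
  assumes C: "A_complex A C" and D: "A_complex A D" and f: "A_map A f C D"
  shows "quasi_iso A f C D \<longleftrightarrow> weak_equiv f C D"
proof
  assume qi: "quasi_iso A f C D"
  then have inj: "inj_on (homology_map f D i) (carrier (homology C i))"
    and surj: "homology_map f D i ` carrier (homology C i) = carrier (homology D i)" for i
    by (auto simp: quasi_iso_def bij_betw_def)
  show "weak_equiv f C D" unfolding weak_equiv_def
  proof (intro allI ballI impI)
    fix i x y assume x: "x \<in> carrier (obj C i)" and y: "y \<in> carrier (obj D (i + 1))"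
      and dx: "bdry C i x = \<zero>\<^bsub>obj C (i - 1)\<^esub>" and fx: "f i x = bdry D (i + 1) y"
    interpret Ci: right_module A "obj C i" by (rule cpx_module[OF C])
    interpret Ci1: right_module A "obj C (i + 1)" by (rule cpx_module[OF C])
    interpret Di: right_module A "obj D i" by (rule cpx_module[OF D])
    interpret Di1: right_module A "obj D (i + 1)" by (rule cpx_module[OF D])
    interpret Di2: right_module A "obj D (i + 2)" by (rule cpx_module[OF D])
    have xz: "x \<in> cycles C i" "\<zero>\<^bsub>obj C i\<^esub> \<in> cycles C i"
      using x dx cpx_d_zero[OF C] by (auto simp: cycles_def)
    have f0: "f i \<zero>\<^bsub>obj C i\<^esub> = \<zero>\<^bsub>obj D i\<^esub>"
      by (rule lin_zero[OF map_lin[OF f] cpx_module[OF C] cpx_module[OF D]])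
    have "f i x \<in> cycles D i" "\<zero>\<^bsub>obj D i\<^esub> \<in> cycles D i"
      using fx y cpx_d_zero[OF D] cpx_closed'[OF D] cpx_dd'[OF D] by (auto simp: cycles_def)
    then have "hclass D i (f i x) = hclass D i (f i \<zero>\<^bsub>obj C i\<^esub>)"
      unfolding f0 using fx y cpx_closed'[OF D y]
      by (subst hclass_eq_iff[OF D]) (auto simp: Di.M.minus_eq Di.M.minus_zero_eq)
    then have "hclass C i x = hclass C i \<zero>\<^bsub>obj C i\<^esub>"
      using inj_onD[OF inj, of i] xz homology_map_hclass[OF C D f] homology_carrier[OF C] by simp
    then obtain w where w: "w \<in> carrier (obj C (i + 1))" "x = bdry C (i + 1) w"
      using hclass_eq_iff[OF C xz] x by (auto simp: Ci.M.minus_eq Ci.M.minus_zero_eq)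
    define y1 where "y1 = y \<ominus>\<^bsub>obj D (i + 1)\<^esub> f (i + 1) w"
    have fw: "f (i + 1) w \<in> carrier (obj D (i + 1))" using map_closed[OF f w(1)] .
    have y1: "y1 \<in> carrier (obj D (i + 1))" using y fw by (simp add: y1_def)
    have "bdry D (i + 1) y1 = bdry D (i + 1) y \<ominus>\<^bsub>obj D i\<^esub> f i x"
      unfolding y1_def using lin_diff[OF cpx_lin'[OF D] cpx_module[OF D] cpx_module[OF D] y fw]
        map_bdry'[OF f w(1)] w(2) by simp
    also have "\<dots> = \<zero>\<^bsub>obj D i\<^esub>" unfolding fx using cpx_closed'[OF D y] by algebra
    finally have "y1 \<in> cycles D (i + 1)" using y1 by (simp add: cycles_def)
    then have "hclass D (i + 1) y1 \<in> homology_map f D (i + 1) ` carrier (homology C (i + 1))"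
      unfolding surj homology_carrier[OF D] by blast
    then obtain z where z: "z \<in> cycles C (i + 1)" and "hclass D (i + 1) y1 = hclass D (i + 1) (f (i + 1) z)"
      unfolding homology_carrier[OF C] using homology_map_hclass[OF C D f] by auto
    moreover have "f (i + 1) z \<in> cycles D (i + 1)"
      using z map_closed[OF f] map_bdry[OF f, of z "i + 1"]
        lin_zero[OF map_lin[OF f] cpx_module[OF C] cpx_module[OF D], of i] by (auto simp: cycles_def)
    ultimately obtain v where "v \<in> carrier (obj D (i + 1 + 1))"
      and "y1 \<ominus>\<^bsub>obj D (i + 1)\<^esub> f (i + 1) z = bdry D (i + 1 + 1) v"
      using hclass_eq_iff[OF D \<open>y1 \<in> cycles D (i + 1)\<close>] by blast
    then have v: "v \<in> carrier (obj D (i + 2))"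
      and "y1 \<ominus>\<^bsub>obj D (i + 1)\<^esub> f (i + 1) z = bdry D (i + 2) v" by (simp_all add: add.commute)
    then have eq: "bdry D (i + 2) v = y \<ominus>\<^bsub>obj D (i + 1)\<^esub> f (i + 1) w \<ominus>\<^bsub>obj D (i + 1)\<^esub> f (i + 1) z"
      by (simp add: y1_def)
    have zc: "z \<in> carrier (obj C (i + 1))" "bdry C (i + 1) z = \<zero>\<^bsub>obj C i\<^esub>"
      using z by (auto simp: cycles_def)
    have fz: "f (i + 1) z \<in> carrier (obj D (i + 1))" using map_closed[OF f zc(1)] .
    show "\<exists>x'\<in>carrier (obj C (i + 1)). \<exists>y'\<in>carrier (obj D (i + 2)).
        bdry C (i + 1) x' = x \<and> y = f (i + 1) x' \<oplus>\<^bsub>obj D (i + 1)\<^esub> bdry D (i + 2) y'"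
    proof (intro bexI[of _ "w \<oplus>\<^bsub>obj C (i + 1)\<^esub> z"] bexI[of _ v] conjI)
      show "bdry C (i + 1) (w \<oplus>\<^bsub>obj C (i + 1)\<^esub> z) = x"
        using lin_add[OF cpx_lin'[OF C] w(1) zc(1)] w(2) zc(2) x by simp
      show "y = f (i + 1) (w \<oplus>\<^bsub>obj C (i + 1)\<^esub> z) \<oplus>\<^bsub>obj D (i + 1)\<^esub> bdry D (i + 2) v"
        unfolding eq lin_add[OF map_lin[OF f] w(1) zc(1)] using y fw fz by algebra
    qed (use v w zc in auto)
  qed
next
  assume we: "weak_equiv f C D"
  have "bij_betw (homology_map f D i) (carrier (homology C i)) (carrier (homology D i))" for i
    unfolding bij_betw_def
  proof
    interpret Ci: right_module A "obj C i" by (rule cpx_module[OF C])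
    interpret Ci1: right_module A "obj C (i - 1)" by (rule cpx_module[OF C])
    interpret Di: right_module A "obj D i" by (rule cpx_module[OF D])
    interpret Di1: right_module A "obj D (i - 1)" by (rule cpx_module[OF D])
    have fcyc: "f i x \<in> cycles D i" if "x \<in> cycles C i" for x
      using that map_closed[OF f] map_bdry[OF f, of x i]
        lin_zero[OF map_lin[OF f] cpx_module[OF C] cpx_module[OF D], of "i - 1"]
      by (auto simp: cycles_def)
    show "inj_on (homology_map f D i) (carrier (homology C i))"
    proof (rule inj_onI, unfold homology_carrier[OF C], elim imageE)
      fix K L x x'
      assume eq: "homology_map f D i K = homology_map f D i L"
        and x: "K = hclass C i x" "x \<in> cycles C i" and x': "L = hclass C i x'" "x' \<in> cycles C i"
      have xc: "x \<in> carrier (obj C i)" "x' \<in> carrier (obj C i)"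
        "bdry C i x = \<zero>\<^bsub>obj C (i - 1)\<^esub>" "bdry C i x' = \<zero>\<^bsub>obj C (i - 1)\<^esub>"
        using x(2) x'(2) by (auto simp: cycles_def)
      have "hclass D i (f i x) = hclass D i (f i x')"
        using eq homology_map_hclass[OF C D f] x x' by simp
      then obtain y where y: "y \<in> carrier (obj D (i + 1))" "f i x \<ominus>\<^bsub>obj D i\<^esub> f i x' = bdry D (i + 1) y"
        using hclass_eq_iff[OF D fcyc[OF x(2)] fcyc[OF x'(2)]] by blast
      have "f i (x \<ominus>\<^bsub>obj C i\<^esub> x') = bdry D (i + 1) y"
        using y lin_diff[OF map_lin[OF f] cpx_module[OF C] cpx_module[OF D] xc(1,2)] by simp
      moreover have "bdry C i (x \<ominus>\<^bsub>obj C i\<^esub> x') = \<zero>\<^bsub>obj C (i - 1)\<^esub>"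
        unfolding lin_diff[OF cpx_lin[OF C] cpx_module[OF C] cpx_module[OF C] xc(1,2)] xc(3,4) by algebra
      ultimately obtain w where "w \<in> carrier (obj C (i + 1))" "bdry C (i + 1) w = x \<ominus>\<^bsub>obj C i\<^esub> x'"
        using weak_equivD[OF we, of "x \<ominus>\<^bsub>obj C i\<^esub> x'" i y] y xc by (metis Ci.M.minus_closed)
      then show "K = L" unfolding x x' using hclass_eq_iff[OF C x(2) x'(2)] by metis
    qed
    show "homology_map f D i ` carrier (homology C i) = carrier (homology D i)"
    proof
      show "homology_map f D i ` carrier (homology C i) \<subseteq> carrier (homology D i)"
        unfolding homology_carrier[OF C] homology_carrier[OF D] using homology_map_hclass[OF C D f] fcyc by auto
      show "carrier (homology D i) \<subseteq> homology_map f D i ` carrier (homology C i)"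
      proof
        fix K assume "K \<in> carrier (homology D i)"
        then obtain y where K: "K = hclass D i y" and y: "y \<in> cycles D i" unfolding homology_carrier[OF D] by blast
        then obtain x y' where x: "x \<in> carrier (obj C i)" "bdry C i x = \<zero>\<^bsub>obj C (i - 1)\<^esub>"
          and y': "y' \<in> carrier (obj D (i + 1))" "y = f i x \<oplus>\<^bsub>obj D i\<^esub> bdry D (i + 1) y'"
          using weak_equiv_surj[OF we C D f, of y i] by (auto simp: cycles_def)
        have xz: "x \<in> cycles C i" using x by (simp add: cycles_def)
        have "y \<ominus>\<^bsub>obj D i\<^esub> f i x = bdry D (i + 1) y'"
          unfolding y'(2) using map_closed[OF f x(1)] cpx_closed'[OF D y'(1)] by algebra
        then have "K = hclass D i (f i x)"
          unfolding K using hclass_eq_iff[OF D y fcyc[OF xz]] y'(1) by blast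
        then show "K \<in> homology_map f D i ` carrier (homology C i)"
          unfolding homology_carrier[OF C] using homology_map_hclass[OF C D f xz] xz by auto
      qed
    qed
  qed
  then show "quasi_iso A f C D" using f by (simp add: quasi_iso_def)
qed



section \<open>Lifting maps out of projective complexes\<close>

text \<open>
  Since \<open>f\<close> and \<open>s\<close> are correct on cycles of degree \<open>i - 1\<close>, the pair of \<open>f (d z)\<close> and \<open>g z - s (d z)\<close> satisfies
  the hypothesis of \<open>weak_equiv h\<close> for each \<open>z\<close> in degree \<open>i\<close>; projectivity makes the choice of the two
  preimages linear in \<open>z\<close>.
\<close>

lemma lift_step:
  assumes R: "A_complex A R" and W: "A_complex A W" and V: "A_complex A V"
    and proj: "fg_projective A (obj R i)"
    and h: "A_map A h W V" and we: "weak_equiv h W V" and g: "A_map A g R V"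
    and f: "f \<in> linear_maps A (obj R (i - 1)) (obj W (i - 1))"
    and s: "s \<in> linear_maps A (obj R (i - 1)) (obj V i)"
    and cyc: "\<And>z. \<lbrakk>z \<in> carrier (obj R (i - 1)); bdry R (i - 1) z = \<zero>\<^bsub>obj R (i - 2)\<^esub>\<rbrakk> \<Longrightarrow>
      bdry W (i - 1) (f z) = \<zero>\<^bsub>obj W (i - 2)\<^esub> \<and> h (i - 1) (f z) \<oplus>\<^bsub>obj V (i - 1)\<^esub> bdry V i (s z) = g (i - 1) z"
  shows "\<exists>f'\<in>linear_maps A (obj R i) (obj W i). \<exists>s'\<in>linear_maps A (obj R i) (obj V (i + 1)).
    \<forall>z\<in>carrier (obj R i). bdry W i (f' z) = f (bdry R i z)
      \<and> h i (f' z) \<oplus>\<^bsub>obj V i\<^esub> s (bdry R i z) \<oplus>\<^bsub>obj V i\<^esub> bdry V (i + 1) (s' z) = g i z"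
proof -
  interpret Vi: right_module A "obj V i" by (rule cpx_module[OF V])
  interpret Vi1: right_module A "obj V (i - 1)" by (rule cpx_module[OF V])
  note mods = cpx_module[OF R] cpx_module[OF W] cpx_module[OF V]
  define \<beta> where "\<beta> = (\<lambda>z. (bdry W i (fst z), h i (fst z) \<oplus>\<^bsub>obj V i\<^esub> bdry V (i + 1) (snd z)))"
  define \<alpha> where "\<alpha> = (\<lambda>z. (f (bdry R i z), g i z \<ominus>\<^bsub>obj V i\<^esub> s (bdry R i z)))"
  have \<beta>: "\<beta> \<in> linear_maps A (sum_module (obj W i) (obj V (i + 1))) (sum_module (obj W (i - 1)) (obj V i))"
    unfolding \<beta>_def
    by (intro lin_pair lin_plus lin_on_fst lin_on_snd cpx_lin[OF W] cpx_lin'[OF V] map_lin[OF h] mods)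
  have \<alpha>: "\<alpha> \<in> linear_maps A (obj R i) (sum_module (obj W (i - 1)) (obj V i))"
    unfolding \<alpha>_def
    by (intro lin_pair lin_diff_maps lin_comp[OF cpx_lin[OF R]] f s map_lin[OF g] mods)
  have "\<alpha> z \<in> \<beta> ` carrier (sum_module (obj W i) (obj V (i + 1)))" if z: "z \<in> carrier (obj R i)" for z
  proof -
    let ?x = "f (bdry R i z)" and ?y = "g i z \<ominus>\<^bsub>obj V i\<^esub> s (bdry R i z)"
    have dz: "bdry R i z \<in> carrier (obj R (i - 1))" by (rule cpx_closed[OF R z])
    have c: "bdry W (i - 1) ?x = \<zero>\<^bsub>obj W (i - 2)\<^esub>"
      "h (i - 1) ?x \<oplus>\<^bsub>obj V (i - 1)\<^esub> bdry V i (s (bdry R i z)) = g (i - 1) (bdry R i z)"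
      using cyc[OF dz cpx_dd[OF R z]] by auto
    have x: "?x \<in> carrier (obj W (i - 1))" by (rule lin_closed[OF f dz])
    have sc: "s (bdry R i z) \<in> carrier (obj V i)" by (rule lin_closed[OF s dz])
    have gc: "g i z \<in> carrier (obj V i)" by (rule map_closed[OF g z])
    have y: "?y \<in> carrier (obj V i)" using sc gc by simp
    have "bdry V i ?y = g (i - 1) (bdry R i z) \<ominus>\<^bsub>obj V (i - 1)\<^esub> bdry V i (s (bdry R i z))"
      using lin_diff[OF cpx_lin[OF V] mods(3) mods(3) gc sc] map_bdry[OF g z] by simp
    also have "\<dots> = h (i - 1) ?x"
      unfolding c(2)[symmetric] using map_closed[OF h x] cpx_closed[OF V sc] by algebra
    finally have "h (i - 1) ?x = bdry V (i - 1 + 1) ?y" by simp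
    then obtain x' y' where "x' \<in> carrier (obj W (i - 1 + 1))" "y' \<in> carrier (obj V (i - 1 + 2))"
      "bdry W (i - 1 + 1) x' = ?x" "?y = h (i - 1 + 1) x' \<oplus>\<^bsub>obj V (i - 1 + 1)\<^esub> bdry V (i - 1 + 2) y'"
      using weak_equivD[OF we x, of ?y] y c(1) by (auto simp: add.commute)
    then have "(x', y') \<in> carrier (sum_module (obj W i) (obj V (i + 1)))" "\<alpha> z = \<beta> (x', y')"
      by (auto simp: \<alpha>_def \<beta>_def add.commute)
    then show ?thesis by (metis imageI)
  qed
  then obtain \<gamma> where \<gamma>: "\<gamma> \<in> linear_maps A (obj R i) (sum_module (obj W i) (obj V (i + 1)))"
    and \<beta>\<gamma>: "\<And>z. z \<in> carrier (obj R i) \<Longrightarrow> \<beta> (\<gamma> z) = \<alpha> z"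
    using fg_projective_lift[OF proj mods(1) right_module_sum[OF mods(2,3)] right_module_sum[OF mods(2,3)] \<beta> \<alpha>]
    by blast
  show ?thesis
  proof (intro bexI[OF _ lin_comp[OF \<gamma> lin_fst]] bexI[OF _ lin_comp[OF \<gamma> lin_snd]] ballI conjI)
    fix z assume z: "z \<in> carrier (obj R i)"
    have eq: "bdry W i (fst (\<gamma> z)) = f (bdry R i z)"
      "h i (fst (\<gamma> z)) \<oplus>\<^bsub>obj V i\<^esub> bdry V (i + 1) (snd (\<gamma> z)) = g i z \<ominus>\<^bsub>obj V i\<^esub> s (bdry R i z)"
      using \<beta>\<gamma>[OF z] by (auto simp: \<beta>_def \<alpha>_def)
    show "bdry W i (fst (\<gamma> z)) = f (bdry R i z)" by (rule eq)
    have cl: "s (bdry R i z) \<in> carrier (obj V i)" "g i z \<in> carrier (obj V i)"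
      "h i (fst (\<gamma> z)) \<in> carrier (obj V i)" "bdry V (i + 1) (snd (\<gamma> z)) \<in> carrier (obj V i)"
      using lin_closed[OF s cpx_closed[OF R z]] map_closed[OF g z] lin_closed[OF \<gamma> z]
        map_closed[OF h] cpx_closed'[OF V] by (auto simp: mem_Times_iff)
    have "h i (fst (\<gamma> z)) \<oplus>\<^bsub>obj V i\<^esub> s (bdry R i z) \<oplus>\<^bsub>obj V i\<^esub> bdry V (i + 1) (snd (\<gamma> z))
      = (h i (fst (\<gamma> z)) \<oplus>\<^bsub>obj V i\<^esub> bdry V (i + 1) (snd (\<gamma> z))) \<oplus>\<^bsub>obj V i\<^esub> s (bdry R i z)"
      using cl by algebra
    also have "\<dots> = g i z" unfolding eq(2) using cl by algebra
    finally show "h i (fst (\<gamma> z)) \<oplus>\<^bsub>obj V i\<^esub> s (bdry R i z) \<oplus>\<^bsub>obj V i\<^esub> bdry V (i + 1) (snd (\<gamma> z)) = g i z" .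
  qed
qed

lemma lift_through_weak_equiv:
  assumes R: "A_complex A R" and W: "A_complex A W" and V: "A_complex A V"
    and proj: "\<And>i. fg_projective A (obj R i)"
    and h: "A_map A h W V" and we: "weak_equiv h W V" and g: "A_map A g R V"
  obtains f s where "A_map A f R W" "\<And>i. s i \<in> linear_maps A (obj R i) (obj V (i + 1))"
    and "\<And>i z. z \<in> carrier (obj R i) \<Longrightarrow>
      h i (f i z) \<oplus>\<^bsub>obj V i\<^esub> s (i - 1) (bdry R i z) \<oplus>\<^bsub>obj V i\<^esub> bdry V (i + 1) (s i z) = g i z"
proof -
  note mods = cpx_module[OF R] cpx_module[OF W] cpx_module[OF V]
  \<comment> \<open>The induction starts in degree \<open>-1\<close>, where \<open>R\<close> vanishes; stage \<open>n\<close> treats degree \<open>n - 1\<close>.\<close>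
  define good where "good i p \<longleftrightarrow> fst p \<in> linear_maps A (obj R i) (obj W i)
    \<and> snd p \<in> linear_maps A (obj R i) (obj V (i + 1))
    \<and> (\<forall>z\<in>carrier (obj R i). bdry R i z = \<zero>\<^bsub>obj R (i - 1)\<^esub> \<longrightarrow> bdry W i (fst p z) = \<zero>\<^bsub>obj W (i - 1)\<^esub>
        \<and> h i (fst p z) \<oplus>\<^bsub>obj V i\<^esub> bdry V (i + 1) (snd p z) = g i z)" for i p
  define link where "link i p p' \<longleftrightarrow> (\<forall>z\<in>carrier (obj R i). bdry W i (fst p' z) = fst p (bdry R i z)
      \<and> h i (fst p' z) \<oplus>\<^bsub>obj V i\<^esub> snd p (bdry R i z) \<oplus>\<^bsub>obj V i\<^esub> bdry V (i + 1) (snd p' z) = g i z)" for i p p'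
  let ?zero = "\<lambda>i. (\<lambda>_. \<zero>\<^bsub>obj W i\<^esub>, \<lambda>_. \<zero>\<^bsub>obj V (i + 1)\<^esub>)"
  have zero_good: "good i (?zero i)" and zero_link: "link i (?zero (i - 1)) (?zero i)" if "i < 0" for i
  proof -
    interpret Vi: right_module A "obj V i" by (rule cpx_module[OF V])
    have "g i \<zero>\<^bsub>obj R i\<^esub> = \<zero>\<^bsub>obj V i\<^esub>" by (rule lin_zero[OF map_lin[OF g] mods(1,3)])
    moreover have "h i \<zero>\<^bsub>obj W i\<^esub> = \<zero>\<^bsub>obj V i\<^esub>" by (rule lin_zero[OF map_lin[OF h] mods(2,3)])
    moreover have "z = \<zero>\<^bsub>obj R i\<^esub>" if "z \<in> carrier (obj R i)" for z
      by (rule cpx_negative[OF R \<open>i < 0\<close> that])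
    moreover have "bdry V (i + 1) \<zero>\<^bsub>obj V (i + 1)\<^esub> = \<zero>\<^bsub>obj V i\<^esub>" using cpx_d_zero[OF V, of "i + 1"] by simp
    ultimately show "good i (?zero i)" "link i (?zero (i - 1)) (?zero i)"
      using lin_const_zero[OF mods(2)] lin_const_zero[OF mods(3)] cpx_d_zero[OF W] by (auto simp: good_def link_def)
  qed
  have step: "\<exists>p'. good i p' \<and> link i p p'" if p: "good (i - 1) p" for i p
  proof -
    have "\<exists>f'\<in>linear_maps A (obj R i) (obj W i). \<exists>s'\<in>linear_maps A (obj R i) (obj V (i + 1)).
      \<forall>z\<in>carrier (obj R i). bdry W i (f' z) = fst p (bdry R i z)
      \<and> h i (f' z) \<oplus>\<^bsub>obj V i\<^esub> snd p (bdry R i z) \<oplus>\<^bsub>obj V i\<^esub> bdry V (i + 1) (s' z) = g i z"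
      by (rule lift_step[OF R W V proj h we g]) (use p in \<open>auto simp: good_def\<close>)
    then obtain f' s' where f': "f' \<in> linear_maps A (obj R i) (obj W i)"
      and s': "s' \<in> linear_maps A (obj R i) (obj V (i + 1))"
      and eq: "\<And>z. z \<in> carrier (obj R i) \<Longrightarrow> bdry W i (f' z) = fst p (bdry R i z)"
        "\<And>z. z \<in> carrier (obj R i) \<Longrightarrow>
          h i (f' z) \<oplus>\<^bsub>obj V i\<^esub> snd p (bdry R i z) \<oplus>\<^bsub>obj V i\<^esub> bdry V (i + 1) (s' z) = g i z"
      by blast
    interpret Vi: right_module A "obj V i" by (rule cpx_module[OF V])
    have p0: "fst p \<zero>\<^bsub>obj R (i - 1)\<^esub> = \<zero>\<^bsub>obj W (i - 1)\<^esub>" "snd p \<zero>\<^bsub>obj R (i - 1)\<^esub> = \<zero>\<^bsub>obj V i\<^esub>"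
      using p lin_zero[OF _ mods(1,2)] lin_zero[OF _ mods(1,3), of "snd p" "i - 1" i] by (auto simp: good_def)
    have "h i (f' z) \<oplus>\<^bsub>obj V i\<^esub> bdry V (i + 1) (s' z) = g i z"
      if "z \<in> carrier (obj R i)" "bdry R i z = \<zero>\<^bsub>obj R (i - 1)\<^esub>" for z
      using eq(2)[OF that(1)] map_closed[OF h lin_closed[OF f' that(1)]] by (simp add: that(2) p0)
    then have "good i (f', s')" using f' s' eq(1) p0 by (auto simp: good_def)
    moreover have "link i p (f', s')" using eq by (simp add: link_def)
    ultimately show ?thesis by blast
  qed
  have "\<exists>F. \<forall>n. (good (int n - 1) (F n) \<and> (n = 0 \<longrightarrow> F n = ?zero (-1))) \<and> link (int n) (F n) (F (Suc n))"
  proof (rule dependent_nat_choice)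
    show "\<exists>p. good (int 0 - 1) p \<and> (0 = 0 \<longrightarrow> p = ?zero (-1))" using zero_good[of "-1"] by simp
  qed (use step in \<open>auto simp: add.commute\<close>)
  then obtain F where F: "\<And>n. good (int n - 1) (F n)" "F 0 = ?zero (-1)" "\<And>n. link (int n) (F n) (F (Suc n))"
    by blast
  define G where "G i = (if i < 0 then ?zero i else F (nat (i + 1)))" for i
  have good: "good i (G i)" for i
    using zero_good[of i] F(1)[of "nat (i + 1)"] by (auto simp: G_def)
  have "link i (G (i - 1)) (G i)" for i
  proof (cases "i < 0")
    case True
    then show ?thesis using zero_link by (simp add: G_def)
  next
    case False
    have "G (i - 1) = F (nat i)" using False F(2) by (cases "i = 0") (auto simp: G_def)
    moreover have "G i = F (Suc (nat i))" using False by (simp add: G_def nat_add_distrib)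
    ultimately show ?thesis using F(3)[of "nat i"] False by simp
  qed
  then have "A_map A (\<lambda>i. fst (G i)) R W"
    and "\<And>i. snd (G i) \<in> linear_maps A (obj R i) (obj V (i + 1))"
    and "\<And>i z. z \<in> carrier (obj R i) \<Longrightarrow>
      h i (fst (G i) z) \<oplus>\<^bsub>obj V i\<^esub> snd (G (i - 1)) (bdry R i z) \<oplus>\<^bsub>obj V i\<^esub> bdry V (i + 1) (snd (G i) z) = g i z"
    using good by (auto simp: A_map_def good_def link_def)
  then show ?thesis by (rule that)
qed

lemma weak_equiv_comp:
  assumes C: "A_complex A C" and D: "A_complex A D" and E: "A_complex A E"
    and f: "A_map A f C D" "weak_equiv f C D" and g: "A_map A g D E" "weak_equiv g D E"
  shows "weak_equiv (\<lambda>i x. g i (f i x)) C E"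
  unfolding weak_equiv_def
proof (intro allI ballI impI)
  fix i x y assume x: "x \<in> carrier (obj C i)" "bdry C i x = \<zero>\<^bsub>obj C (i - 1)\<^esub>"
    and y: "y \<in> carrier (obj E (i + 1))" "g i (f i x) = bdry E (i + 1) y"
  interpret E1: right_module A "obj E (i + 1)" by (rule cpx_module[OF E])
  have "bdry D i (f i x) = \<zero>\<^bsub>obj D (i - 1)\<^esub>"
    using map_bdry[OF f(1) x(1)] lin_zero[OF map_lin[OF f(1)] cpx_module[OF C] cpx_module[OF D]] x(2) by metis
  then obtain w v where w: "w \<in> carrier (obj D (i + 1))" "bdry D (i + 1) w = f i x"
    and v: "v \<in> carrier (obj E (i + 2))" and yw: "y = g (i + 1) w \<oplus>\<^bsub>obj E (i + 1)\<^esub> bdry E (i + 2) v"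
    using weak_equivD[OF g(2) map_closed[OF f(1) x(1)] y(1)] y(2) by metis
  obtain x' w' where x': "x' \<in> carrier (obj C (i + 1))" "bdry C (i + 1) x' = x"
    and w': "w' \<in> carrier (obj D (i + 2))" "w = f (i + 1) x' \<oplus>\<^bsub>obj D (i + 1)\<^esub> bdry D (i + 2) w'"
    using weak_equivD[OF f(2) x(1) w(1) x(2)] w(2) by metis
  have gw': "g (i + 2) w' \<in> carrier (obj E (i + 2))" by (rule map_closed[OF g(1) w'(1)])
  have cl: "g (i + 1) (f (i + 1) x') \<in> carrier (obj E (i + 1))"
    "bdry E (i + 2) (g (i + 2) w') \<in> carrier (obj E (i + 1))" "bdry E (i + 2) v \<in> carrier (obj E (i + 1))"
    using map_closed[OF g(1) map_closed[OF f(1) x'(1)]] cpx_closed''[OF E] gw' v by auto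
  have gd: "g (i + 1) (bdry D (i + 2) w') = bdry E (i + 2) (g (i + 2) w')"
    using map_bdry[OF g(1) w'(1)] by (simp add: add.commute)
  have "g (i + 1) w = g (i + 1) (f (i + 1) x') \<oplus>\<^bsub>obj E (i + 1)\<^esub> bdry E (i + 2) (g (i + 2) w')"
    unfolding w'(2) using lin_add[OF map_lin[OF g(1)] map_closed[OF f(1) x'(1)] cpx_closed''[OF D w'(1)]] gd
    by simp
  then have "y = g (i + 1) (f (i + 1) x') \<oplus>\<^bsub>obj E (i + 1)\<^esub> bdry E (i + 2) (g (i + 2) w' \<oplus>\<^bsub>obj E (i + 2)\<^esub> v)"
    unfolding yw lin_add[OF cpx_lin''[OF E] gw' v] using cl by (simp add: E1.M.a_assoc)
  moreover have "g (i + 2) w' \<oplus>\<^bsub>obj E (i + 2)\<^esub> v \<in> carrier (obj E (i + 2))"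
    using gw' v cpx_module[OF E] by (meson abelian_groupE(1) right_module_def)
  ultimately show "\<exists>x'\<in>carrier (obj C (i + 1)). \<exists>y'\<in>carrier (obj E (i + 2)).
      bdry C (i + 1) x' = x \<and> y = g (i + 1) (f (i + 1) x') \<oplus>\<^bsub>obj E (i + 1)\<^esub> bdry E (i + 2) y'"
    using x' by blast
qed

text \<open>
  Two out of three for quasi-isomorphisms, where the triangle commutes only up to the homotopy \<open>s\<close>.
\<close>

lemma weak_equiv_lift:
  assumes P: "A_complex A P" and C: "A_complex A C" and D: "A_complex A D"
    and f: "A_map A f C D" "weak_equiv f C D" and g: "A_map A g P D" "weak_equiv g P D"
    and k: "A_map A k P C" and s: "\<And>i. s i \<in> linear_maps A (obj P i) (obj D (i + 1))"
    and htpy: "\<And>i z. z \<in> carrier (obj P i) \<Longrightarrow>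
      f i (k i z) \<oplus>\<^bsub>obj D i\<^esub> s (i - 1) (bdry P i z) \<oplus>\<^bsub>obj D i\<^esub> bdry D (i + 1) (s i z) = g i z"
  shows "weak_equiv k P C"
  unfolding weak_equiv_def
proof (intro allI ballI impI)
  fix i p y assume p: "p \<in> carrier (obj P i)" "bdry P i p = \<zero>\<^bsub>obj P (i - 1)\<^esub>"
    and y: "y \<in> carrier (obj C (i + 1))" "k i p = bdry C (i + 1) y"
  interpret D0: right_module A "obj D i" by (rule cpx_module[OF D])
  interpret D1: right_module A "obj D (i + 1)" by (rule cpx_module[OF D])
  interpret D2: right_module A "obj D (i + 2)" by (rule cpx_module[OF D])
  interpret C0: right_module A "obj C i" by (rule cpx_module[OF C])
  interpret C1: right_module A "obj C (i + 1)" by (rule cpx_module[OF C])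
  have sp: "s i p \<in> carrier (obj D (i + 1))" by (rule lin_closed[OF s p(1)])
  have fy: "f (i + 1) y \<in> carrier (obj D (i + 1))" by (rule map_closed[OF f(1) y(1)])
  have s0: "s (i - 1) \<zero>\<^bsub>obj P (i - 1)\<^esub> = \<zero>\<^bsub>obj D i\<^esub>"
    using lin_zero[OF s cpx_module[OF P] cpx_module[OF D], of "i - 1"] by simp
  have "g i p = bdry D (i + 1) (f (i + 1) y \<oplus>\<^bsub>obj D (i + 1)\<^esub> s i p)"
    using htpy[OF p(1)] map_closed[OF f(1) map_closed[OF k p(1)]] map_bdry'[OF f(1) y(1)]
      lin_add[OF cpx_lin'[OF D] fy sp] by (simp add: p(2) s0 y(2))
  then obtain p' v where p': "p' \<in> carrier (obj P (i + 1))" "bdry P (i + 1) p' = p"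
    and v: "v \<in> carrier (obj D (i + 2))"
    and eq: "f (i + 1) y \<oplus>\<^bsub>obj D (i + 1)\<^esub> s i p = g (i + 1) p' \<oplus>\<^bsub>obj D (i + 1)\<^esub> bdry D (i + 2) v"
    using weak_equivD[OF g(2) p(1) _ p(2), of "f (i + 1) y \<oplus>\<^bsub>obj D (i + 1)\<^esub> s i p"] fy sp
    by (metis D1.M.a_closed)
  have kp': "k (i + 1) p' \<in> carrier (obj C (i + 1))" by (rule map_closed[OF k p'(1)])
  have sp': "s (i + 1) p' \<in> carrier (obj D (i + 2))"
    using lin_closed[OF s p'(1)] by (simp add: add.commute)
  have gp': "g (i + 1) p' = f (i + 1) (k (i + 1) p') \<oplus>\<^bsub>obj D (i + 1)\<^esub> s i p \<oplus>\<^bsub>obj D (i + 1)\<^esub> bdry D (i + 2) (s (i + 1) p')"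
    using htpy[OF p'(1)] p'(2) by (simp add: add.commute)
  let ?c = "y \<ominus>\<^bsub>obj C (i + 1)\<^esub> k (i + 1) p'" and ?v = "s (i + 1) p' \<oplus>\<^bsub>obj D (i + 2)\<^esub> v"
  have c: "?c \<in> carrier (obj C (i + 1))" using y kp' by simp
  have "bdry C (i + 1) ?c = \<zero>\<^bsub>obj C i\<^esub>"
    using lin_diff[OF cpx_lin'[OF C] cpx_module[OF C] cpx_module[OF C] y(1) kp'] map_bdry'[OF k p'(1)] p'(2)
      cpx_closed'[OF C y(1)] y(2) by (simp add: C0.M.minus_eq C0.M.r_neg)
  moreover have "f (i + 1) ?c = bdry D (i + 2) ?v"
  proof -
    have cl: "f (i + 1) (k (i + 1) p') \<in> carrier (obj D (i + 1))"
      "bdry D (i + 2) (s (i + 1) p') \<in> carrier (obj D (i + 1))" "bdry D (i + 2) v \<in> carrier (obj D (i + 1))"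
      using map_closed[OF f(1) kp'] cpx_closed''[OF D] sp' v by auto
    have "f (i + 1) y = (f (i + 1) y \<oplus>\<^bsub>obj D (i + 1)\<^esub> s i p) \<ominus>\<^bsub>obj D (i + 1)\<^esub> s i p" using fy sp by algebra
    also have "\<dots> = f (i + 1) (k (i + 1) p') \<oplus>\<^bsub>obj D (i + 1)\<^esub> (bdry D (i + 2) (s (i + 1) p') \<oplus>\<^bsub>obj D (i + 1)\<^esub> bdry D (i + 2) v)"
      unfolding eq gp' using cl sp by algebra
    finally have "f (i + 1) y = f (i + 1) (k (i + 1) p') \<oplus>\<^bsub>obj D (i + 1)\<^esub> bdry D (i + 2) ?v"
      unfolding lin_add[OF cpx_lin''[OF D] sp' v] .
    then show ?thesis
      unfolding lin_diff[OF map_lin[OF f(1)] cpx_module[OF C] cpx_module[OF D] y(1) kp']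
      using cl(1) cpx_closed''[OF D, of ?v i] sp' v by (simp add: D1.M.minus_eq) algebra
  qed
  ultimately obtain x where "x \<in> carrier (obj C (i + 1 + 1))" "bdry C (i + 1 + 1) x = ?c"
    using weak_equivD[OF f(2) c, of ?v] sp' v by (auto simp: add.commute)
  then have x: "x \<in> carrier (obj C (i + 2))" "bdry C (i + 2) x = ?c" by (auto simp: add.commute)
  have "y = k (i + 1) p' \<oplus>\<^bsub>obj C (i + 1)\<^esub> bdry C (i + 2) x"
    unfolding x(2) using y(1) kp' by algebra
  then show "\<exists>x'\<in>carrier (obj P (i + 1)). \<exists>y'\<in>carrier (obj C (i + 2)).
      bdry P (i + 1) x' = p \<and> y = k (i + 1) x' \<oplus>\<^bsub>obj C (i + 1)\<^esub> bdry C (i + 2) y'"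
    using p' x(1) by blast
qed

definition projectively_resolved :: "('a, 'b) ring_scheme \<Rightarrow> ('a, 'p) cpx \<Rightarrow> ('a, 'm, 'c) cpx_scheme \<Rightarrow> bool"
  where "projectively_resolved A P C \<longleftrightarrow> strictly_perfect A P \<and> (\<exists>f. A_map A f P C \<and> weak_equiv f P C)"

text \<open>
  A resolution of \<open>D\<close> is composed with a quasi-isomorphism \<open>D \<rightarrow> C\<close> and lifted through a quasi-isomorphism
  \<open>C \<rightarrow> D\<close>. In this way the edges of a zig-zag are removed one after the other.
\<close>

lemma projectively_resolved_edge:
  assumes e: "qi_edge A C D" and r: "projectively_resolved A P D"
  shows "projectively_resolved A P C"
proof -
  have C: "A_complex A C" and D: "A_complex A D" using e by (auto simp: qi_edge_def)
  obtain g where P: "strictly_perfect A P" and g: "A_map A g P D" "weak_equiv g P D"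
    using r by (auto simp: projectively_resolved_def)
  have Pc: "A_complex A P" and proj: "\<And>i. fg_projective A (obj P i)" using P by (auto simp: strictly_perfect_def)
  consider f where "quasi_iso A f C D" | f where "quasi_iso A f D C" using e by (auto simp: qi_edge_def)
  then show ?thesis
  proof cases
    case 1
    have f: "A_map A f C D" "weak_equiv f C D"
      using 1 quasi_iso_iff_weak_equiv[OF C D] by (auto simp: quasi_iso_def)
    obtain k s where k: "A_map A k P C" and s: "\<And>i. s i \<in> linear_maps A (obj P i) (obj D (i + 1))"
      "\<And>i z. z \<in> carrier (obj P i) \<Longrightarrow>
        f i (k i z) \<oplus>\<^bsub>obj D i\<^esub> s (i - 1) (bdry P i z) \<oplus>\<^bsub>obj D i\<^esub> bdry D (i + 1) (s i z) = g i z"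
      using lift_through_weak_equiv[OF Pc C D proj f g(1)] by blast
    have "weak_equiv k P C" by (rule weak_equiv_lift[OF Pc C D f g k s])
    then show ?thesis using P k by (auto simp: projectively_resolved_def)
  next
    case 2
    have f: "A_map A f D C" "weak_equiv f D C"
      using 2 quasi_iso_iff_weak_equiv[OF D C] by (auto simp: quasi_iso_def)
    show ?thesis using P map_comp[OF g(1) f(1)] weak_equiv_comp[OF Pc D C g f]
      by (auto simp: projectively_resolved_def)
  qed
qed

lemma weak_equiv_id:
  assumes C: "A_complex A C" shows "weak_equiv (\<lambda>i x. x) C C"
  unfolding weak_equiv_def
proof (intro allI ballI impI)
  fix i x y assume x: "x \<in> carrier (obj C i)" and y: "y \<in> carrier (obj C (i + 1))" "x = bdry C (i + 1) y"
  interpret C1: right_module A "obj C (i + 1)" by (rule cpx_module[OF C])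
  have "bdry C (i + 2) \<zero>\<^bsub>obj C (i + 2)\<^esub> = \<zero>\<^bsub>obj C (i + 1)\<^esub>"
    using cpx_d_zero[OF C, of "i + 2"] by (simp add: add.commute)
  then show "\<exists>x'\<in>carrier (obj C (i + 1)). \<exists>y'\<in>carrier (obj C (i + 2)).
      bdry C (i + 1) x' = x \<and> y = x' \<oplus>\<^bsub>obj C (i + 1)\<^esub> bdry C (i + 2) y'"
    using y by (intro bexI[of _ y] bexI[of _ "\<zero>\<^bsub>obj C (i + 2)\<^esub>"]) (auto simp: cpx_zero_closed[OF C])
qed

lemma A_perfect_resolved:
  assumes "A_perfect TYPE('z) A X"
  shows "\<exists>P :: ('a, 'z) cpx. projectively_resolved A P X"
proof -
  obtain W P :: "('a, 'z) cpx" where e: "qi_edge A X W" and z: "(qi_edge A)\<^sup>*\<^sup>* W P" and P: "strictly_perfect A P"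
    using assms unfolding A_perfect_def by blast
  have "A_complex A P" using P by (simp add: strictly_perfect_def)
  then have "projectively_resolved A P P"
    using P weak_equiv_id[of A P] by (auto simp: projectively_resolved_def A_map_def lin_id intro!: exI[of _ "\<lambda>i x. x"])
  with z have "projectively_resolved A P W"
    by (induction rule: converse_rtranclp_induct) (auto intro: projectively_resolved_edge)
  then show ?thesis using projectively_resolved_edge[OF e] by blast
qed



section \<open>Twisted sums\<close>

text \<open>
  The suspension. Its sign is written as the action of \<open>- 1\<close>, because the operation \<open>\<ominus>\<close> of a module depends on
  the carrier, and complexes will be restricted to subcomplexes on which the same formulas have to apply.
\<close>

definition shifted :: "('a, 'b) ring_scheme \<Rightarrow> ('a, 'm, 'c) cpx_scheme \<Rightarrow> ('a, 'm) cpx"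
  where "shifted A C = \<lparr>obj = (\<lambda>i. obj C (i - 1)),
    bdry = (\<lambda>i x. bdry C (i - 1) x \<triangleleft>\<^bsub>obj C (i - 2)\<^esub> (\<ominus>\<^bsub>A\<^esub> \<one>\<^bsub>A\<^esub>))\<rparr>"

text \<open>
  Equivalently, \<open>v\<close> is a chain map from \<open>Q\<close> to the suspension of \<open>X\<close>. The second condition makes the
  differential of the twisted sum square to zero.
\<close>

definition twisting ::
  "('a, 'b) ring_scheme \<Rightarrow> (int \<Rightarrow> 'q \<Rightarrow> 'm) \<Rightarrow> ('a, 'q, 'd) cpx_scheme \<Rightarrow> ('a, 'm, 'c) cpx_scheme \<Rightarrow> bool"
  where "twisting A v Q X \<longleftrightarrow> (\<forall>i. v i \<in> linear_maps A (obj Q i) (obj X (i - 1)))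
    \<and> (\<forall>i. \<forall>z\<in>carrier (obj Q i).
        bdry X (i - 1) (v i z) \<oplus>\<^bsub>obj X (i - 2)\<^esub> v (i - 1) (bdry Q i z) = \<zero>\<^bsub>obj X (i - 2)\<^esub>)"

text \<open>
  The extension of \<open>Q\<close> by \<open>X\<close> classified by \<open>v\<close>. Mapping cones, telescopes and the terms of the filtration
  are all of this form.
\<close>

definition twisted ::
  "(int \<Rightarrow> 'q \<Rightarrow> 'm) \<Rightarrow> ('a, 'q, 'd) cpx_scheme \<Rightarrow> ('a, 'm, 'c) cpx_scheme \<Rightarrow> ('a, 'm \<times> 'q) cpx"
  where "twisted v Q X = \<lparr>obj = (\<lambda>i. sum_module (obj X i) (obj Q i)),
    bdry = (\<lambda>i z. (bdry X i (fst z) \<oplus>\<^bsub>obj X (i - 1)\<^esub> v i (snd z), bdry Q i (snd z)))\<rparr>"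

lemma shifted_simps [simp]:
  "obj (shifted A C) i = obj C (i - 1)"
  "bdry (shifted A C) i x = bdry C (i - 1) x \<triangleleft>\<^bsub>obj C (i - 2)\<^esub> (\<ominus>\<^bsub>A\<^esub> \<one>\<^bsub>A\<^esub>)"
  by (simp_all add: shifted_def)

lemma twisted_simps [simp]:
  "obj (twisted v Q X) i = sum_module (obj X i) (obj Q i)"
  "bdry (twisted v Q X) i z = (bdry X i (fst z) \<oplus>\<^bsub>obj X (i - 1)\<^esub> v i (snd z), bdry Q i (snd z))"
  by (simp_all add: twisted_def)

lemma cpx_neg:
  "A_complex A C \<Longrightarrow> x \<in> carrier (obj C i) \<Longrightarrow> x \<triangleleft>\<^bsub>obj C i\<^esub> (\<ominus>\<^bsub>A\<^esub> \<one>\<^bsub>A\<^esub>) = \<ominus>\<^bsub>obj C i\<^esub> x"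
  by (rule right_module.rsmult_minus_one[OF cpx_module])

lemma cpx_minus_closed: "A_complex A C \<Longrightarrow> x \<in> carrier (obj C i) \<Longrightarrow> \<ominus>\<^bsub>obj C i\<^esub> x \<in> carrier (obj C i)"
  using cpx_module by (metis abelian_group.a_inv_closed right_module_def)

lemma cpx_add_closed:
  "A_complex A C \<Longrightarrow> x \<in> carrier (obj C i) \<Longrightarrow> y \<in> carrier (obj C i) \<Longrightarrow> x \<oplus>\<^bsub>obj C i\<^esub> y \<in> carrier (obj C i)"
  using cpx_module by (metis abelian_groupE(1) right_module_def)

lemma cpx_closed2:
  "A_complex A C \<Longrightarrow> x \<in> carrier (obj C (i - 1)) \<Longrightarrow> bdry C (i - 1) x \<in> carrier (obj C (i - 2))"
  using cpx_closed[of A C x "i - 1"] by simp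

lemma cpx_minus_zero: "A_complex A C \<Longrightarrow> \<ominus>\<^bsub>obj C i\<^esub> \<zero>\<^bsub>obj C i\<^esub> = \<zero>\<^bsub>obj C i\<^esub>"
  using cpx_module by (metis abelian_group.minus_zero_eq right_module_def)

lemma cpx_bdry_minus:
  "A_complex A C \<Longrightarrow> x \<in> carrier (obj C i) \<Longrightarrow> bdry C i (\<ominus>\<^bsub>obj C i\<^esub> x) = \<ominus>\<^bsub>obj C (i - 1)\<^esub> bdry C i x"
  by (rule lin_minus[OF cpx_lin cpx_module cpx_module])

lemma cpx_minus_minus: "A_complex A C \<Longrightarrow> x \<in> carrier (obj C i) \<Longrightarrow> \<ominus>\<^bsub>obj C i\<^esub> (\<ominus>\<^bsub>obj C i\<^esub> x) = x"
  using cpx_module by (metis abelian_group.minus_minus right_module_def)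

lemma shifted_bdry:
  "A_complex A C \<Longrightarrow> x \<in> carrier (obj C (i - 1)) \<Longrightarrow>
    bdry (shifted A C) i x = \<ominus>\<^bsub>obj C (i - 2)\<^esub> bdry C (i - 1) x"
  by (simp add: cpx_neg cpx_closed2)

lemma shifted_complex:
  assumes C: "A_complex A C" shows "A_complex A (shifted A C)"
  unfolding A_complex_def
proof (intro conjI allI ballI impI)
  fix i
  show "right_module A (obj (shifted A C) i)" by (simp add: cpx_module[OF C])
  have "(\<lambda>x. bdry C (i - 1) x \<triangleleft>\<^bsub>obj C (i - 2)\<^esub> (\<ominus>\<^bsub>A\<^esub> \<one>\<^bsub>A\<^esub>)) \<in> linear_maps A (obj C (i - 1)) (obj C (i - 2))"
    using cpx_lin[OF C, of "i - 1"] by (intro lin_neg cpx_module[OF C]) simp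
  then show "bdry (shifted A C) i \<in> linear_maps A (obj (shifted A C) i) (obj (shifted A C) (i - 1))"
    by (simp add: shifted_def)
  show "zero_module (obj (shifted A C) i)" if "i < 0"
    using that C by (simp add: A_complex_def)
  fix x assume "x \<in> carrier (obj (shifted A C) i)"
  then have x: "x \<in> carrier (obj C (i - 1))" by simp
  have d: "bdry C (i - 1) x \<in> carrier (obj C (i - 1 - 1))" "bdry C (i - 1) x \<in> carrier (obj C (i - 2))"
    using cpx_closed[OF C x] by auto
  have "bdry C (i - 2) (bdry C (i - 1) x) = \<zero>\<^bsub>obj C (i - 3)\<^esub>" using cpx_dd[OF C x] by simp
  then have "bdry (shifted A C) (i - 1) (bdry (shifted A C) i x) = \<ominus>\<^bsub>obj C (i - 3)\<^esub> (\<ominus>\<^bsub>obj C (i - 3)\<^esub> \<zero>\<^bsub>obj C (i - 3)\<^esub>)"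
    using shifted_bdry[OF C x] shifted_bdry[OF C, of _ "i - 1"] cpx_minus_closed[OF C d(2)] cpx_bdry_minus[OF C d(2)]
    by (simp del: shifted_simps)
  then show "bdry (shifted A C) (i - 1) (bdry (shifted A C) i x) = \<zero>\<^bsub>obj (shifted A C) (i - 2)\<^esub>"
    by (simp add: cpx_minus_zero[OF C])
qed

lemma shifted_strictly_perfect: "strictly_perfect A C \<Longrightarrow> strictly_perfect A (shifted A C)"
proof -
  assume C: "strictly_perfect A C"
  then obtain d where d: "\<forall>i>d. zero_module (obj C i)" by (auto simp: strictly_perfect_def)
  then have "\<forall>i>d + 1. zero_module (obj (shifted A C) i)" by simp
  then show "strictly_perfect A (shifted A C)"
    using C shifted_complex unfolding strictly_perfect_def by auto
qed

lemma shifted_map: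
  assumes C: "A_complex A C" and D: "A_complex A D" and f: "A_map A f C D"
  shows "A_map A (\<lambda>i. f (i - 1)) (shifted A C) (shifted A D)"
  unfolding A_map_def
proof (intro conjI allI ballI)
  fix i
  show "f (i - 1) \<in> linear_maps A (obj (shifted A C) i) (obj (shifted A D) i)" by (simp add: map_lin[OF f])
  fix x assume "x \<in> carrier (obj (shifted A C) i)"
  then have x: "x \<in> carrier (obj C (i - 1))" by simp
  show "f (i - 1 - 1) (bdry (shifted A C) i x) = bdry (shifted A D) i (f (i - 1) x)"
    unfolding shifted_bdry[OF C x] shifted_bdry[OF D map_closed[OF f x]]
    using lin_minus[OF map_lin[OF f] cpx_module[OF C] cpx_module[OF D] cpx_closed2[OF C x]] map_bdry[OF f x] by simp
qed

lemma shifted_weak_equiv: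
  assumes C: "A_complex A C" and D: "A_complex A D" and f: "A_map A f C D" "weak_equiv f C D"
  shows "weak_equiv (\<lambda>i. f (i - 1)) (shifted A C) (shifted A D)"
  unfolding weak_equiv_def
proof (intro allI ballI impI)
  fix i x y
  assume "x \<in> carrier (obj (shifted A C) i)" and "y \<in> carrier (obj (shifted A D) (i + 1))"
    and dx: "bdry (shifted A C) i x = \<zero>\<^bsub>obj (shifted A C) (i - 1)\<^esub>"
    and fx: "f (i - 1) x = bdry (shifted A D) (i + 1) y"
  then have x: "x \<in> carrier (obj C (i - 1))" and y: "y \<in> carrier (obj D i)" by auto
  have y': "y \<in> carrier (obj D (i - 1 + 1))" "y \<in> carrier (obj D (i + 1 - 1))" using y by auto
  let ?y = "\<ominus>\<^bsub>obj D i\<^esub> y"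
  have dx0: "bdry C (i - 1) x = \<zero>\<^bsub>obj C (i - 1 - 1)\<^esub>"
    using dx cpx_minus_minus[OF C cpx_closed2[OF C x]] cpx_minus_zero[OF C, of "i - 2"]
    unfolding shifted_bdry[OF C x] by simp
  have yc: "?y \<in> carrier (obj D (i - 1 + 1))" using cpx_minus_closed[OF D y] by simp
  have "f (i - 1) x = bdry D (i - 1 + 1) ?y"
    using fx cpx_bdry_minus[OF D y] unfolding shifted_bdry[OF D y'(2)] by simp
  from weak_equivD[OF f(2) x yc dx0 this]
  obtain x' w where "x' \<in> carrier (obj C (i - 1 + 1))" "w \<in> carrier (obj D (i - 1 + 2))"
    "bdry C (i - 1 + 1) x' = x" "?y = f (i - 1 + 1) x' \<oplus>\<^bsub>obj D (i - 1 + 1)\<^esub> bdry D (i - 1 + 2) w"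
    by metis
  then have x': "x' \<in> carrier (obj C i)" "bdry C i x' = x"
    and w: "w \<in> carrier (obj D (i + 1))" "?y = f i x' \<oplus>\<^bsub>obj D i\<^esub> bdry D (i + 1) w"
    by (auto simp: add.commute)
  interpret D: right_module A "obj D i" by (rule cpx_module[OF D])
  have fx': "f i x' \<in> carrier (obj D i)" by (rule map_closed[OF f(1) x'(1)])
  have "y = \<ominus>\<^bsub>obj D i\<^esub> (f i x' \<oplus>\<^bsub>obj D i\<^esub> bdry D (i + 1) w)"
    unfolding w(2)[symmetric] using y by simp
  also have "\<dots> = f i (\<ominus>\<^bsub>obj C i\<^esub> x') \<oplus>\<^bsub>obj D i\<^esub> \<ominus>\<^bsub>obj D i\<^esub> bdry D (i + 1) w"
    unfolding lin_minus[OF map_lin[OF f(1)] cpx_module[OF C] cpx_module[OF D] x'(1)]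
    using fx' cpx_closed'[OF D w(1)] by algebra
  finally have eq: "y = f i (\<ominus>\<^bsub>obj C i\<^esub> x') \<oplus>\<^bsub>obj D i\<^esub> \<ominus>\<^bsub>obj D i\<^esub> bdry D (i + 1) w" .
  have mx: "\<ominus>\<^bsub>obj C i\<^esub> x' \<in> carrier (obj C (i + 1 - 1))" using cpx_minus_closed[OF C x'(1)] by simp
  have "bdry (shifted A C) (i + 1) (\<ominus>\<^bsub>obj C i\<^esub> x') = x"
    unfolding shifted_bdry[OF C mx]
    using cpx_bdry_minus[OF C x'(1)] x'(2) cpx_minus_minus[OF C x] by simp
  moreover have "bdry (shifted A D) (i + 2) w = \<ominus>\<^bsub>obj D i\<^esub> bdry D (i + 1) w"
    using shifted_bdry[OF D, of w "i + 2"] w(1) by (simp add: add.commute del: shifted_simps(2))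
  ultimately show "\<exists>x'\<in>carrier (obj (shifted A C) (i + 1)). \<exists>y'\<in>carrier (obj (shifted A D) (i + 2)).
      bdry (shifted A C) (i + 1) x' = x \<and>
      y = f (i + 1 - 1) x' \<oplus>\<^bsub>obj (shifted A D) (i + 1)\<^esub> bdry (shifted A D) (i + 2) y'"
    using eq mx w(1) by (intro bexI[of _ "\<ominus>\<^bsub>obj C i\<^esub> x'"] bexI[of _ w]) (simp_all add: add.commute del: shifted_simps(2))
qed

lemma twisting_lin: "twisting A v Q X \<Longrightarrow> v i \<in> linear_maps A (obj Q i) (obj X (i - 1))"
  by (simp add: twisting_def)

lemma twisting_closed: "twisting A v Q X \<Longrightarrow> z \<in> carrier (obj Q i) \<Longrightarrow> v i z \<in> carrier (obj X (i - 1))"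
  by (rule lin_closed[OF twisting_lin])

lemma twisting_closed':
  "twisting A v Q X \<Longrightarrow> z \<in> carrier (obj Q (i + 1)) \<Longrightarrow> v (i + 1) z \<in> carrier (obj X i)"
  using twisting_closed[of A v Q X z "i + 1"] by simp

lemma twisting_bdry:
  assumes v: "twisting A v Q X" and X: "A_complex A X" and Q: "A_complex A Q" and z: "z \<in> carrier (obj Q i)"
  shows "v (i - 1) (bdry Q i z) = \<ominus>\<^bsub>obj X (i - 2)\<^esub> bdry X (i - 1) (v i z)"
proof -
  interpret right_module A "obj X (i - 2)" by (rule cpx_module[OF X])
  have c: "bdry X (i - 1) (v i z) \<in> carrier (obj X (i - 2))" "v (i - 1) (bdry Q i z) \<in> carrier (obj X (i - 2))"
    using cpx_closed2[OF X twisting_closed[OF v z]] twisting_closed[OF v cpx_closed[OF Q z]] by auto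
  have "bdry X (i - 1) (v i z) \<oplus>\<^bsub>obj X (i - 2)\<^esub> v (i - 1) (bdry Q i z) = \<zero>\<^bsub>obj X (i - 2)\<^esub>"
    using v z by (simp add: twisting_def)
  then have "v (i - 1) (bdry Q i z) \<oplus>\<^bsub>obj X (i - 2)\<^esub> bdry X (i - 1) (v i z) = \<zero>\<^bsub>obj X (i - 2)\<^esub>"
    using c by (simp add: M.a_comm)
  then show ?thesis using M.add_eq_zeroD c by blast
qed

lemma twisting_of_map:
  assumes C: "A_complex A C" and D: "A_complex A D" and f: "A_map A f C D"
  shows "twisting A (\<lambda>i. f (i - 1)) (shifted A C) D"
  unfolding twisting_def
proof (intro conjI allI ballI)
  fix i
  show "f (i - 1) \<in> linear_maps A (obj (shifted A C) i) (obj D (i - 1))" by (simp add: map_lin[OF f])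
  fix z assume "z \<in> carrier (obj (shifted A C) i)"
  then have z: "z \<in> carrier (obj C (i - 1))" by simp
  interpret right_module A "obj D (i - 2)" by (rule cpx_module[OF D])
  have fz: "bdry D (i - 1) (f (i - 1) z) \<in> carrier (obj D (i - 2))" by (rule cpx_closed2[OF D map_closed[OF f z]])
  have "f (i - 1 - 1) (bdry (shifted A C) i z) = \<ominus>\<^bsub>obj D (i - 2)\<^esub> bdry D (i - 1) (f (i - 1) z)"
    unfolding shifted_bdry[OF C z]
    using lin_minus[OF map_lin[OF f] cpx_module[OF C] cpx_module[OF D] cpx_closed2[OF C z]] map_bdry[OF f z] by simp
  then show "bdry D (i - 1) (f (i - 1) z) \<oplus>\<^bsub>obj D (i - 2)\<^esub> f (i - 1 - 1) (bdry (shifted A C) i z) = \<zero>\<^bsub>obj D (i - 2)\<^esub>"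
    using fz by (simp add: M.r_neg)
qed

lemma map_of_twisting:
  assumes Q: "A_complex A Q" and X: "A_complex A X" and v: "twisting A v Q X"
  shows "A_map A v Q (shifted A X)"
  unfolding A_map_def
proof (intro conjI allI ballI)
  fix i
  show "v i \<in> linear_maps A (obj Q i) (obj (shifted A X) i)" by (simp add: twisting_lin[OF v])
  fix z assume z: "z \<in> carrier (obj Q i)"
  show "v (i - 1) (bdry Q i z) = bdry (shifted A X) i (v i z)"
    unfolding shifted_bdry[OF X twisting_closed[OF v z]] by (rule twisting_bdry[OF v X Q z])
qed

lemma twisting_of_shifted_map:
  assumes Q: "A_complex A Q" and X: "A_complex A X" and v: "A_map A v Q (shifted A X)"
  shows "twisting A v Q X"
  unfolding twisting_def
proof (intro conjI allI ballI)
  fix i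
  show "v i \<in> linear_maps A (obj Q i) (obj X (i - 1))" using map_lin[OF v, of i] by simp
  fix z assume z: "z \<in> carrier (obj Q i)"
  have vz: "v i z \<in> carrier (obj X (i - 1))" using map_closed[OF v z] by simp
  interpret right_module A "obj X (i - 2)" by (rule cpx_module[OF X])
  have "v (i - 1) (bdry Q i z) = \<ominus>\<^bsub>obj X (i - 2)\<^esub> bdry X (i - 1) (v i z)"
    using map_bdry[OF v z] unfolding shifted_bdry[OF X vz] .
  then show "bdry X (i - 1) (v i z) \<oplus>\<^bsub>obj X (i - 2)\<^esub> v (i - 1) (bdry Q i z) = \<zero>\<^bsub>obj X (i - 2)\<^esub>"
    using cpx_closed2[OF X vz] by (simp add: M.r_neg)
qed

lemma twisted_complex:
  assumes X: "A_complex A X" and Q: "A_complex A Q" and v: "twisting A v Q X"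
  shows "A_complex A (twisted v Q X)"
  unfolding A_complex_def
proof (intro conjI allI ballI impI)
  fix i
  show "right_module A (obj (twisted v Q X) i)"
    by (simp add: right_module_sum[OF cpx_module[OF X] cpx_module[OF Q]])
  have "(\<lambda>z. (bdry X i (fst z) \<oplus>\<^bsub>obj X (i - 1)\<^esub> v i (snd z), bdry Q i (snd z)))
      \<in> linear_maps A (sum_module (obj X i) (obj Q i)) (sum_module (obj X (i - 1)) (obj Q (i - 1)))"
    by (intro lin_pair lin_plus lin_on_fst lin_on_snd cpx_lin[OF X] cpx_lin[OF Q] twisting_lin[OF v] cpx_module[OF X])
  then show "bdry (twisted v Q X) i \<in> linear_maps A (obj (twisted v Q X) i) (obj (twisted v Q X) (i - 1))"
    by (simp add: twisted_def)
  show "zero_module (obj (twisted v Q X) i)" if "i < 0"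
    using that X Q by (simp add: A_complex_def zero_module_def)
  fix z assume "z \<in> carrier (obj (twisted v Q X) i)"
  then obtain x w where z: "z = (x, w)" and x: "x \<in> carrier (obj X i)" and w: "w \<in> carrier (obj Q i)" by auto
  interpret right_module A "obj X (i - 2)" by (rule cpx_module[OF X])
  have c: "bdry X i x \<in> carrier (obj X (i - 1))" "v i w \<in> carrier (obj X (i - 1))"
    using cpx_closed[OF X x] twisting_closed[OF v w] by auto
  have "bdry X (i - 1) (bdry X i x \<oplus>\<^bsub>obj X (i - 1)\<^esub> v i w) = bdry X (i - 1) (v i w)"
    using lin_add[OF cpx_lin[OF X] c] cpx_dd[OF X x] cpx_closed2[OF X c(2)] by simp
  then show "bdry (twisted v Q X) (i - 1) (bdry (twisted v Q X) i z) = \<zero>\<^bsub>obj (twisted v Q X) (i - 2)\<^esub>"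
    using v w cpx_dd[OF Q w] by (simp add: z twisting_def)
qed

lemma twisted_strictly_perfect:
  assumes X: "strictly_perfect A X" and Q: "strictly_perfect A Q" and v: "twisting A v Q X"
  shows "strictly_perfect A (twisted v Q X)"
proof -
  obtain d d' where "\<forall>i>d. zero_module (obj X i)" "\<forall>i>d'. zero_module (obj Q i)"
    using X Q unfolding strictly_perfect_def by blast
  then have "\<forall>i>max d d'. zero_module (obj (twisted v Q X) i)" by (simp add: zero_module_def)
  moreover have "A_complex A X" "A_complex A Q" using X Q by (auto simp: strictly_perfect_def)
  moreover have "fg_projective A (obj (twisted v Q X) i)" for i
    using X Q by (simp add: strictly_perfect_def fg_projective_sum cpx_module)
  ultimately show ?thesis unfolding strictly_perfect_def using twisted_complex[OF _ _ v] by blast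
qed

context
  fixes A :: "('a, 'b) ring_scheme"
    and X :: "('a, 'x, 'c) cpx_scheme" and Q :: "('a, 'q, 'd) cpx_scheme"
    and X' :: "('a, 'y, 'e) cpx_scheme" and Q' :: "('a, 'r, 'f) cpx_scheme"
    and v v' \<alpha> \<beta> k
  assumes X: "A_complex A X" and Q: "A_complex A Q" and X': "A_complex A X'" and Q': "A_complex A Q'"
    and v: "twisting A v Q X" and v': "twisting A v' Q' X'"
    and \<alpha>: "A_map A \<alpha> X X'" and \<beta>: "A_map A \<beta> Q Q'"
    and k: "\<And>i. k i \<in> linear_maps A (obj Q i) (obj X' i)"
    and htpy: "\<And>i z. z \<in> carrier (obj Q i) \<Longrightarrow>
      \<alpha> (i - 1) (v i z) \<oplus>\<^bsub>obj X' (i - 1)\<^esub> k (i - 1) (bdry Q i z)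
        = bdry X' i (k i z) \<oplus>\<^bsub>obj X' (i - 1)\<^esub> v' i (\<beta> i z)"
begin

lemma twisted_map:
  "A_map A (\<lambda>i z. (\<alpha> i (fst z) \<oplus>\<^bsub>obj X' i\<^esub> k i (snd z), \<beta> i (snd z))) (twisted v Q X) (twisted v' Q' X')"
  unfolding A_map_def
proof (intro conjI allI ballI)
  fix i
  show "(\<lambda>z. (\<alpha> i (fst z) \<oplus>\<^bsub>obj X' i\<^esub> k i (snd z), \<beta> i (snd z)))
      \<in> linear_maps A (obj (twisted v Q X) i) (obj (twisted v' Q' X') i)"
    unfolding twisted_simps
    by (intro lin_pair lin_plus lin_on_fst lin_on_snd map_lin[OF \<alpha>] map_lin[OF \<beta>] k cpx_module[OF X'])
  fix z assume "z \<in> carrier (obj (twisted v Q X) i)"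
  then obtain x w where z: "z = (x, w)" and x: "x \<in> carrier (obj X i)" and w: "w \<in> carrier (obj Q i)" by auto
  interpret right_module A "obj X' (i - 1)" by (rule cpx_module[OF X'])
  have c: "bdry X' i (\<alpha> i x) \<in> carrier (obj X' (i - 1))" "\<alpha> (i - 1) (v i w) \<in> carrier (obj X' (i - 1))"
    "k (i - 1) (bdry Q i w) \<in> carrier (obj X' (i - 1))" "bdry X' i (k i w) \<in> carrier (obj X' (i - 1))"
    "v' i (\<beta> i w) \<in> carrier (obj X' (i - 1))"
    using cpx_closed[OF X' map_closed[OF \<alpha> x]] map_closed[OF \<alpha> twisting_closed[OF v w]]
      lin_closed[OF k cpx_closed[OF Q w]] cpx_closed[OF X' lin_closed[OF k w]]
      twisting_closed[OF v' map_closed[OF \<beta> w]] by auto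
  have "\<alpha> (i - 1) (bdry X i x \<oplus>\<^bsub>obj X (i - 1)\<^esub> v i w) \<oplus>\<^bsub>obj X' (i - 1)\<^esub> k (i - 1) (bdry Q i w)
    = bdry X' i (\<alpha> i x) \<oplus>\<^bsub>obj X' (i - 1)\<^esub> (\<alpha> (i - 1) (v i w) \<oplus>\<^bsub>obj X' (i - 1)\<^esub> k (i - 1) (bdry Q i w))"
    using lin_add[OF map_lin[OF \<alpha>] cpx_closed[OF X x] twisting_closed[OF v w]] map_bdry[OF \<alpha> x] c
    by (simp add: M.a_assoc)
  also have "\<dots> = bdry X' i (\<alpha> i x \<oplus>\<^bsub>obj X' i\<^esub> k i w) \<oplus>\<^bsub>obj X' (i - 1)\<^esub> v' i (\<beta> i w)"
    unfolding htpy[OF w] lin_add[OF cpx_lin[OF X'] map_closed[OF \<alpha> x] lin_closed[OF k w]]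
    using c by (simp add: M.a_assoc)
  finally show "(\<alpha> (i - 1) (fst (bdry (twisted v Q X) i z)) \<oplus>\<^bsub>obj X' (i - 1)\<^esub> k (i - 1) (snd (bdry (twisted v Q X) i z)),
        \<beta> (i - 1) (snd (bdry (twisted v Q X) i z)))
      = bdry (twisted v' Q' X') i (\<alpha> i (fst z) \<oplus>\<^bsub>obj X' i\<^esub> k i (snd z), \<beta> i (snd z))"
    by (simp add: z map_bdry[OF \<beta> w])
qed

text \<open>
  The five lemma for the two extensions, carried out on elements: first the component in \<open>Q\<close> is solved, then its
  solution is subtracted and the remaining equation lies in \<open>X\<close>.
\<close>

lemma twisted_weak_equiv:
  assumes w\<alpha>: "weak_equiv \<alpha> X X'" and w\<beta>: "weak_equiv \<beta> Q Q'"
  shows "weak_equiv (\<lambda>i z. (\<alpha> i (fst z) \<oplus>\<^bsub>obj X' i\<^esub> k i (snd z), \<beta> i (snd z))) (twisted v Q X) (twisted v' Q' X')"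
  unfolding weak_equiv_def
proof (intro allI ballI impI)
  fix i p p'
  assume "p \<in> carrier (obj (twisted v Q X) i)" and "p' \<in> carrier (obj (twisted v' Q' X') (i + 1))"
    and "bdry (twisted v Q X) i p = \<zero>\<^bsub>obj (twisted v Q X) (i - 1)\<^esub>"
    and "(\<alpha> i (fst p) \<oplus>\<^bsub>obj X' i\<^esub> k i (snd p), \<beta> i (snd p)) = bdry (twisted v' Q' X') (i + 1) p'"
  then obtain x z x' z' where p: "p = (x, z)" "p' = (x', z')"
    and x: "x \<in> carrier (obj X i)" and z: "z \<in> carrier (obj Q i)"
    and x': "x' \<in> carrier (obj X' (i + 1))" and z': "z' \<in> carrier (obj Q' (i + 1))"
    and dx: "bdry X i x \<oplus>\<^bsub>obj X (i - 1)\<^esub> v i z = \<zero>\<^bsub>obj X (i - 1)\<^esub>"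
    and dz: "bdry Q i z = \<zero>\<^bsub>obj Q (i - 1)\<^esub>"
    and ax: "\<alpha> i x \<oplus>\<^bsub>obj X' i\<^esub> k i z = bdry X' (i + 1) x' \<oplus>\<^bsub>obj X' i\<^esub> v' (i + 1) z'"
    and bz: "\<beta> i z = bdry Q' (i + 1) z'" by auto
  interpret X1: right_module A "obj X (i - 1)" by (rule cpx_module[OF X])
  interpret X0: right_module A "obj X i" by (rule cpx_module[OF X])
  interpret X'0: right_module A "obj X' i" by (rule cpx_module[OF X'])
  interpret X'1: right_module A "obj X' (i + 1)" by (rule cpx_module[OF X'])
  obtain z1 z1' where z1: "z1 \<in> carrier (obj Q (i + 1))" "bdry Q (i + 1) z1 = z"
    and z1': "z1' \<in> carrier (obj Q' (i + 2))" "z' = \<beta> (i + 1) z1 \<oplus>\<^bsub>obj Q' (i + 1)\<^esub> bdry Q' (i + 2) z1'"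
    using weak_equivD[OF w\<beta> z z' dz bz] by metis
  define x1 where "x1 = x \<ominus>\<^bsub>obj X i\<^esub> v (i + 1) z1"
  define x1' where "x1' = x' \<ominus>\<^bsub>obj X' (i + 1)\<^esub> k (i + 1) z1 \<ominus>\<^bsub>obj X' (i + 1)\<^esub> v' (i + 2) z1'"
  have vz1: "v (i + 1) z1 \<in> carrier (obj X i)" by (rule twisting_closed'[OF v z1(1)])
  have kz1: "k (i + 1) z1 \<in> carrier (obj X' (i + 1))" by (rule lin_closed[OF k z1(1)])
  have vz1': "v' (i + 2) z1' \<in> carrier (obj X' (i + 1))"
    using twisting_closed[OF v' z1'(1)] by (simp add: add.commute)
  have x1: "x1 \<in> carrier (obj X i)" using x vz1 by (simp add: x1_def)
  have x1': "x1' \<in> carrier (obj X' (i + 1))" using x' kz1 vz1' by (simp add: x1'_def)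
  have vz: "v i z = \<ominus>\<^bsub>obj X (i - 1)\<^esub> bdry X i (v (i + 1) z1)"
    using twisting_bdry[OF v X Q z1(1)] z1(2) by simp
  have "bdry X i x1 = bdry X i x \<oplus>\<^bsub>obj X (i - 1)\<^esub> v i z"
    unfolding x1_def lin_diff[OF cpx_lin[OF X] cpx_module[OF X] cpx_module[OF X] x vz1] vz
    by (simp add: X1.M.minus_eq)
  then have dx1: "bdry X i x1 = \<zero>\<^bsub>obj X (i - 1)\<^esub>" using dx by simp
  have dx1': "bdry X' (i + 1) x1' = bdry X' (i + 1) x' \<ominus>\<^bsub>obj X' i\<^esub> bdry X' (i + 1) (k (i + 1) z1)
      \<ominus>\<^bsub>obj X' i\<^esub> bdry X' (i + 1) (v' (i + 2) z1')"
    unfolding x1'_def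
    using lin_diff[OF cpx_lin'[OF X'] cpx_module[OF X'] cpx_module[OF X'] _ vz1', of "x' \<ominus>\<^bsub>obj X' (i + 1)\<^esub> k (i + 1) z1"]
      lin_diff[OF cpx_lin'[OF X'] cpx_module[OF X'] cpx_module[OF X'] x' kz1] x' kz1 by simp
  have h: "\<alpha> i (v (i + 1) z1) \<oplus>\<^bsub>obj X' i\<^esub> k i z
      = bdry X' (i + 1) (k (i + 1) z1) \<oplus>\<^bsub>obj X' i\<^esub> v' (i + 1) (\<beta> (i + 1) z1)"
    using htpy[OF z1(1)] z1(2) by simp
  have bz1: "\<beta> (i + 1) z1 \<in> carrier (obj Q' (i + 1))" by (rule map_closed[OF \<beta> z1(1)])
  have "v' (i + 1) (bdry Q' (i + 2) z1') = \<ominus>\<^bsub>obj X' i\<^esub> bdry X' (i + 1) (v' (i + 2) z1')"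
    using twisting_bdry[OF v' X' Q' z1'(1)] by (simp add: add.commute)
  then have vz': "v' (i + 1) z' = v' (i + 1) (\<beta> (i + 1) z1) \<ominus>\<^bsub>obj X' i\<^esub> bdry X' (i + 1) (v' (i + 2) z1')"
    unfolding z1'(2) using lin_add[OF twisting_lin[OF v'] bz1 cpx_closed''[OF Q' z1'(1)]] by (simp add: X'0.M.minus_eq)
  have cl: "\<alpha> i x \<in> carrier (obj X' i)" "\<alpha> i (v (i + 1) z1) \<in> carrier (obj X' i)" "k i z \<in> carrier (obj X' i)"
    "bdry X' (i + 1) x' \<in> carrier (obj X' i)" "bdry X' (i + 1) (k (i + 1) z1) \<in> carrier (obj X' i)"
    "bdry X' (i + 1) (v' (i + 2) z1') \<in> carrier (obj X' i)" "v' (i + 1) (\<beta> (i + 1) z1) \<in> carrier (obj X' i)"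
    using map_closed[OF \<alpha> x] map_closed[OF \<alpha> vz1] lin_closed[OF k z] cpx_closed'[OF X' x'] cpx_closed'[OF X' kz1]
      cpx_closed'[OF X' vz1'] twisting_closed'[OF v' bz1] by auto
  have "\<alpha> i x1 = \<alpha> i x \<ominus>\<^bsub>obj X' i\<^esub> \<alpha> i (v (i + 1) z1)"
    unfolding x1_def by (rule lin_diff[OF map_lin[OF \<alpha>] cpx_module[OF X] cpx_module[OF X'] x vz1])
  also have "\<dots> = (\<alpha> i x \<oplus>\<^bsub>obj X' i\<^esub> k i z) \<ominus>\<^bsub>obj X' i\<^esub> (\<alpha> i (v (i + 1) z1) \<oplus>\<^bsub>obj X' i\<^esub> k i z)"
    using cl by algebra
  also have "\<dots> = bdry X' (i + 1) x1'"
    unfolding ax h vz' dx1' using cl by algebra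
  finally have "\<alpha> i x1 = bdry X' (i + 1) x1'" .
  from weak_equivD[OF w\<alpha> x1 x1' dx1 this]
  obtain x2 x2' where x2: "x2 \<in> carrier (obj X (i + 1))" "bdry X (i + 1) x2 = x1"
    and x2': "x2' \<in> carrier (obj X' (i + 2))" "x1' = \<alpha> (i + 1) x2 \<oplus>\<^bsub>obj X' (i + 1)\<^esub> bdry X' (i + 2) x2'"
    by metis
  have ax2: "\<alpha> (i + 1) x2 \<in> carrier (obj X' (i + 1))" by (rule map_closed[OF \<alpha> x2(1)])
  have dx2': "bdry X' (i + 2) x2' \<in> carrier (obj X' (i + 1))" by (rule cpx_closed''[OF X' x2'(1)])
  have 1: "bdry X (i + 1) x2 \<oplus>\<^bsub>obj X i\<^esub> v (i + 1) z1 = x"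
    unfolding x2(2) x1_def using x vz1 by algebra
  have "x' = x1' \<oplus>\<^bsub>obj X' (i + 1)\<^esub> k (i + 1) z1 \<oplus>\<^bsub>obj X' (i + 1)\<^esub> v' (i + 2) z1'"
    unfolding x1'_def using x' kz1 vz1' by algebra
  also have "\<dots> = (\<alpha> (i + 1) x2 \<oplus>\<^bsub>obj X' (i + 1)\<^esub> k (i + 1) z1)
      \<oplus>\<^bsub>obj X' (i + 1)\<^esub> (bdry X' (i + 2) x2' \<oplus>\<^bsub>obj X' (i + 1)\<^esub> v' (i + 2) z1')"
    unfolding x2'(2) using ax2 dx2' kz1 vz1' by algebra
  finally have 2: "x' = (\<alpha> (i + 1) x2 \<oplus>\<^bsub>obj X' (i + 1)\<^esub> k (i + 1) z1)
      \<oplus>\<^bsub>obj X' (i + 1)\<^esub> (bdry X' (i + 2) x2' \<oplus>\<^bsub>obj X' (i + 1)\<^esub> v' (i + 2) z1')" .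
  have idx: "i + 2 - 1 = i + 1" by simp
  show "\<exists>q\<in>carrier (obj (twisted v Q X) (i + 1)). \<exists>q'\<in>carrier (obj (twisted v' Q' X') (i + 2)).
      bdry (twisted v Q X) (i + 1) q = p \<and>
      p' = (\<alpha> (i + 1) (fst q) \<oplus>\<^bsub>obj X' (i + 1)\<^esub> k (i + 1) (snd q), \<beta> (i + 1) (snd q))
        \<oplus>\<^bsub>obj (twisted v' Q' X') (i + 1)\<^esub> bdry (twisted v' Q' X') (i + 2) q'"
    unfolding twisted_simps idx
    by (intro bexI[of _ "(x2, z1)"] bexI[of _ "(x2', z1')"])
       (use 1 2 z1 z1' x2(1) x2'(1) in \<open>simp_all add: p\<close>)
qed

end

lemma twisted_map_strict:
  assumes X: "A_complex A X" and Q: "A_complex A Q" and v: "twisting A v Q X"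
    and \<alpha>: "A_map A \<alpha> X X'" and \<beta>: "A_map A \<beta> Q Q'"
    and comm: "\<And>i z. z \<in> carrier (obj Q i) \<Longrightarrow> \<alpha> (i - 1) (v i z) = v' i (\<beta> i z)"
  shows "A_map A (\<lambda>i z. (\<alpha> i (fst z), \<beta> i (snd z))) (twisted v Q X) (twisted v' Q' X')"
  unfolding A_map_def
proof (intro conjI allI ballI)
  fix i
  show "(\<lambda>z. (\<alpha> i (fst z), \<beta> i (snd z))) \<in> linear_maps A (obj (twisted v Q X) i) (obj (twisted v' Q' X') i)"
    unfolding twisted_simps by (intro lin_pair lin_on_fst lin_on_snd map_lin[OF \<alpha>] map_lin[OF \<beta>])
  fix z assume "z \<in> carrier (obj (twisted v Q X) i)"
  then obtain x w where z: "z = (x, w)" and x: "x \<in> carrier (obj X i)" and w: "w \<in> carrier (obj Q i)" by auto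
  show "(\<alpha> (i - 1) (fst (bdry (twisted v Q X) i z)), \<beta> (i - 1) (snd (bdry (twisted v Q X) i z)))
      = bdry (twisted v' Q' X') i (\<alpha> i (fst z), \<beta> i (snd z))"
    using lin_add[OF map_lin[OF \<alpha>] cpx_closed[OF X x] twisting_closed[OF v w]]
    by (simp add: z map_bdry[OF \<alpha> x] map_bdry[OF \<beta> w] comm[OF w])
qed

text \<open>
  The twisting \<open>v\<close>, as a map from \<open>Q\<close> to the suspension of \<open>X\<close>, lifts along the resolutions up to a homotopy, and
  the homotopy is the off-diagonal entry of the comparison map.
\<close>

lemma twisted_resolved:
  assumes X: "A_complex A X" and Q: "A_complex A Q" and v: "twisting A v Q X"
    and P: "projectively_resolved A P X" and R: "projectively_resolved A R Q"
  shows "\<exists>u. projectively_resolved A (twisted u R P) (twisted v Q X)"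
proof -
  obtain \<alpha> \<beta> where sP: "strictly_perfect A P" and \<alpha>: "A_map A \<alpha> P X" "weak_equiv \<alpha> P X"
    and sR: "strictly_perfect A R" and \<beta>: "A_map A \<beta> R Q" "weak_equiv \<beta> R Q"
    using P R unfolding projectively_resolved_def by blast
  have Pc: "A_complex A P" and Rc: "A_complex A R" and proj: "\<And>i. fg_projective A (obj R i)"
    using sP sR by (auto simp: strictly_perfect_def)
  obtain u s where u: "A_map A u R (shifted A P)"
    and s: "\<And>i. s i \<in> linear_maps A (obj R i) (obj (shifted A X) (i + 1))"
    and eq: "\<And>i z. z \<in> carrier (obj R i) \<Longrightarrow> \<alpha> (i - 1) (u i z) \<oplus>\<^bsub>obj (shifted A X) i\<^esub> s (i - 1) (bdry R i z)
      \<oplus>\<^bsub>obj (shifted A X) i\<^esub> bdry (shifted A X) (i + 1) (s i z) = v i (\<beta> i z)"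
    using lift_through_weak_equiv[OF Rc shifted_complex[OF Pc] shifted_complex[OF X] proj
        shifted_map[OF Pc X \<alpha>(1)] shifted_weak_equiv[OF Pc X \<alpha>] map_comp[OF \<beta>(1) map_of_twisting[OF Q X v]]]
    by blast
  have tu: "twisting A u R P" by (rule twisting_of_shifted_map[OF Rc Pc u])
  have s': "s i \<in> linear_maps A (obj R i) (obj X i)" for i using s[of i] by simp
  have htpy: "\<alpha> (i - 1) (u i z) \<oplus>\<^bsub>obj X (i - 1)\<^esub> s (i - 1) (bdry R i z)
      = bdry X i (s i z) \<oplus>\<^bsub>obj X (i - 1)\<^esub> v i (\<beta> i z)" if z: "z \<in> carrier (obj R i)" for i z
  proof -
    interpret right_module A "obj X (i - 1)" by (rule cpx_module[OF X])
    have c: "\<alpha> (i - 1) (u i z) \<in> carrier (obj X (i - 1))" "s (i - 1) (bdry R i z) \<in> carrier (obj X (i - 1))"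
      "bdry X i (s i z) \<in> carrier (obj X (i - 1))" "s i z \<in> carrier (obj X (i + 1 - 1))"
      using map_closed[OF \<alpha>(1) twisting_closed[OF tu z]] lin_closed[OF s' cpx_closed[OF Rc z]]
        cpx_closed[OF X lin_closed[OF s' z]] lin_closed[OF s' z] by auto
    have "bdry (shifted A X) (i + 1) (s i z) = \<ominus>\<^bsub>obj X (i - 1)\<^esub> bdry X i (s i z)"
      unfolding shifted_bdry[OF X c(4)] by simp
    then have "v i (\<beta> i z) = \<alpha> (i - 1) (u i z) \<oplus>\<^bsub>obj X (i - 1)\<^esub> s (i - 1) (bdry R i z)
      \<oplus>\<^bsub>obj X (i - 1)\<^esub> \<ominus>\<^bsub>obj X (i - 1)\<^esub> bdry X i (s i z)"
      using eq[OF z] by (simp del: shifted_simps(2))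
    then show ?thesis using c(1-3) by (simp del: shifted_simps) algebra
  qed
  show ?thesis unfolding projectively_resolved_def
    using twisted_strictly_perfect[OF sP sR tu] twisted_map[OF Pc Rc X Q tu v \<alpha>(1) \<beta>(1) s' htpy]
      twisted_weak_equiv[OF Pc Rc X Q tu v \<alpha>(1) \<beta>(1) s' htpy \<alpha>(2) \<beta>(2)] by blast
qed



section \<open>Subcomplexes and truncation\<close>

definition subcpx :: "(int \<Rightarrow> 'm set) \<Rightarrow> ('a, 'm, 'c) cpx_scheme \<Rightarrow> ('a, 'm) cpx"
  where "subcpx S C = \<lparr>obj = (\<lambda>i. (obj C i)\<lparr>carrier := S i\<rparr>), bdry = bdry C\<rparr>"

lemma subcpx_simps [simp]:
  "obj (subcpx S C) i = (obj C i)\<lparr>carrier := S i\<rparr>" "bdry (subcpx S C) = bdry C"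
  by (simp_all add: subcpx_def)

lemma subcpx_complex:
  assumes C: "A_complex A C" and S: "\<And>i. submodule A (obj C i) (S i)"
    and d: "\<And>i x. x \<in> S i \<Longrightarrow> bdry C i x \<in> S (i - 1)"
  shows "A_complex A (subcpx S C)"
proof -
  have sub: "x \<in> carrier (obj C i)" if "x \<in> S i" for x i
    using that S[of i] by (auto simp: submodule_def)
  have "bdry C i \<in> linear_maps A ((obj C i)\<lparr>carrier := S i\<rparr>) ((obj C (i - 1))\<lparr>carrier := S (i - 1)\<rparr>)" for i
    by (rule lin_restrict_cod[OF lin_restrict_dom[OF cpx_lin[OF C]]]) (use sub d in auto)
  moreover have "zero_module ((obj C i)\<lparr>carrier := S i\<rparr>)" if "i < 0" for i
    using cpx_negative[OF C that] sub S[of i] by (fastforce simp: zero_module_def submodule_def)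
  ultimately show ?thesis
    using right_module_restrict[OF cpx_module[OF C] S] cpx_dd[OF C sub]
    by (auto simp: A_complex_def)
qed

lemma subcpx_inclusion:
  assumes C: "A_complex A C" and S: "\<And>i. submodule A (obj C i) (S i)"
  shows "A_map A (\<lambda>i x. x) (subcpx S C) C"
proof -
  have "(\<lambda>x. x) \<in> linear_maps A ((obj C i)\<lparr>carrier := S i\<rparr>) (obj C i)" for i
    by (rule lin_restrict_dom[OF lin_id]) (use S[of i] in \<open>simp add: submodule_def\<close>)
  then show ?thesis by (simp add: A_map_def)
qed

text \<open>
  As long as there is no homology, the differential maps onto the cycles of degree \<open>i\<close>, which form a retract of a
  projective module; so it splits there, and its kernel in degree \<open>i + 1\<close> is again a retract.
\<close>

lemma cycles_projection:
  assumes C: "A_complex A C" and proj: "\<And>i. fg_projective A (obj C i)"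
    and ac: "\<And>i. i \<le> m \<Longrightarrow> cycles C i \<subseteq> boundaries C i" and i: "i \<le> m + 1"
  shows "\<exists>e\<in>linear_maps A (obj C i) (obj C i). \<forall>x\<in>carrier (obj C i). e x \<in> cycles C i \<and> (x \<in> cycles C i \<longrightarrow> e x = x)"
proof -
  have low: "x \<in> cycles C i" if "i \<le> 0" "x \<in> carrier (obj C i)" for i x
    using that cpx_negative[OF C, of "i - 1" "bdry C i x"] cpx_closed[OF C that(2)] by (simp add: cycles_def)
  have "int n \<le> m + 1 \<Longrightarrow> \<exists>e\<in>linear_maps A (obj C (int n)) (obj C (int n)). \<forall>x\<in>carrier (obj C (int n)).
      e x \<in> cycles C (int n) \<and> (x \<in> cycles C (int n) \<longrightarrow> e x = x)" for n
  proof (induction n)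
    case 0
    show ?case using lin_id low[of 0] by (intro bexI[of _ "\<lambda>x. x"]) auto
  next
    case (Suc n)
    define i where "i = int n"
    have i: "i \<le> m" "int (Suc n) = i + 1" using Suc.prems by (auto simp: i_def)
    interpret C1: right_module A "obj C (i + 1)" by (rule cpx_module[OF C])
    interpret C0: right_module A "obj C i" by (rule cpx_module[OF C])
    obtain e where e: "e \<in> linear_maps A (obj C i) (obj C i)"
      "\<And>x. x \<in> carrier (obj C i) \<Longrightarrow> e x \<in> cycles C i" "\<And>x. x \<in> cycles C i \<Longrightarrow> e x = x"
      using Suc i(1) by (auto simp: i_def cycles_def)
    have "e x \<in> bdry C (i + 1) ` carrier (obj C (i + 1))" if "x \<in> carrier (obj C i)" for x
      using e(2)[OF that] ac[OF i(1)] by (auto simp: boundaries_def)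
    then obtain s where s: "s \<in> linear_maps A (obj C i) (obj C (i + 1))"
      "\<And>x. x \<in> carrier (obj C i) \<Longrightarrow> bdry C (i + 1) (s x) = e x"
      using fg_projective_lift[OF proj cpx_module[OF C] cpx_module[OF C] cpx_module[OF C] cpx_lin'[OF C] e(1)]
      by blast
    have s0: "s \<zero>\<^bsub>obj C i\<^esub> = \<zero>\<^bsub>obj C (i + 1)\<^esub>" by (rule lin_zero[OF s(1) cpx_module[OF C] cpx_module[OF C]])
    let ?e = "\<lambda>x. x \<ominus>\<^bsub>obj C (i + 1)\<^esub> s (bdry C (i + 1) x)"
    have "?e \<in> linear_maps A (obj C (i + 1)) (obj C (i + 1))"
      by (intro lin_diff_maps lin_id lin_comp[OF cpx_lin'[OF C] s(1)] cpx_module[OF C])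
    moreover have "?e x \<in> cycles C (i + 1)" if x: "x \<in> carrier (obj C (i + 1))" for x
    proof -
      have dx: "bdry C (i + 1) x \<in> carrier (obj C i)" by (rule cpx_closed'[OF C x])
      have "bdry C (i + 1) x \<in> cycles C i" using dx cpx_dd'[OF C x] by (simp add: cycles_def)
      then have "bdry C (i + 1) (?e x) = \<zero>\<^bsub>obj C i\<^esub>"
        unfolding lin_diff[OF cpx_lin'[OF C] cpx_module[OF C] cpx_module[OF C] x lin_closed[OF s(1) dx]] s(2)[OF dx]
        using e(3) dx by (simp add: C0.M.minus_eq C0.M.r_neg)
      then show ?thesis using x lin_closed[OF s(1) dx] by (simp add: cycles_def)
    qed
    moreover have "?e x = x" if "x \<in> cycles C (i + 1)" for x
      using that by (simp add: cycles_def s0 C1.M.minus_eq C1.M.minus_zero_eq)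
    ultimately show ?case unfolding i(2) by (intro bexI[of _ ?e]) auto
  qed
  from this[of "nat i"] show ?thesis
    using i low[of i] lin_id by (cases "i < 0") (auto intro!: bexI[of _ "\<lambda>x. x"])
qed

text \<open>
  Replace degrees up to \<open>m\<close> by zero and degree \<open>m + 1\<close> by its cycles, which are finitely generated projective
  by the preceding lemma.
\<close>

lemma truncated_resolution:
  fixes P :: "('a, 'p) cpx"
  assumes P: "projectively_resolved A P C" and C: "A_complex A C"
    and ac: "\<And>i. i \<le> m \<Longrightarrow> cycles C i \<subseteq> boundaries C i"
  shows "\<exists>P' :: ('a, 'p) cpx. projectively_resolved A P' C \<and> (\<forall>i\<le>m. zero_module (obj P' i))"
proof -
  obtain f where sP: "strictly_perfect A P" and f: "A_map A f P C" "weak_equiv f P C"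
    using P unfolding projectively_resolved_def by blast
  have Pc: "A_complex A P" and proj: "\<And>i. fg_projective A (obj P i)" using sP by (auto simp: strictly_perfect_def)
  have acP: "cycles P i \<subseteq> boundaries P i" if im: "i \<le> m" for i
  proof
    fix x assume x: "x \<in> cycles P i"
    then have xc: "x \<in> carrier (obj P i)" "bdry P i x = \<zero>\<^bsub>obj P (i - 1)\<^esub>" by (auto simp: cycles_def)
    have "f i x \<in> cycles C i"
      using xc map_closed[OF f(1)] map_bdry[OF f(1) xc(1)]
        lin_zero[OF map_lin[OF f(1)] cpx_module[OF Pc] cpx_module[OF C], of "i - 1"] by (simp add: cycles_def)
    then obtain y where "y \<in> carrier (obj C (i + 1))" "f i x = bdry C (i + 1) y"
      using ac[OF im] by (auto simp: boundaries_def)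
    then show "x \<in> boundaries P i" using weak_equivD[OF f(2) xc(1) _ xc(2)] by (metis boundaries_def imageI)
  qed
  define S where "S i = (if i \<le> m then {\<zero>\<^bsub>obj P i\<^esub>} else if i = m + 1 then cycles P i else carrier (obj P i))" for i
  have sub: "submodule A (obj P i) (S i)" for i
    using submodule_zero[OF cpx_module[OF Pc]] submodule_cycles[OF Pc]
      right_module.rsmult_closed[OF cpx_module[OF Pc]] cpx_zero_closed[OF Pc] cpx_add_closed[OF Pc]
    by (auto simp: S_def submodule_def)
  have SP: "x \<in> carrier (obj P i)" if "x \<in> S i" for x i using that sub[of i] by (auto simp: submodule_def)
  have dS: "bdry P i x \<in> S (i - 1)" if "x \<in> S i" for x i
    using that SP[OF that] cpx_d_zero[OF Pc] cpx_closed[OF Pc SP[OF that]] cpx_dd[OF Pc SP[OF that]]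
    by (auto simp: S_def cycles_def split: if_splits)
  let ?P = "subcpx S P"
  have P': "A_complex A ?P" by (rule subcpx_complex[OF Pc sub dS])
  have fgp: "fg_projective A (obj ?P i)" for i
  proof -
    have zero: "fg_projective A (obj ?P i)" if "i \<le> m"
      using that by (intro fg_projective_zero[OF cpx_module[OF P']]) (auto simp: zero_module_def S_def)
    have mid: "fg_projective A (obj ?P i)" if i: "i = m + 1"
    proof -
      obtain e where e: "e \<in> linear_maps A (obj P i) (obj P i)"
        "\<And>x. x \<in> carrier (obj P i) \<Longrightarrow> e x \<in> cycles P i" "\<And>x. x \<in> cycles P i \<Longrightarrow> e x = x"
        using cycles_projection[OF Pc proj acP, of m i] i by (auto simp: cycles_def)
      have Si: "S i = cycles P i" using i by (simp add: S_def)
      have "(\<lambda>x. x) \<in> linear_maps A (obj ?P i) (obj P i)" by (rule map_lin[OF subcpx_inclusion[OF Pc sub]])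
      moreover have "e \<in> linear_maps A (obj P i) (obj ?P i)"
        using lin_restrict_cod[OF e(1), of "S i"] e(2) by (simp add: Si)
      ultimately have "retract_of A (obj ?P i) (obj P i)"
        unfolding retract_of_def
        by - (rule bexI[where x = "\<lambda>x. x"], rule bexI[where x = e], use e(3) Si in simp_all)
      then show ?thesis by (rule fg_projective_retract[OF proj _ cpx_module[OF P'] cpx_module[OF Pc]])
    qed
    consider "i \<le> m" | "i = m + 1" | "m + 1 < i" by linarith
    then show ?thesis using zero mid proj by cases (auto simp: S_def)
  qed
  obtain d where d: "\<forall>i>d. zero_module (obj P i)" using sP by (auto simp: strictly_perfect_def)
  have "zero_module (obj ?P i)" if "i > d" for i
  proof -
    have "zero_module (obj P i)" using d that by blast
    then show ?thesis using sub[of i] by (auto simp: zero_module_def submodule_def)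
  qed
  then have "strictly_perfect A ?P" using P' fgp unfolding strictly_perfect_def by blast
  moreover have "weak_equiv (\<lambda>i x. x) ?P P"
    unfolding weak_equiv_def
  proof (intro allI ballI impI)
    fix i x y assume "x \<in> carrier (obj ?P i)" and y: "y \<in> carrier (obj P (i + 1))" and xy: "x = bdry P (i + 1) y"
    then have x: "x \<in> S i" by simp
    interpret P1: right_module A "obj P (i + 1)" by (rule cpx_module[OF Pc])
    have z2: "\<zero>\<^bsub>obj P (i + 2)\<^esub> \<in> carrier (obj P (i + 2))" "bdry P (i + 2) \<zero>\<^bsub>obj P (i + 2)\<^esub> = \<zero>\<^bsub>obj P (i + 1)\<^esub>"
      using cpx_zero_closed[OF Pc] cpx_d_zero[OF Pc, of "i + 2"] by (auto simp: add.commute)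
    have *: "\<exists>x'\<in>carrier (obj ?P (i + 1)). \<exists>y'\<in>carrier (obj P (i + 2)).
        bdry ?P (i + 1) x' = x \<and> y = x' \<oplus>\<^bsub>obj P (i + 1)\<^esub> bdry P (i + 2) y'" if "y \<in> S (i + 1)"
      using that y xy z2 by (intro bexI[of _ y] bexI[of _ "\<zero>\<^bsub>obj P (i + 2)\<^esub>"]) auto
    show "\<exists>x'\<in>carrier (obj ?P (i + 1)). \<exists>y'\<in>carrier (obj P (i + 2)).
        bdry ?P (i + 1) x' = x \<and> y = x' \<oplus>\<^bsub>obj P (i + 1)\<^esub> bdry P (i + 2) y'"
    proof (cases "i < m")
      case True
      then have x0: "x = \<zero>\<^bsub>obj P i\<^esub>" using x by (simp add: S_def)
      then have "y \<in> cycles P (i + 1)" using y xy by (simp add: cycles_def)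
      then have "y \<in> boundaries P (i + 1)" using acP[of "i + 1"] True by auto
      then obtain y' where y': "y' \<in> carrier (obj P (i + 2))" "y = bdry P (i + 2) y'"
        by (auto simp: boundaries_def add.commute)
      have "\<zero>\<^bsub>obj P (i + 1)\<^esub> \<in> S (i + 1)" using sub[of "i + 1"] by (simp add: submodule_def)
      moreover have "bdry P (i + 1) \<zero>\<^bsub>obj P (i + 1)\<^esub> = x" using cpx_d_zero[OF Pc, of "i + 1"] x0 by simp
      ultimately show ?thesis using y' y
        by (intro bexI[of _ "\<zero>\<^bsub>obj P (i + 1)\<^esub>"] bexI[of _ y']) auto
    next
      case False
      then have "y \<in> S (i + 1)" using x xy y by (cases "i = m") (auto simp: S_def cycles_def)
      then show ?thesis by (rule *)
    qed
  qed
  ultimately have "projectively_resolved A ?P C"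
    using map_comp[OF subcpx_inclusion[OF Pc sub] f(1)] weak_equiv_comp[OF P' Pc C subcpx_inclusion[OF Pc sub] _ f]
    unfolding projectively_resolved_def by blast
  moreover have "\<forall>i\<le>m. zero_module (obj ?P i)" by (simp add: zero_module_def S_def)
  ultimately show ?thesis by blast
qed

section \<open>Polynomial modules\<close>

text \<open>
  The \<open>A[t]\<close>-module \<open>M[t]\<close>; the value at \<open>k\<close> is the coefficient of \<open>t\<^sup>k\<close>.
\<close>

definition poly_module :: "('a, 'm, 'c) rmodule_scheme \<Rightarrow> ('a, nat \<Rightarrow> 'm) rmodule"
  where "poly_module M =
    \<lparr>carrier = {p. (\<forall>k. p k \<in> carrier M) \<and> (\<exists>n. \<forall>k\<ge>n. p k = \<zero>\<^bsub>M\<^esub>)}, mult = undefined, one = undefined,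
     zero = (\<lambda>k. \<zero>\<^bsub>M\<^esub>), add = (\<lambda>p q k. p k \<oplus>\<^bsub>M\<^esub> q k), rsmult = (\<lambda>p a k. p k \<triangleleft>\<^bsub>M\<^esub> a)\<rparr>"

definition poly_const :: "('a, 'm, 'c) rmodule_scheme \<Rightarrow> 'm \<Rightarrow> nat \<Rightarrow> 'm"
  where "poly_const M x = case_nat x (\<lambda>_. \<zero>\<^bsub>M\<^esub>)"

text \<open>
  Multiplication by \<open>t\<close>.
\<close>

definition poly_shift :: "('a, 'm, 'c) rmodule_scheme \<Rightarrow> (nat \<Rightarrow> 'm) \<Rightarrow> nat \<Rightarrow> 'm"
  where "poly_shift M p = case_nat \<zero>\<^bsub>M\<^esub> p"

lemma poly_module_simps [simp]:
  "\<zero>\<^bsub>poly_module M\<^esub> = (\<lambda>k. \<zero>\<^bsub>M\<^esub>)"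
  "p \<oplus>\<^bsub>poly_module M\<^esub> q = (\<lambda>k. p k \<oplus>\<^bsub>M\<^esub> q k)"
  "p \<triangleleft>\<^bsub>poly_module M\<^esub> a = (\<lambda>k. p k \<triangleleft>\<^bsub>M\<^esub> a)"
  by (simp_all add: poly_module_def)

lemma poly_carrier:
  "p \<in> carrier (poly_module M) \<longleftrightarrow> (\<forall>k. p k \<in> carrier M) \<and> (\<exists>n. \<forall>k\<ge>n. p k = \<zero>\<^bsub>M\<^esub>)"
  by (simp add: poly_module_def)

lemma poly_coeff: "p \<in> carrier (poly_module M) \<Longrightarrow> p k \<in> carrier M"
  by (simp add: poly_carrier)

lemma poly_bound:
  assumes "p \<in> carrier (poly_module M)" "q \<in> carrier (poly_module M)"
  obtains n where "\<And>k. k \<ge> n \<Longrightarrow> p k = \<zero>\<^bsub>M\<^esub>" "\<And>k. k \<ge> n \<Longrightarrow> q k = \<zero>\<^bsub>M\<^esub>"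
proof -
  obtain n n' where "\<forall>k\<ge>n. p k = \<zero>\<^bsub>M\<^esub>" "\<forall>k\<ge>n'. q k = \<zero>\<^bsub>M\<^esub>" using assms by (auto simp: poly_carrier)
  then show ?thesis by (intro that[of "max n n'"]) auto
qed

lemma right_module_poly:
  assumes M: "right_module A M" shows "right_module A (poly_module M)"
proof -
  interpret right_module A M by fact
  show ?thesis
  proof (rule right_moduleI)
    fix p assume p: "p \<in> carrier (poly_module M)"
    then obtain n where "\<And>k. k \<ge> n \<Longrightarrow> p k = \<zero>\<^bsub>M\<^esub>" using poly_bound by blast
    then have "(\<lambda>k. \<ominus>\<^bsub>M\<^esub> p k) \<in> carrier (poly_module M)"
      using p by (auto simp: poly_carrier M.minus_zero_eq)
    then show "\<exists>q\<in>carrier (poly_module M). q \<oplus>\<^bsub>poly_module M\<^esub> p = \<zero>\<^bsub>poly_module M\<^esub>"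
      using poly_coeff[OF p] by (intro bexI[of _ "\<lambda>k. \<ominus>\<^bsub>M\<^esub> p k"]) (auto simp: M.l_neg)
    fix a assume a: "a \<in> carrier A"
    show "p \<triangleleft>\<^bsub>poly_module M\<^esub> a \<in> carrier (poly_module M)"
      using p a poly_coeff[OF p] by (auto simp: poly_carrier rsmult_closed) (metis zero_rsmult)
  next
    fix p q assume p: "p \<in> carrier (poly_module M)" and q: "q \<in> carrier (poly_module M)"
    obtain n where "\<And>k. k \<ge> n \<Longrightarrow> p k = \<zero>\<^bsub>M\<^esub>" "\<And>k. k \<ge> n \<Longrightarrow> q k = \<zero>\<^bsub>M\<^esub>" using poly_bound[OF p q] by blast
    then show "p \<oplus>\<^bsub>poly_module M\<^esub> q \<in> carrier (poly_module M)"
      using p q by (auto simp: poly_carrier intro!: exI[of _ n])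
  qed (auto simp: right_module_ring[OF M] fun_eq_iff poly_coeff M.a_ac rsmult_add_left rsmult_add_right
      rsmult_assoc rsmult_one, auto simp: poly_carrier)
qed

context
  fixes A :: "('a, 'b) ring_scheme" and M :: "('a, 'm, 'c) rmodule_scheme"
  assumes M: "right_module A M"
begin

interpretation M: right_module A M by (rule M)

lemma poly_const_closed: "x \<in> carrier M \<Longrightarrow> poly_const M x \<in> carrier (poly_module M)"
  by (auto simp: poly_carrier poly_const_def split: nat.split intro!: exI[of _ "Suc 0"])

lemma lin_poly_const: "poly_const M \<in> linear_maps A M (poly_module M)"
  by (rule linear_mapsI)
     (auto simp: poly_const_closed, auto simp: poly_const_def fun_eq_iff M.zero_rsmult split: nat.split)

lemma poly_shift_closed:
  assumes "p \<in> carrier (poly_module M)" shows "poly_shift M p \<in> carrier (poly_module M)"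
proof -
  obtain n where "\<forall>k\<ge>n. p k = \<zero>\<^bsub>M\<^esub>" using assms by (auto simp: poly_carrier)
  then have "\<forall>k\<ge>Suc n. poly_shift M p k = \<zero>\<^bsub>M\<^esub>" by (auto simp: poly_shift_def split: nat.split)
  moreover have "poly_shift M p k \<in> carrier M" for k
    using assms by (auto simp: poly_carrier poly_shift_def split: nat.split)
  ultimately show ?thesis unfolding poly_carrier by blast
qed

lemma lin_poly_shift: "poly_shift M \<in> linear_maps A (poly_module M) (poly_module M)"
  by (rule linear_mapsI)
     (auto simp: poly_shift_closed, auto simp: poly_shift_def fun_eq_iff M.zero_rsmult split: nat.split)

lemma poly_decompose:
  assumes p: "p \<in> carrier (poly_module M)"
  shows "(\<lambda>k. p (Suc k)) \<in> carrier (poly_module M)"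
    and "p = poly_const M (p 0) \<oplus>\<^bsub>poly_module M\<^esub> poly_shift M (\<lambda>k. p (Suc k))"
proof -
  obtain n where "\<forall>k\<ge>n. p k = \<zero>\<^bsub>M\<^esub>" using p by (auto simp: poly_carrier)
  then have "\<forall>k\<ge>n. p (Suc k) = \<zero>\<^bsub>M\<^esub>" by auto
  then show "(\<lambda>k. p (Suc k)) \<in> carrier (poly_module M)" using p unfolding poly_carrier by blast
  show "p = poly_const M (p 0) \<oplus>\<^bsub>poly_module M\<^esub> poly_shift M (\<lambda>k. p (Suc k))"
    using poly_coeff[OF p] by (auto simp: fun_eq_iff poly_const_def poly_shift_def split: nat.split)
qed

lemma poly_induct [consumes 1, case_names zero pCons]:
  assumes p: "p \<in> carrier (poly_module M)" and zero: "Pr (\<lambda>k. \<zero>\<^bsub>M\<^esub>)"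
    and step: "\<And>x p. \<lbrakk>x \<in> carrier M; p \<in> carrier (poly_module M); Pr p\<rbrakk> \<Longrightarrow>
      Pr (poly_const M x \<oplus>\<^bsub>poly_module M\<^esub> poly_shift M p)"
  shows "Pr p"
proof -
  have "Pr p" if "p \<in> carrier (poly_module M)" "\<forall>k\<ge>n. p k = \<zero>\<^bsub>M\<^esub>" for n p
    using that
  proof (induction n arbitrary: p)
    case 0
    then have "p = (\<lambda>k. \<zero>\<^bsub>M\<^esub>)" by (auto simp: fun_eq_iff)
    then show ?case using zero by simp
  next
    case (Suc n)
    have "Pr (\<lambda>k. p (Suc k))" using poly_decompose(1)[OF Suc.prems(1)] Suc.prems(2) by (intro Suc.IH) auto
    then show ?case
      using step[OF poly_coeff[OF Suc.prems(1), of 0] poly_decompose(1)[OF Suc.prems(1)]]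
        poly_decompose(2)[OF Suc.prems(1)] by metis
  qed
  then show ?thesis using p by (auto simp: poly_carrier)
qed

text \<open>
  \<open>M[t]\<close> is generated by constants as an \<open>A[t]\<close>-module.
\<close>

lemma poly_maps_eq:
  assumes N: "right_module A N"
    and F: "F \<in> linear_maps A (poly_module M) N" and G: "G \<in> linear_maps A (poly_module M) N"
    and Ft: "\<And>p. p \<in> carrier (poly_module M) \<Longrightarrow> F (poly_shift M p) = t (F p)"
    and Gt: "\<And>p. p \<in> carrier (poly_module M) \<Longrightarrow> G (poly_shift M p) = t (G p)"
    and eq: "\<And>x. x \<in> carrier M \<Longrightarrow> F (poly_const M x) = G (poly_const M x)"
    and p: "p \<in> carrier (poly_module M)"
  shows "F p = G p"
  using p
proof (induction rule: poly_induct)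
  case zero
  show ?case using lin_zero[OF F right_module_poly[OF M] N] lin_zero[OF G right_module_poly[OF M] N] by simp
next
  case (pCons x p)
  note cl = poly_const_closed[OF pCons.hyps(1)] poly_shift_closed[OF pCons.hyps(2)]
  show ?case
    unfolding lin_add[OF F cl] lin_add[OF G cl] by (simp add: Ft Gt eq pCons)
qed

end

text \<open>
  The sum of \<open>t\<^sup>k (u (p k))\<close> for \<open>k < n\<close>, by Horner's rule.
\<close>

primrec horner :: "('a, 'n, 'd) rmodule_scheme \<Rightarrow> ('m \<Rightarrow> 'n) \<Rightarrow> ('n \<Rightarrow> 'n) \<Rightarrow> nat \<Rightarrow> (nat \<Rightarrow> 'm) \<Rightarrow> 'n"
  where
    "horner N u t 0 p = \<zero>\<^bsub>N\<^esub>"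
  | "horner N u t (Suc n) p = u (p 0) \<oplus>\<^bsub>N\<^esub> t (horner N u t n (\<lambda>k. p (Suc k)))"

text \<open>
  The \<open>A[t]\<close>-linear map \<open>M[t] \<rightarrow> N\<close> that extends \<open>u\<close>, where \<open>N\<close> is an \<open>A[t]\<close>-module through \<open>t\<close>. The least
  bound is only one possible number of terms: by \<open>poly_extend_eq_horner\<close> every bound gives the same value.
\<close>

definition poly_extend ::
  "('a, 'm, 'c) rmodule_scheme \<Rightarrow> ('a, 'n, 'd) rmodule_scheme \<Rightarrow> ('m \<Rightarrow> 'n) \<Rightarrow> ('n \<Rightarrow> 'n) \<Rightarrow> (nat \<Rightarrow> 'm) \<Rightarrow> 'n"
  where "poly_extend M N u t p = horner N u t (LEAST n. \<forall>k\<ge>n. p k = \<zero>\<^bsub>M\<^esub>) p"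

context
  fixes A :: "('a, 'b) ring_scheme" and M :: "('a, 'm, 'c) rmodule_scheme" and N :: "('a, 'n, 'd) rmodule_scheme" and u t
  assumes M: "right_module A M" and N: "right_module A N"
    and u: "u \<in> linear_maps A M N" and t: "t \<in> linear_maps A N N"
begin

interpretation M: right_module A M by (rule M)
interpretation N: right_module A N by (rule N)

lemma horner_closed: "(\<And>k. p k \<in> carrier M) \<Longrightarrow> horner N u t n p \<in> carrier N"
  by (induction n arbitrary: p) (auto simp: lin_closed[OF u] lin_closed[OF t])

lemma horner_zero: "horner N u t n (\<lambda>k. \<zero>\<^bsub>M\<^esub>) = \<zero>\<^bsub>N\<^esub>"
  by (induction n) (auto simp: lin_zero[OF u M N] lin_zero[OF t N N])

lemma horner_extend:
  assumes "\<And>k. p k \<in> carrier M" "\<forall>k\<ge>n. p k = \<zero>\<^bsub>M\<^esub>" shows "horner N u t (n + j) p = horner N u t n p"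
  using assms
proof (induction n arbitrary: p)
  case 0
  then have "p = (\<lambda>k. \<zero>\<^bsub>M\<^esub>)" by (auto simp: fun_eq_iff)
  then show ?case using horner_zero by simp
next
  case (Suc n)
  then show ?case using Suc.IH[of "\<lambda>k. p (Suc k)"] by simp
qed

lemma poly_extend_eq_horner:
  assumes p: "p \<in> carrier (poly_module M)" and n: "\<forall>k\<ge>n. p k = \<zero>\<^bsub>M\<^esub>"
  shows "poly_extend M N u t p = horner N u t n p"
proof -
  define l where "l = (LEAST n. \<forall>k\<ge>n. p k = \<zero>\<^bsub>M\<^esub>)"
  have l: "\<forall>k\<ge>l. p k = \<zero>\<^bsub>M\<^esub>" unfolding l_def using n by (rule LeastI)
  have "l \<le> n" unfolding l_def using n by (rule Least_le)
  then have "horner N u t n p = horner N u t l p"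
    using horner_extend[OF poly_coeff[OF p] l, of "n - l"] by simp
  then show ?thesis by (simp add: poly_extend_def l_def)
qed

lemma horner_add:
  "(\<And>k. p k \<in> carrier M) \<Longrightarrow> (\<And>k. q k \<in> carrier M) \<Longrightarrow>
    horner N u t n (\<lambda>k. p k \<oplus>\<^bsub>M\<^esub> q k) = horner N u t n p \<oplus>\<^bsub>N\<^esub> horner N u t n q"
proof (induction n arbitrary: p q)
  case (Suc n)
  have c: "horner N u t n (\<lambda>k. p (Suc k)) \<in> carrier N" "horner N u t n (\<lambda>k. q (Suc k)) \<in> carrier N"
    by (rule horner_closed, rule Suc.prems)+
  show ?case
    using Suc lin_closed[OF u] lin_closed[OF t] c by (simp add: lin_add[OF u] lin_add[OF t] N.M.a_ac)
qed simp

lemma horner_smult: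
  "(\<And>k. p k \<in> carrier M) \<Longrightarrow> a \<in> carrier A \<Longrightarrow>
    horner N u t n (\<lambda>k. p k \<triangleleft>\<^bsub>M\<^esub> a) = horner N u t n p \<triangleleft>\<^bsub>N\<^esub> a"
proof (induction n arbitrary: p)
  case (Suc n)
  have c: "horner N u t n (\<lambda>k. p (Suc k)) \<in> carrier N"
    by (rule horner_closed, rule Suc.prems)
  show ?case
    using Suc lin_closed[OF u] lin_closed[OF t] c by (simp add: lin_smult[OF u] lin_smult[OF t] N.rsmult_add_left)
qed (simp add: N.zero_rsmult)

lemma lin_poly_extend: "poly_extend M N u t \<in> linear_maps A (poly_module M) N"
proof (rule linear_mapsI)
  fix p assume p: "p \<in> carrier (poly_module M)"
  then obtain n where n: "\<forall>k\<ge>n. p k = \<zero>\<^bsub>M\<^esub>" by (auto simp: poly_carrier)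
  show "poly_extend M N u t p \<in> carrier N"
    unfolding poly_extend_eq_horner[OF p n] by (rule horner_closed[OF poly_coeff[OF p]])
  fix a assume a: "a \<in> carrier A"
  have "p \<triangleleft>\<^bsub>poly_module M\<^esub> a \<in> carrier (poly_module M)"
    by (rule right_module.rsmult_closed[OF right_module_poly[OF M] p a])
  then show "poly_extend M N u t (p \<triangleleft>\<^bsub>poly_module M\<^esub> a) = poly_extend M N u t p \<triangleleft>\<^bsub>N\<^esub> a"
    using poly_extend_eq_horner[of "p \<triangleleft>\<^bsub>poly_module M\<^esub> a" n] poly_extend_eq_horner[OF p n] n a
      horner_smult[OF poly_coeff[OF p] a] by (simp add: M.zero_rsmult)
next
  fix p q assume p: "p \<in> carrier (poly_module M)" and q: "q \<in> carrier (poly_module M)"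
  obtain n where n: "\<And>k. k \<ge> n \<Longrightarrow> p k = \<zero>\<^bsub>M\<^esub>" "\<And>k. k \<ge> n \<Longrightarrow> q k = \<zero>\<^bsub>M\<^esub>" using poly_bound[OF p q] by blast
  have "p \<oplus>\<^bsub>poly_module M\<^esub> q \<in> carrier (poly_module M)"
    using right_module_poly[OF M] p q by (meson abelian_groupE(1) right_module_def)
  then show "poly_extend M N u t (p \<oplus>\<^bsub>poly_module M\<^esub> q) = poly_extend M N u t p \<oplus>\<^bsub>N\<^esub> poly_extend M N u t q"
    using poly_extend_eq_horner[of "p \<oplus>\<^bsub>poly_module M\<^esub> q" n] poly_extend_eq_horner[OF p, of n]
      poly_extend_eq_horner[OF q, of n] n horner_add[OF poly_coeff[OF p] poly_coeff[OF q]] by simp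
qed

lemma poly_extend_const:
  assumes x: "x \<in> carrier M" shows "poly_extend M N u t (poly_const M x) = u x"
proof -
  have "\<forall>k\<ge>1. poly_const M x k = \<zero>\<^bsub>M\<^esub>" by (auto simp: poly_const_def split: nat.split)
  from poly_extend_eq_horner[OF poly_const_closed[OF M x] this] show ?thesis
    using lin_closed[OF u x] by (simp add: poly_const_def lin_zero[OF t N N])
qed

lemma poly_extend_shift:
  assumes p: "p \<in> carrier (poly_module M)"
  shows "poly_extend M N u t (poly_shift M p) = t (poly_extend M N u t p)"
proof -
  obtain n where n: "\<forall>k\<ge>n. p k = \<zero>\<^bsub>M\<^esub>" using p by (auto simp: poly_carrier)
  then have "\<forall>k\<ge>Suc n. poly_shift M p k = \<zero>\<^bsub>M\<^esub>" by (auto simp: poly_shift_def split: nat.split)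
  from poly_extend_eq_horner[OF poly_shift_closed[OF M p] this] poly_extend_eq_horner[OF p n] show ?thesis
    using lin_closed[OF t horner_closed[OF poly_coeff[OF p]]] by (simp add: poly_shift_def lin_zero[OF u M N])
qed

end

definition poly_map :: "('m \<Rightarrow> 'n) \<Rightarrow> (nat \<Rightarrow> 'm) \<Rightarrow> nat \<Rightarrow> 'n"
  where "poly_map u p = (\<lambda>k. u (p k))"

lemma lin_poly_map:
  assumes u: "u \<in> linear_maps A M N" and M: "right_module A M" and N: "right_module A N"
  shows "poly_map u \<in> linear_maps A (poly_module M) (poly_module N)"
proof (rule linear_mapsI)
  fix p assume p: "p \<in> carrier (poly_module M)"
  then obtain n where n: "\<forall>k\<ge>n. p k = \<zero>\<^bsub>M\<^esub>" by (auto simp: poly_carrier)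
  then have "\<forall>k\<ge>n. poly_map u p k = \<zero>\<^bsub>N\<^esub>" using lin_zero[OF u M N] by (simp add: poly_map_def)
  then show "poly_map u p \<in> carrier (poly_module N)"
    using lin_closed[OF u poly_coeff[OF p]] by (auto simp: poly_carrier poly_map_def)
qed (auto simp: poly_map_def fun_eq_iff lin_add[OF u] lin_smult[OF u] poly_coeff)

lemma poly_map_shift:
  "u \<zero>\<^bsub>M\<^esub> = \<zero>\<^bsub>N\<^esub> \<Longrightarrow> poly_map u (poly_shift M p) = poly_shift N (poly_map u p)"
  by (auto simp: poly_map_def poly_shift_def fun_eq_iff split: nat.split)

lemma poly_map_const: "u \<zero>\<^bsub>M\<^esub> = \<zero>\<^bsub>N\<^esub> \<Longrightarrow> poly_map u (poly_const M x) = poly_const N (u x)"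
  by (auto simp: poly_map_def poly_const_def fun_eq_iff split: nat.split)

text \<open>
  Multiplication by \<open>t - \<tau>\<close> on \<open>M[t]\<close>, where \<open>\<tau>\<close> acts on coefficients.
\<close>

definition char_map ::
  "('a, 'b) ring_scheme \<Rightarrow> ('a, 'm, 'c) rmodule_scheme \<Rightarrow> ('m \<Rightarrow> 'm) \<Rightarrow> (nat \<Rightarrow> 'm) \<Rightarrow> nat \<Rightarrow> 'm"
  where "char_map A M \<tau> p = poly_shift M p
    \<oplus>\<^bsub>poly_module M\<^esub> (poly_map \<tau> p \<triangleleft>\<^bsub>poly_module M\<^esub> (\<ominus>\<^bsub>A\<^esub> \<one>\<^bsub>A\<^esub>))"

context
  fixes A :: "('a, 'b) ring_scheme" and M :: "('a, 'm, 'c) rmodule_scheme" and \<tau>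
  assumes M: "right_module A M" and \<tau>: "\<tau> \<in> linear_maps A M M"
begin

interpretation M: right_module A M by (rule M)

lemma lin_char_map: "char_map A M \<tau> \<in> linear_maps A (poly_module M) (poly_module M)"
proof -
  have "(\<lambda>p. poly_shift M p \<oplus>\<^bsub>poly_module M\<^esub> (poly_map \<tau> p \<triangleleft>\<^bsub>poly_module M\<^esub> (\<ominus>\<^bsub>A\<^esub> \<one>\<^bsub>A\<^esub>)))
      \<in> linear_maps A (poly_module M) (poly_module M)"
    by (intro lin_plus lin_neg lin_poly_shift lin_poly_map right_module_poly M \<tau>)
  then show ?thesis by (simp add: char_map_def[abs_def])
qed

lemma char_map_coeff:
  "p \<in> carrier (poly_module M) \<Longrightarrow> char_map A M \<tau> p k = poly_shift M p k \<ominus>\<^bsub>M\<^esub> \<tau> (p k)"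
  using lin_closed[OF \<tau> poly_coeff] by (simp add: char_map_def poly_map_def M.rsmult_minus_one a_minus_def)

lemma char_map_shift:
  assumes p: "p \<in> carrier (poly_module M)"
  shows "char_map A M \<tau> (poly_shift M p) = poly_shift M (char_map A M \<tau> p)"
proof
  fix k
  show "char_map A M \<tau> (poly_shift M p) k = poly_shift M (char_map A M \<tau> p) k"
    unfolding char_map_coeff[OF poly_shift_closed[OF M p]]
    by (cases k) (auto simp: poly_shift_def char_map_coeff[OF p] lin_zero[OF \<tau> M M] M.M.minus_eq M.M.minus_zero_eq)
qed

text \<open>
  Division with remainder by the monic polynomial \<open>t - \<tau>\<close>.
\<close>

lemma poly_division:
  assumes p: "p \<in> carrier (poly_module M)"
  shows "\<exists>x\<in>carrier M. \<exists>r\<in>carrier (poly_module M). p = poly_const M x \<oplus>\<^bsub>poly_module M\<^esub> char_map A M \<tau> r"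
  using p
proof (induction rule: poly_induct[OF M, consumes 1, case_names zero pCons])
  case zero
  interpret P: right_module A "poly_module M" by (rule right_module_poly[OF M])
  have "char_map A M \<tau> \<zero>\<^bsub>poly_module M\<^esub> = \<zero>\<^bsub>poly_module M\<^esub>"
    by (rule lin_zero[OF lin_char_map right_module_poly[OF M] right_module_poly[OF M]])
  moreover have "poly_const M \<zero>\<^bsub>M\<^esub> = \<zero>\<^bsub>poly_module M\<^esub>"
    by (rule lin_zero[OF lin_poly_const[OF M] M right_module_poly[OF M]])
  ultimately show ?case
    by (intro bexI[of _ "\<zero>\<^bsub>M\<^esub>"] bexI[of _ "\<zero>\<^bsub>poly_module M\<^esub>"] P.M.zero_closed M.M.zero_closed)
       (simp del: poly_module_simps(2) add: P.M.l_zero[unfolded poly_module_simps(1)] P.M.zero_closed[unfolded poly_module_simps(1)])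
next
  case (pCons x p)
  interpret P: right_module A "poly_module M" by (rule right_module_poly[OF M])
  obtain y r where y: "y \<in> carrier M" and r: "r \<in> carrier (poly_module M)"
    and p: "p = poly_const M y \<oplus>\<^bsub>poly_module M\<^esub> char_map A M \<tau> r" using pCons.IH by blast
  \<comment> \<open>\<open>t y = (t - \<tau>) y + \<tau> y\<close>\<close>
  have y1: "poly_shift M (poly_const M y)
      = char_map A M \<tau> (poly_const M y) \<oplus>\<^bsub>poly_module M\<^esub> poly_const M (\<tau> y)"
  proof
    fix k
    show "poly_shift M (poly_const M y) k
      = (char_map A M \<tau> (poly_const M y) \<oplus>\<^bsub>poly_module M\<^esub> poly_const M (\<tau> y)) k"
      using y lin_closed[OF \<tau> y]
      unfolding poly_module_simps char_map_coeff[OF poly_const_closed[OF M y]]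
      by (cases k) (auto simp: poly_shift_def poly_const_def
        lin_zero[OF \<tau> M M] M.M.minus_eq M.M.minus_zero_eq M.M.l_neg split: nat.split)
  qed
  have cl: "poly_const M y \<in> carrier (poly_module M)" "poly_const M x \<in> carrier (poly_module M)"
    "poly_const M (\<tau> y) \<in> carrier (poly_module M)" "char_map A M \<tau> r \<in> carrier (poly_module M)"
    "poly_shift M r \<in> carrier (poly_module M)" "char_map A M \<tau> (poly_const M y) \<in> carrier (poly_module M)"
    "char_map A M \<tau> (poly_shift M r) \<in> carrier (poly_module M)"
    using poly_const_closed[OF M] lin_closed[OF \<tau>] y pCons.hyps lin_closed[OF lin_char_map] r poly_shift_closed[OF M] by auto
  have "poly_shift M p = (char_map A M \<tau> (poly_const M y) \<oplus>\<^bsub>poly_module M\<^esub> poly_const M (\<tau> y))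
      \<oplus>\<^bsub>poly_module M\<^esub> char_map A M \<tau> (poly_shift M r)"
    unfolding p lin_add[OF lin_poly_shift[OF M] cl(1,4)] y1 char_map_shift[OF r] ..
  then have "poly_const M x \<oplus>\<^bsub>poly_module M\<^esub> poly_shift M p
    = (poly_const M x \<oplus>\<^bsub>poly_module M\<^esub> poly_const M (\<tau> y))
      \<oplus>\<^bsub>poly_module M\<^esub> (char_map A M \<tau> (poly_const M y) \<oplus>\<^bsub>poly_module M\<^esub> char_map A M \<tau> (poly_shift M r))"
    using cl by (simp only: P.M.a_ac P.M.a_closed)
  also have "\<dots> = poly_const M (x \<oplus>\<^bsub>M\<^esub> \<tau> y)
      \<oplus>\<^bsub>poly_module M\<^esub> char_map A M \<tau> (poly_const M y \<oplus>\<^bsub>poly_module M\<^esub> poly_shift M r)"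
    unfolding lin_add[OF lin_char_map cl(1,5)] lin_add[OF lin_poly_const[OF M] pCons.hyps(1) lin_closed[OF \<tau> y]] ..
  finally show ?case
    using pCons.hyps(1) lin_closed[OF \<tau> y] P.M.a_closed[OF cl(1,5)] M.M.a_closed by blast
qed

text \<open>
  Comparison of coefficients gives \<open>r k = \<tau> (r (k + 1))\<close> for all \<open>k\<close>, so \<open>r\<close> vanishes by descending induction
  from its degree bound.
\<close>

lemma poly_division_unique:
  assumes x: "x \<in> carrier M" and r: "r \<in> carrier (poly_module M)" and eq: "poly_const M x = char_map A M \<tau> r"
  shows "x = \<zero>\<^bsub>M\<^esub>" and "r = \<zero>\<^bsub>poly_module M\<^esub>"
proof -
  have "\<zero>\<^bsub>M\<^esub> = r k \<ominus>\<^bsub>M\<^esub> \<tau> (r (Suc k))" for k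
    using fun_cong[OF eq, of "Suc k"] char_map_coeff[OF r, of "Suc k"] by (simp add: poly_const_def poly_shift_def)
  then have down: "r k = \<tau> (r (Suc k))" for k
    using M.M.minus_eq_zeroD poly_coeff[OF r] lin_closed[OF \<tau>] by metis
  obtain n where n: "\<forall>k\<ge>n. r k = \<zero>\<^bsub>M\<^esub>" using r by (auto simp: poly_carrier)
  have "r (n - j) = \<zero>\<^bsub>M\<^esub>" for j
  proof (induction j)
    case (Suc j)
    show ?case
    proof (cases "j < n")
      case True
      then have "Suc (n - Suc j) = n - j" by simp
      then show ?thesis using down[of "n - Suc j"] Suc lin_zero[OF \<tau> M M] by simp
    qed (use Suc in simp)
  qed (use n in simp)
  then have "r k = \<zero>\<^bsub>M\<^esub>" for k
    using n[rule_format, of k] by (metis diff_diff_cancel nat_le_linear)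
  then show r0: "r = \<zero>\<^bsub>poly_module M\<^esub>" by (simp add: fun_eq_iff)
  show "x = \<zero>\<^bsub>M\<^esub>"
    using fun_cong[OF eq, of 0] char_map_coeff[OF r, of 0] lin_zero[OF \<tau> M M]
    by (simp add: poly_const_def poly_shift_def r0 M.M.minus_eq M.M.minus_zero_eq)
qed

end



section \<open>The algebraic mapping telescope\<close>

definition poly_cpx :: "('a, 'm, 'c) cpx_scheme \<Rightarrow> ('a, nat \<Rightarrow> 'm) cpx"
  where "poly_cpx P = \<lparr>obj = (\<lambda>i. poly_module (obj P i)), bdry = (\<lambda>i. poly_map (bdry P i))\<rparr>"

lemma poly_cpx_simps [simp]:
  "obj (poly_cpx P) i = poly_module (obj P i)" "bdry (poly_cpx P) i = poly_map (bdry P i)"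
  by (simp_all add: poly_cpx_def)

lemma poly_cpx_complex:
  assumes P: "A_complex A P" shows "A_complex A (poly_cpx P)"
proof -
  have "zero_module (poly_module (obj P i))" if "i < 0" for i
  proof -
    have "p = (\<lambda>k. \<zero>\<^bsub>obj P i\<^esub>)" if p: "p \<in> carrier (poly_module (obj P i))" for p
      using cpx_negative[OF P \<open>i < 0\<close> poly_coeff[OF p]] by auto
    moreover have "(\<lambda>k. \<zero>\<^bsub>obj P i\<^esub>) \<in> carrier (poly_module (obj P i))"
      using cpx_zero_closed[OF P] by (auto simp: poly_carrier)
    ultimately show ?thesis unfolding zero_module_def poly_module_simps by blast
  qed
  moreover have "poly_map (bdry P (i - 1)) (poly_map (bdry P i) p) = (\<lambda>k. \<zero>\<^bsub>obj P (i - 2)\<^esub>)"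
    if "p \<in> carrier (poly_module (obj P i))" for i p
    using cpx_dd[OF P poly_coeff[OF that]] by (simp add: poly_map_def)
  moreover have "right_module A (poly_module (obj P i))" for i
    by (rule right_module_poly[OF cpx_module[OF P]])
  moreover have "poly_map (bdry P i) \<in> linear_maps A (poly_module (obj P i)) (poly_module (obj P (i - 1)))" for i
    by (rule lin_poly_map[OF cpx_lin[OF P] cpx_module[OF P] cpx_module[OF P]])
  ultimately show ?thesis
    unfolding A_complex_def poly_cpx_simps poly_module_simps by blast
qed

lemma char_map_natural:
  assumes M: "right_module A M" and N: "right_module A N" and u: "u \<in> linear_maps A M N"
    and \<tau>: "\<tau> \<in> linear_maps A M M" and \<sigma>: "\<sigma> \<in> linear_maps A N N"
    and comm: "\<And>x. x \<in> carrier M \<Longrightarrow> u (\<tau> x) = \<sigma> (u x)" and p: "p \<in> carrier (poly_module M)"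
  shows "poly_map u (char_map A M \<tau> p) = char_map A N \<sigma> (poly_map u p)"
proof
  fix k
  have up: "poly_map u p \<in> carrier (poly_module N)" by (rule lin_closed[OF lin_poly_map[OF u M N] p])
  have "poly_shift M p k \<in> carrier M" by (rule poly_coeff[OF poly_shift_closed[OF M p]])
  then show "poly_map u (char_map A M \<tau> p) k = char_map A N \<sigma> (poly_map u p) k"
    using char_map_coeff[OF M \<tau> p, of k] char_map_coeff[OF N \<sigma> up, of k] lin_zero[OF u M N] comm[OF poly_coeff[OF p]]
      lin_diff[OF u M N _ lin_closed[OF \<tau> poly_coeff[OF p]]]
    by (simp add: poly_map_def poly_shift_def split: nat.split)
qed

text \<open>
  The cone of \<open>t - \<tau>\<close> on \<open>P[t]\<close>. It consists of extended \<open>A[t]\<close>-modules, and it replaces \<open>P\<close> with \<open>t\<close> acting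
  as \<open>\<tau>\<close>.
\<close>

definition telescope ::
  "('a, 'b) ring_scheme \<Rightarrow> (int \<Rightarrow> 'm \<Rightarrow> 'm) \<Rightarrow> ('a, 'm, 'c) cpx_scheme \<Rightarrow> ('a, (nat \<Rightarrow> 'm) \<times> (nat \<Rightarrow> 'm)) cpx"
  where "telescope A \<tau> P =
    twisted (\<lambda>i. char_map A (obj P (i - 1)) (\<tau> (i - 1))) (shifted A (poly_cpx P)) (poly_cpx P)"

definition telescope_shift ::
  "('a, 'm, 'c) cpx_scheme \<Rightarrow> int \<Rightarrow> (nat \<Rightarrow> 'm) \<times> (nat \<Rightarrow> 'm) \<Rightarrow> (nat \<Rightarrow> 'm) \<times> (nat \<Rightarrow> 'm)"
  where "telescope_shift P i z = (poly_shift (obj P i) (fst z), poly_shift (obj P (i - 1)) (snd z))"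

definition telescope_incl :: "('a, 'm, 'c) cpx_scheme \<Rightarrow> int \<Rightarrow> 'm \<Rightarrow> (nat \<Rightarrow> 'm) \<times> (nat \<Rightarrow> 'm)"
  where "telescope_incl P i x = (poly_const (obj P i) x, \<zero>\<^bsub>poly_module (obj P (i - 1))\<^esub>)"

text \<open>
  The \<open>A[t]\<close>-linear map determined by \<open>f\<close> on the generators in \<open>P\<close> and by the homotopy \<open>h\<close> on the generators in
  its suspension.
\<close>

definition telescope_map ::
  "('a, 'm, 'c) cpx_scheme \<Rightarrow> ('a, 'n, 'd) cpx_scheme \<Rightarrow> (int \<Rightarrow> 'm \<Rightarrow> 'n) \<Rightarrow> (int \<Rightarrow> 'm \<Rightarrow> 'n) \<Rightarrow> (int \<Rightarrow> 'n \<Rightarrow> 'n)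
    \<Rightarrow> int \<Rightarrow> (nat \<Rightarrow> 'm) \<times> (nat \<Rightarrow> 'm) \<Rightarrow> 'n"
  where "telescope_map P C f h t i z = poly_extend (obj P i) (obj C i) (f i) (t i) (fst z)
    \<oplus>\<^bsub>obj C i\<^esub> poly_extend (obj P (i - 1)) (obj C i) (h (i - 1)) (t i) (snd z)"

context
  fixes A :: "('a, 'b) ring_scheme" and P :: "('a, 'p, 'c) cpx_scheme" and \<tau>
  assumes P: "A_complex A P" and \<tau>: "A_map A \<tau> P P"
begin

lemma char_map_chain:
  "A_map A (\<lambda>i. char_map A (obj P i) (\<tau> i)) (poly_cpx P) (poly_cpx P)"
  unfolding A_map_def poly_cpx_simps
proof (intro conjI allI ballI)
  fix i
  show "char_map A (obj P i) (\<tau> i) \<in> linear_maps A (poly_module (obj P i)) (poly_module (obj P i))"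
    by (rule lin_char_map[OF cpx_module[OF P] map_lin[OF \<tau>]])
  fix p assume p: "p \<in> carrier (poly_module (obj P i))"
  show "char_map A (obj P (i - 1)) (\<tau> (i - 1)) (poly_map (bdry P i) p)
      = poly_map (bdry P i) (char_map A (obj P i) (\<tau> i) p)"
    by (rule char_map_natural[OF cpx_module[OF P] cpx_module[OF P] cpx_lin[OF P] map_lin[OF \<tau>] map_lin[OF \<tau>] _ p, symmetric])
       (rule map_bdry[OF \<tau>, symmetric])
qed

lemma telescope_twisting:
  "twisting A (\<lambda>i. char_map A (obj P (i - 1)) (\<tau> (i - 1))) (shifted A (poly_cpx P)) (poly_cpx P)"
  by (rule twisting_of_map[OF poly_cpx_complex[OF P] poly_cpx_complex[OF P] char_map_chain])

lemma telescope_complex: "A_complex A (telescope A \<tau> P)"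
  unfolding telescope_def
  by (rule twisted_complex[OF poly_cpx_complex[OF P] shifted_complex[OF poly_cpx_complex[OF P]] telescope_twisting])

lemma telescope_obj: "obj (telescope A \<tau> P) i = sum_module (poly_module (obj P i)) (poly_module (obj P (i - 1)))"
  by (simp add: telescope_def)

lemma telescope_bdry:
  assumes "r \<in> carrier (poly_module (obj P (i - 1)))"
  shows "bdry (telescope A \<tau> P) i (p, r) =
    (poly_map (bdry P i) p \<oplus>\<^bsub>poly_module (obj P (i - 1))\<^esub> char_map A (obj P (i - 1)) (\<tau> (i - 1)) r,
     \<ominus>\<^bsub>poly_module (obj P (i - 2))\<^esub> poly_map (bdry P (i - 1)) r)"
  using shifted_bdry[OF poly_cpx_complex[OF P], of r i] assms by (simp add: telescope_def del: shifted_simps(2))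

lemma poly_bdry_lin: "poly_map (bdry P i) \<in> linear_maps A (poly_module (obj P i)) (poly_module (obj P (i - 1)))"
  using cpx_lin[OF poly_cpx_complex[OF P], of i] by simp

lemma poly_bdry_closed':
  "p \<in> carrier (poly_module (obj P (i + 1))) \<Longrightarrow> poly_map (bdry P (i + 1)) p \<in> carrier (poly_module (obj P i))"
  using lin_closed[OF poly_bdry_lin, of p "i + 1"] by simp

lemma poly_bdry_shift: "poly_map (bdry P i) (poly_shift (obj P i) p) = poly_shift (obj P (i - 1)) (poly_map (bdry P i) p)"
  by (rule poly_map_shift) (rule cpx_d_zero[OF P])

lemma poly_bdry_const: "poly_map (bdry P i) (poly_const (obj P i) x) = poly_const (obj P (i - 1)) (bdry P i x)"
  by (rule poly_map_const) (rule cpx_d_zero[OF P])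

lemma telescope_shift_map: "A_map A (telescope_shift P) (telescope A \<tau> P) (telescope A \<tau> P)"
proof -
  note C = poly_cpx_complex[OF P] and SC = shifted_complex[OF poly_cpx_complex[OF P]]
  have sh: "A_map A (\<lambda>i. poly_shift (obj P i)) (poly_cpx P) (poly_cpx P)"
    unfolding A_map_def poly_cpx_simps
    using lin_poly_shift[OF cpx_module[OF P]] poly_bdry_shift[symmetric] by simp
  show ?thesis unfolding telescope_def telescope_shift_def[abs_def]
    by (rule twisted_map_strict[OF C SC telescope_twisting sh shifted_map[OF C C sh]])
       (simp add: char_map_shift[OF cpx_module[OF P] map_lin[OF \<tau>]])
qed

lemma telescope_incl_map: "A_map A (telescope_incl P) P (telescope A \<tau> P)"
  unfolding A_map_def
proof (intro conjI allI ballI)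
  fix i
  note mods = cpx_module[OF P] right_module_poly[OF cpx_module[OF P]]
  show "telescope_incl P i \<in> linear_maps A (obj P i) (obj (telescope A \<tau> P) i)"
    unfolding telescope_obj telescope_incl_def[abs_def]
    by (intro lin_pair lin_poly_const lin_const_zero mods)
  fix x assume x: "x \<in> carrier (obj P i)"
  interpret M: right_module A "poly_module (obj P (i - 1))" by (rule mods)
  have z: "\<zero>\<^bsub>poly_module (obj P (i - 1))\<^esub> \<in> carrier (poly_module (obj P (i - 1)))" by (rule M.M.zero_closed)
  have "char_map A (obj P (i - 1)) (\<tau> (i - 1)) \<zero>\<^bsub>poly_module (obj P (i - 1))\<^esub> = \<zero>\<^bsub>poly_module (obj P (i - 1))\<^esub>"
    by (rule lin_zero[OF lin_char_map[OF mods(1) map_lin[OF \<tau>]] mods(2) mods(2)])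
  moreover have "poly_map (bdry P (i - 1)) \<zero>\<^bsub>poly_module (obj P (i - 1))\<^esub> = \<zero>\<^bsub>poly_module (obj P (i - 2))\<^esub>"
    using lin_zero[OF poly_bdry_lin mods(2) mods(2), of "i - 1"] by simp
  moreover have "\<ominus>\<^bsub>poly_module (obj P (i - 2))\<^esub> \<zero>\<^bsub>poly_module (obj P (i - 2))\<^esub> = \<zero>\<^bsub>poly_module (obj P (i - 2))\<^esub>"
    using cpx_minus_zero[OF poly_cpx_complex[OF P], of "i - 2"] by simp
  ultimately show "telescope_incl P (i - 1) (bdry P i x) = bdry (telescope A \<tau> P) i (telescope_incl P i x)"
    unfolding telescope_incl_def telescope_bdry[OF z] poly_bdry_const
    using poly_const_closed[OF mods(1) cpx_closed[OF P x]] by (simp only: M.M.r_zero) simp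
qed

text \<open>
  Dividing the first component of a chain by \<open>t - \<tau>\<close> leaves a constant remainder, which is the required element of
  \<open>P\<close>; uniqueness of the division determines the second component.
\<close>

lemma telescope_incl_weak_equiv: "weak_equiv (telescope_incl P) P (telescope A \<tau> P)"
  unfolding weak_equiv_def
proof (intro allI ballI impI)
  fix i x z
  assume x: "x \<in> carrier (obj P i)" and zc: "z \<in> carrier (obj (telescope A \<tau> P) (i + 1))"
    and eq: "telescope_incl P i x = bdry (telescope A \<tau> P) (i + 1) z"
  obtain p r where z: "z = (p, r)" and p: "p \<in> carrier (poly_module (obj P (i + 1)))"
    and r: "r \<in> carrier (poly_module (obj P (i + 1 - 1)))"
    using zc by (auto simp: telescope_obj)
  then have r0: "r \<in> carrier (poly_module (obj P i))" by simp
  note mods = cpx_module[OF P] right_module_poly[OF cpx_module[OF P]]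
  interpret M0: right_module A "obj P i" by (rule mods)
  interpret Mp: right_module A "poly_module (obj P i)" by (rule mods)
  interpret Mp1: right_module A "poly_module (obj P (i + 1))" by (rule mods)
  let ?\<theta> = "\<lambda>i. char_map A (obj P i) (\<tau> i)"
  note \<theta> = lin_char_map[OF mods(1) map_lin[OF \<tau>]]
  have eq1: "poly_const (obj P i) x = poly_map (bdry P (i + 1)) p \<oplus>\<^bsub>poly_module (obj P i)\<^esub> ?\<theta> i r"
    using eq telescope_bdry[OF r, of p] unfolding z telescope_incl_def by simp
  obtain x' r' where x': "x' \<in> carrier (obj P (i + 1))" and r': "r' \<in> carrier (poly_module (obj P (i + 1)))"
    and p': "p = poly_const (obj P (i + 1)) x' \<oplus>\<^bsub>poly_module (obj P (i + 1))\<^esub> ?\<theta> (i + 1) r'"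
    using poly_division[OF mods(1) map_lin[OF \<tau>] p] by blast
  let ?dr = "poly_map (bdry P (i + 1)) r'"
  have dr: "?dr \<in> carrier (poly_module (obj P i))" by (rule poly_bdry_closed'[OF r'])
  have dx: "bdry P (i + 1) x' \<in> carrier (obj P i)" by (rule cpx_closed'[OF P x'])
  have "poly_map (bdry P (i + 1)) p = poly_const (obj P i) (bdry P (i + 1) x') \<oplus>\<^bsub>poly_module (obj P i)\<^esub> ?\<theta> i ?dr"
  proof -
    have 1: "poly_map (bdry P (i + 1)) (poly_const (obj P (i + 1)) x') = poly_const (obj P i) (bdry P (i + 1) x')"
      using poly_bdry_const[of "i + 1" x'] by simp
    have 2: "poly_map (bdry P (i + 1)) (?\<theta> (i + 1) r') = ?\<theta> i ?dr"
      using map_bdry'[OF char_map_chain, of r' i] r' by simp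
    have "poly_map (bdry P (i + 1)) \<in> linear_maps A (poly_module (obj P (i + 1))) (poly_module (obj P i))"
      using poly_bdry_lin[of "i + 1"] by simp
    from lin_add[OF this poly_const_closed[OF mods(1) x'] lin_closed[OF \<theta> r']] show ?thesis
      unfolding p' 1 2 .
  qed
  then have "poly_const (obj P i) x = poly_const (obj P i) (bdry P (i + 1) x')
      \<oplus>\<^bsub>poly_module (obj P i)\<^esub> ?\<theta> i ?dr \<oplus>\<^bsub>poly_module (obj P i)\<^esub> ?\<theta> i r"
    using eq1 by (simp only: )
  also have "\<dots> = poly_const (obj P i) (bdry P (i + 1) x') \<oplus>\<^bsub>poly_module (obj P i)\<^esub> ?\<theta> i (?dr \<oplus>\<^bsub>poly_module (obj P i)\<^esub> r)"
    unfolding lin_add[OF \<theta> dr r0]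
    by (rule Mp.M.a_assoc[OF poly_const_closed[OF mods(1) dx] lin_closed[OF \<theta> dr] lin_closed[OF \<theta> r0]])
  finally have e2: "poly_const (obj P i) x = poly_const (obj P i) (bdry P (i + 1) x')
      \<oplus>\<^bsub>poly_module (obj P i)\<^esub> ?\<theta> i (?dr \<oplus>\<^bsub>poly_module (obj P i)\<^esub> r)" .
  have c: "?dr \<oplus>\<^bsub>poly_module (obj P i)\<^esub> r \<in> carrier (poly_module (obj P i))" by (rule Mp.M.a_closed[OF dr r0])
  have "poly_const (obj P i) (x \<ominus>\<^bsub>obj P i\<^esub> bdry P (i + 1) x') = ?\<theta> i (?dr \<oplus>\<^bsub>poly_module (obj P i)\<^esub> r)"
    unfolding lin_diff[OF lin_poly_const[OF mods(1)] mods(1) mods(2) x dx] e2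
    using poly_const_closed[OF mods(1) dx] lin_closed[OF \<theta> c] by algebra
  from poly_division_unique[OF mods(1) map_lin[OF \<tau>] _ c this] x dx
  have "x \<ominus>\<^bsub>obj P i\<^esub> bdry P (i + 1) x' = \<zero>\<^bsub>obj P i\<^esub>"
    and dr0: "?dr \<oplus>\<^bsub>poly_module (obj P i)\<^esub> r = \<zero>\<^bsub>poly_module (obj P i)\<^esub>" by simp_all
  then have xeq: "bdry P (i + 1) x' = x" using M0.M.minus_eq_zeroD x dx by metis
  have req: "r = \<ominus>\<^bsub>poly_module (obj P i)\<^esub> ?dr"
  proof (rule Mp.M.add_eq_zeroD[OF _ r0 dr])
    show "r \<oplus>\<^bsub>poly_module (obj P i)\<^esub> ?dr = \<zero>\<^bsub>poly_module (obj P i)\<^esub>"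
      using dr0 Mp.M.a_comm[OF r0 dr] by (simp only: )
  qed
  let ?z = "(\<zero>\<^bsub>poly_module (obj P (i + 2))\<^esub>, r')"
  have zc': "?z \<in> carrier (obj (telescope A \<tau> P) (i + 2))"
    using r' cpx_zero_closed[OF poly_cpx_complex[OF P], of "i + 2"] by (simp add: telescope_obj add.commute)
  have d0: "poly_map (bdry P (i + 2)) \<zero>\<^bsub>poly_module (obj P (i + 2))\<^esub> = \<zero>\<^bsub>poly_module (obj P (i + 1))\<^esub>"
    using lin_zero[OF poly_bdry_lin mods(2) mods(2), of "i + 2"] by (simp add: add.commute)
  have idx: "i + 2 - 1 = i + 1" "i + 2 - 2 = i" by auto
  have dz: "bdry (telescope A \<tau> P) (i + 2) ?z = (?\<theta> (i + 1) r', \<ominus>\<^bsub>poly_module (obj P i)\<^esub> ?dr)"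
    using telescope_bdry[of r' "i + 2" "\<zero>\<^bsub>poly_module (obj P (i + 2))\<^esub>"] r' lin_closed[OF \<theta> r']
    unfolding idx d0 by (simp only: Mp1.M.l_zero)
  have "z = telescope_incl P (i + 1) x' \<oplus>\<^bsub>obj (telescope A \<tau> P) (i + 1)\<^esub> bdry (telescope A \<tau> P) (i + 2) ?z"
    unfolding z dz telescope_incl_def telescope_obj sum_module_simps p' add_diff_cancel_right'
    using req Mp.M.l_zero[OF r0] by (simp only: )
  then show "\<exists>x'\<in>carrier (obj P (i + 1)). \<exists>y'\<in>carrier (obj (telescope A \<tau> P) (i + 2)). bdry P (i + 1) x' = x \<and>
      z = telescope_incl P (i + 1) x' \<oplus>\<^bsub>obj (telescope A \<tau> P) (i + 1)\<^esub> bdry (telescope A \<tau> P) (i + 2) y'"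
    using x' xeq zc' by blast
qed

context
  fixes C :: "('a, 'm, 'd) cpx_scheme" and f h t
  assumes C: "A_complex A C" and f: "A_map A f P C" and t: "A_map A t C C"
    and h: "\<And>i. h i \<in> linear_maps A (obj P i) (obj C (i + 1))"
    and htpy: "\<And>i z. z \<in> carrier (obj P i) \<Longrightarrow>
      f i (\<tau> i z) \<oplus>\<^bsub>obj C i\<^esub> h (i - 1) (bdry P i z) \<oplus>\<^bsub>obj C i\<^esub> bdry C (i + 1) (h i z) = t i (f i z)"
begin

abbreviation (input) ext_f where "ext_f i \<equiv> poly_extend (obj P i) (obj C i) (f i) (t i)"
abbreviation (input) ext_h where "ext_h i \<equiv> poly_extend (obj P (i - 1)) (obj C i) (h (i - 1)) (t i)"

lemma htpy_lin: "h (i - 1) \<in> linear_maps A (obj P (i - 1)) (obj C i)"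
  using h[of "i - 1"] by simp

lemma ext_f_lin: "ext_f i \<in> linear_maps A (poly_module (obj P i)) (obj C i)"
  by (rule lin_poly_extend[OF cpx_module[OF P] cpx_module[OF C] map_lin[OF f] map_lin[OF t]])

lemma ext_h_lin: "ext_h i \<in> linear_maps A (poly_module (obj P (i - 1))) (obj C i)"
  by (rule lin_poly_extend[OF cpx_module[OF P] cpx_module[OF C] htpy_lin map_lin[OF t]])

lemma ext_f_bdry:
  assumes p: "p \<in> carrier (poly_module (obj P i))"
  shows "ext_f (i - 1) (poly_map (bdry P i) p) = bdry C i (ext_f i p)"
proof (rule poly_maps_eq[OF cpx_module[OF P] cpx_module[OF C] lin_comp[OF poly_bdry_lin ext_f_lin] lin_comp[OF ext_f_lin cpx_lin[OF C]] _ _ _ p])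
  note ext = cpx_module[OF P] cpx_module[OF C] map_lin[OF f] map_lin[OF t]
  fix q assume q: "q \<in> carrier (poly_module (obj P i))"
  show "ext_f (i - 1) (poly_map (bdry P i) (poly_shift (obj P i) q)) = t (i - 1) (ext_f (i - 1) (poly_map (bdry P i) q))"
    unfolding poly_bdry_shift by (rule poly_extend_shift[OF ext lin_closed[OF poly_bdry_lin q]])
  show "bdry C i (ext_f i (poly_shift (obj P i) q)) = t (i - 1) (bdry C i (ext_f i q))"
    unfolding poly_extend_shift[OF ext q] using map_bdry[OF t lin_closed[OF ext_f_lin q]] by simp
next
  note ext = cpx_module[OF P] cpx_module[OF C] map_lin[OF f] map_lin[OF t]
  fix x assume x: "x \<in> carrier (obj P i)"
  show "ext_f (i - 1) (poly_map (bdry P i) (poly_const (obj P i) x)) = bdry C i (ext_f i (poly_const (obj P i) x))"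
    unfolding poly_bdry_const poly_extend_const[OF ext x] poly_extend_const[OF ext cpx_closed[OF P x]]
    by (rule map_bdry[OF f x])
qed

text \<open>
  This is the homotopy relation of \<open>h\<close>, extended from constants to polynomials.
\<close>

lemma ext_f_char_map:
  assumes r: "r \<in> carrier (poly_module (obj P i))"
  shows "ext_f i (char_map A (obj P i) (\<tau> i) r)
    = ext_h i (poly_map (bdry P i) r) \<oplus>\<^bsub>obj C i\<^esub> bdry C (i + 1) (ext_h (i + 1) r)"
proof -
  note modP = cpx_module[OF P] and modC = cpx_module[OF C]
  note ext = modP modC map_lin[OF f] map_lin[OF t] and exth = modP modC htpy_lin map_lin[OF t]
  note \<theta> = lin_char_map[OF modP map_lin[OF \<tau>]]
  interpret C0: right_module A "obj C i" by (rule modC)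
  interpret C1: right_module A "obj C (i + 1)" by (rule modC)
  interpret PM: right_module A "poly_module (obj P i)" by (rule right_module_poly[OF modP])
  have H1: "ext_h (i + 1) \<in> linear_maps A (poly_module (obj P i)) (obj C (i + 1))"
    using ext_h_lin[of "i + 1"] by simp
  have t0: "t i \<in> linear_maps A (obj C i) (obj C i)" by (rule map_lin[OF t])
  have dH: "bdry C (i + 1) (ext_h (i + 1) q) \<in> carrier (obj C i)" if "q \<in> carrier (poly_module (obj P i))" for q
    by (rule cpx_closed'[OF C lin_closed[OF H1 that]])
  have Hd: "ext_h i (poly_map (bdry P i) q) \<in> carrier (obj C i)" if "q \<in> carrier (poly_module (obj P i))" for q
    by (rule lin_closed[OF ext_h_lin lin_closed[OF poly_bdry_lin that]])
  show ?thesis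
  proof (rule poly_maps_eq[OF modP modC lin_comp[OF \<theta> ext_f_lin]
        lin_plus[OF lin_comp[OF poly_bdry_lin ext_h_lin] lin_comp[OF H1 cpx_lin'[OF C]] modC] _ _ _ r])
    fix q assume q: "q \<in> carrier (poly_module (obj P i))"
    show "ext_f i (char_map A (obj P i) (\<tau> i) (poly_shift (obj P i) q)) = t i (ext_f i (char_map A (obj P i) (\<tau> i) q))"
      unfolding char_map_shift[OF modP map_lin[OF \<tau>] q] by (rule poly_extend_shift[OF ext lin_closed[OF \<theta> q]])
    have "ext_h (i + 1) (poly_shift (obj P i) q) = t (i + 1) (ext_h (i + 1) q)"
      using poly_extend_shift[OF modP modC h map_lin[OF t] q] by simp
    then show "ext_h i (poly_map (bdry P i) (poly_shift (obj P i) q)) \<oplus>\<^bsub>obj C i\<^esub> bdry C (i + 1) (ext_h (i + 1) (poly_shift (obj P i) q))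
      = t i (ext_h i (poly_map (bdry P i) q) \<oplus>\<^bsub>obj C i\<^esub> bdry C (i + 1) (ext_h (i + 1) q))"
      unfolding poly_bdry_shift poly_extend_shift[OF exth lin_closed[OF poly_bdry_lin q]]
        lin_add[OF t0 Hd[OF q] dH[OF q]]
      using map_bdry'[OF t lin_closed[OF H1 q]] by simp
  next
    fix x assume x: "x \<in> carrier (obj P i)"
    let ?c = "poly_const (obj P i) x"
    have \<tau>x: "\<tau> i x \<in> carrier (obj P i)" by (rule map_closed[OF \<tau> x])
    have c: "?c \<in> carrier (poly_module (obj P i))" "poly_const (obj P i) (\<tau> i x) \<in> carrier (poly_module (obj P i))"
      using poly_const_closed[OF modP] x \<tau>x by auto
    have \<tau>c: "poly_map (\<tau> i) ?c = poly_const (obj P i) (\<tau> i x)"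
      by (rule poly_map_const) (rule lin_zero[OF map_lin[OF \<tau>] modP modP])
    have "char_map A (obj P i) (\<tau> i) ?c = poly_shift (obj P i) ?c \<ominus>\<^bsub>poly_module (obj P i)\<^esub> poly_const (obj P i) (\<tau> i x)"
      unfolding char_map_def \<tau>c PM.rsmult_minus_one[OF c(2)] a_minus_def ..
    then have "ext_f i (char_map A (obj P i) (\<tau> i) ?c) = t i (f i x) \<ominus>\<^bsub>obj C i\<^esub> f i (\<tau> i x)"
      using lin_diff[OF ext_f_lin right_module_poly[OF modP] modC poly_shift_closed[OF modP c(1)] c(2)]
        poly_extend_shift[OF ext c(1)] poly_extend_const[OF ext x] poly_extend_const[OF ext \<tau>x] by simp
    moreover have "ext_h i (poly_map (bdry P i) ?c) = h (i - 1) (bdry P i x)"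
      unfolding poly_bdry_const by (rule poly_extend_const[OF exth cpx_closed[OF P x]])
    moreover have "ext_h (i + 1) ?c = h i x"
      using poly_extend_const[OF modP modC h map_lin[OF t] x] by simp
    moreover have "t i (f i x) \<ominus>\<^bsub>obj C i\<^esub> f i (\<tau> i x) = h (i - 1) (bdry P i x) \<oplus>\<^bsub>obj C i\<^esub> bdry C (i + 1) (h i x)"
      unfolding htpy[OF x, symmetric]
      using map_closed[OF f \<tau>x] lin_closed[OF htpy_lin cpx_closed[OF P x]] cpx_closed'[OF C lin_closed[OF h x]] by algebra
    ultimately show "ext_f i (char_map A (obj P i) (\<tau> i) ?c)
      = ext_h i (poly_map (bdry P i) ?c) \<oplus>\<^bsub>obj C i\<^esub> bdry C (i + 1) (ext_h (i + 1) ?c)" by simp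
  qed
qed

lemma telescope_map_chain: "A_map A (telescope_map P C f h t) (telescope A \<tau> P) C"
  unfolding A_map_def
proof (intro conjI allI ballI)
  note modP = cpx_module[OF P] and modC = cpx_module[OF C]
  fix i
  show "telescope_map P C f h t i \<in> linear_maps A (obj (telescope A \<tau> P) i) (obj C i)"
    unfolding telescope_obj telescope_map_def[abs_def]
    by (intro lin_plus lin_on_fst lin_on_snd ext_f_lin ext_h_lin modC)
  fix z assume "z \<in> carrier (obj (telescope A \<tau> P) i)"
  then obtain p r where z: "z = (p, r)" and p: "p \<in> carrier (poly_module (obj P i))"
    and r: "r \<in> carrier (poly_module (obj P (i - 1)))" by (auto simp: telescope_obj)
  interpret C1: right_module A "obj C (i - 1)" by (rule modC)
  note \<theta> = lin_char_map[OF modP map_lin[OF \<tau>]]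
  have dr: "poly_map (bdry P (i - 1)) r \<in> carrier (poly_module (obj P (i - 2)))"
    using lin_closed[OF poly_bdry_lin r] by simp
  have H1: "ext_h (i - 1) \<in> linear_maps A (poly_module (obj P (i - 2))) (obj C (i - 1))"
    using ext_h_lin[of "i - 1"] by simp
  have c: "bdry C i (ext_f i p) \<in> carrier (obj C (i - 1))" "ext_h (i - 1) (poly_map (bdry P (i - 1)) r) \<in> carrier (obj C (i - 1))"
    "bdry C i (ext_h i r) \<in> carrier (obj C (i - 1))"
    using cpx_closed[OF C lin_closed[OF ext_f_lin p]] cpx_closed[OF C lin_closed[OF ext_h_lin r]] lin_closed[OF H1 dr] by auto
  have FC: "ext_f (i - 1) (char_map A (obj P (i - 1)) (\<tau> (i - 1)) r)
      = ext_h (i - 1) (poly_map (bdry P (i - 1)) r) \<oplus>\<^bsub>obj C (i - 1)\<^esub> bdry C i (ext_h i r)"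
    using ext_f_char_map[OF r] by simp
  have "telescope_map P C f h t (i - 1) (bdry (telescope A \<tau> P) i z)
    = ext_f (i - 1) (poly_map (bdry P i) p \<oplus>\<^bsub>poly_module (obj P (i - 1))\<^esub> char_map A (obj P (i - 1)) (\<tau> (i - 1)) r)
      \<oplus>\<^bsub>obj C (i - 1)\<^esub> ext_h (i - 1) (\<ominus>\<^bsub>poly_module (obj P (i - 2))\<^esub> poly_map (bdry P (i - 1)) r)"
    unfolding z telescope_bdry[OF r] telescope_map_def fst_conv snd_conv ..
  also have "\<dots> = (bdry C i (ext_f i p) \<oplus>\<^bsub>obj C (i - 1)\<^esub> (ext_h (i - 1) (poly_map (bdry P (i - 1)) r) \<oplus>\<^bsub>obj C (i - 1)\<^esub> bdry C i (ext_h i r)))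
      \<oplus>\<^bsub>obj C (i - 1)\<^esub> \<ominus>\<^bsub>obj C (i - 1)\<^esub> ext_h (i - 1) (poly_map (bdry P (i - 1)) r)"
    unfolding lin_minus[OF H1 right_module_poly[OF modP] modC dr]
      lin_add[OF ext_f_lin lin_closed[OF poly_bdry_lin p] lin_closed[OF \<theta> r]] ext_f_bdry[OF p] FC ..
  also have "\<dots> = bdry C i (ext_f i p) \<oplus>\<^bsub>obj C (i - 1)\<^esub> bdry C i (ext_h i r)" using c by algebra
  also have "\<dots> = bdry C i (telescope_map P C f h t i z)"
    unfolding z telescope_map_def fst_conv snd_conv lin_add[OF cpx_lin[OF C] lin_closed[OF ext_f_lin p] lin_closed[OF ext_h_lin r]] ..
  finally show "telescope_map P C f h t (i - 1) (bdry (telescope A \<tau> P) i z) = bdry C i (telescope_map P C f h t i z)" .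
qed

lemma telescope_map_shift:
  assumes "z \<in> carrier (obj (telescope A \<tau> P) i)"
  shows "telescope_map P C f h t i (telescope_shift P i z) = t i (telescope_map P C f h t i z)"
proof -
  note ext = cpx_module[OF P] cpx_module[OF C] map_lin[OF f] map_lin[OF t]
    and exth = cpx_module[OF P] cpx_module[OF C] htpy_lin map_lin[OF t]
  obtain p r where z: "z = (p, r)" and p: "p \<in> carrier (poly_module (obj P i))"
    and r: "r \<in> carrier (poly_module (obj P (i - 1)))" using assms by (auto simp: telescope_obj)
  show ?thesis
    unfolding z telescope_map_def telescope_shift_def fst_conv snd_conv
      poly_extend_shift[OF ext p] poly_extend_shift[OF exth r]
    by (rule lin_add[OF map_lin[OF t] lin_closed[OF ext_f_lin p] lin_closed[OF ext_h_lin r], symmetric])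
qed

lemma telescope_map_incl:
  assumes x: "x \<in> carrier (obj P i)"
  shows "telescope_map P C f h t i (telescope_incl P i x) = f i x"
proof -
  interpret C0: right_module A "obj C i" by (rule cpx_module[OF C])
  note ext = cpx_module[OF P] cpx_module[OF C] map_lin[OF f] map_lin[OF t]
  have "ext_h i \<zero>\<^bsub>poly_module (obj P (i - 1))\<^esub> = \<zero>\<^bsub>obj C i\<^esub>"
    by (rule lin_zero[OF ext_h_lin right_module_poly[OF cpx_module[OF P]] cpx_module[OF C]])
  then show ?thesis
    unfolding telescope_map_def telescope_incl_def fst_conv snd_conv poly_extend_const[OF ext x]
    using map_closed[OF f x] by (simp only: C0.M.r_zero)
qed

text \<open>
  Two out of three: both \<open>f\<close> and the inclusion of \<open>P\<close> into the telescope are quasi-isomorphisms.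
\<close>

lemma telescope_map_weak_equiv:
  assumes we: "weak_equiv f P C"
  shows "weak_equiv (telescope_map P C f h t) (telescope A \<tau> P) C"
  unfolding weak_equiv_def
proof (intro allI ballI impI)
  let ?T = "telescope A \<tau> P" and ?g = "telescope_map P C f h t" and ?j = "telescope_incl P"
  note T = telescope_complex and g = telescope_map_chain and j = telescope_incl_map
  fix i z c assume z: "z \<in> carrier (obj ?T i)" "bdry ?T i z = \<zero>\<^bsub>obj ?T (i - 1)\<^esub>"
    and c: "c \<in> carrier (obj C (i + 1))" "?g i z = bdry C (i + 1) c"
  interpret C0: right_module A "obj C i" by (rule cpx_module[OF C])
  interpret C1: right_module A "obj C (i + 1)" by (rule cpx_module[OF C])
  obtain x w where x: "x \<in> carrier (obj P i)" "bdry P i x = \<zero>\<^bsub>obj P (i - 1)\<^esub>"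
    and w: "w \<in> carrier (obj ?T (i + 1))" "z = ?j i x \<oplus>\<^bsub>obj ?T i\<^esub> bdry ?T (i + 1) w"
    using weak_equiv_surj[OF telescope_incl_weak_equiv P T j z] by blast
  have gw: "?g (i + 1) w \<in> carrier (obj C (i + 1))" by (rule map_closed[OF g w(1)])
  have "?g i z = f i x \<oplus>\<^bsub>obj C i\<^esub> bdry C (i + 1) (?g (i + 1) w)"
    unfolding w(2) lin_add[OF map_lin[OF g] map_closed[OF j x(1)] cpx_closed'[OF T w(1)]]
      telescope_map_incl[OF x(1)] map_bdry'[OF g w(1)] ..
  then have e: "bdry C (i + 1) c = f i x \<oplus>\<^bsub>obj C i\<^esub> bdry C (i + 1) (?g (i + 1) w)" using c(2) by (simp only: )
  have "f i x = bdry C (i + 1) (c \<ominus>\<^bsub>obj C (i + 1)\<^esub> ?g (i + 1) w)"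
    unfolding lin_diff[OF cpx_lin'[OF C] cpx_module[OF C] cpx_module[OF C] c(1) gw] e
    using map_closed[OF f x(1)] cpx_closed'[OF C gw] by algebra
  from weak_equivD[OF we x(1) C1.M.minus_closed[OF c(1) gw] x(2) this]
  obtain x' c' where x': "x' \<in> carrier (obj P (i + 1))" "bdry P (i + 1) x' = x"
    and c': "c' \<in> carrier (obj C (i + 2))"
      "c \<ominus>\<^bsub>obj C (i + 1)\<^esub> ?g (i + 1) w = f (i + 1) x' \<oplus>\<^bsub>obj C (i + 1)\<^esub> bdry C (i + 2) c'" by metis
  interpret T1: right_module A "obj ?T (i + 1)" by (rule cpx_module[OF T])
  have jx': "?j (i + 1) x' \<in> carrier (obj ?T (i + 1))" by (rule map_closed[OF j x'(1)])
  let ?w = "?j (i + 1) x' \<oplus>\<^bsub>obj ?T (i + 1)\<^esub> w"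
  have "bdry ?T (i + 1) ?w = z"
    unfolding lin_add[OF cpx_lin'[OF T] jx' w(1)] map_bdry'[OF j x'(1), symmetric] x'(2) w(2) ..
  moreover have "c = ?g (i + 1) ?w \<oplus>\<^bsub>obj C (i + 1)\<^esub> bdry C (i + 2) c'"
  proof -
    have "c = (c \<ominus>\<^bsub>obj C (i + 1)\<^esub> ?g (i + 1) w) \<oplus>\<^bsub>obj C (i + 1)\<^esub> ?g (i + 1) w" using c(1) gw by algebra
    also have "\<dots> = (f (i + 1) x' \<oplus>\<^bsub>obj C (i + 1)\<^esub> ?g (i + 1) w) \<oplus>\<^bsub>obj C (i + 1)\<^esub> bdry C (i + 2) c'"
      unfolding c'(2) using map_closed[OF f x'(1)] cpx_closed''[OF C c'(1)] gw by algebra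
    also have "f (i + 1) x' \<oplus>\<^bsub>obj C (i + 1)\<^esub> ?g (i + 1) w = ?g (i + 1) ?w"
      unfolding lin_add[OF map_lin[OF g] jx' w(1)] telescope_map_incl[OF x'(1)] ..
    finally show ?thesis .
  qed
  ultimately show "\<exists>x'\<in>carrier (obj ?T (i + 1)). \<exists>y'\<in>carrier (obj C (i + 2)).
      bdry ?T (i + 1) x' = z \<and> c = ?g (i + 1) x' \<oplus>\<^bsub>obj C (i + 1)\<^esub> bdry C (i + 2) y'"
    using T1.M.a_closed[OF jx' w(1)] c'(1) by blast
qed

end

end



section \<open>Recognizing filtration steps\<close>

text \<open>
  Both \<open>H\<close> and \<open>M\<close> are quotients of \<open>L\<close> by the same submodule, so they are isomorphic.
\<close>

lemma retract_of_same_kernel: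
  assumes L: "right_module A L" and M: "right_module A M" and H: "right_module A H"
    and \<pi>: "\<pi> \<in> linear_maps A L M" "\<pi> ` carrier L = carrier M"
    and c: "c \<in> linear_maps A L H" "c ` carrier L = carrier H"
    and ker: "\<And>x. x \<in> carrier L \<Longrightarrow> \<pi> x = \<zero>\<^bsub>M\<^esub> \<longleftrightarrow> c x = \<zero>\<^bsub>H\<^esub>"
  shows "retract_of A H M"
proof -
  interpret L: right_module A L by fact
  interpret M: right_module A M by fact
  interpret H: right_module A H by fact
  have key: "\<pi> x = \<pi> y \<longleftrightarrow> c x = c y" if x: "x \<in> carrier L" and y: "y \<in> carrier L" for x y
  proof -
    have zM: "a \<ominus>\<^bsub>M\<^esub> b = \<zero>\<^bsub>M\<^esub> \<longleftrightarrow> a = b" if "a \<in> carrier M" "b \<in> carrier M" for a b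
      using M.M.minus_eq_zeroD[of a b] that by (auto simp: M.M.minus_eq M.M.r_neg)
    have zH: "a \<ominus>\<^bsub>H\<^esub> b = \<zero>\<^bsub>H\<^esub> \<longleftrightarrow> a = b" if "a \<in> carrier H" "b \<in> carrier H" for a b
      using H.M.minus_eq_zeroD[of a b] that by (auto simp: H.M.minus_eq H.M.r_neg)
    show ?thesis
      using ker[of "x \<ominus>\<^bsub>L\<^esub> y"] x y lin_diff[OF \<pi>(1) L M x y] lin_diff[OF c(1) L H x y]
        zM[OF lin_closed[OF \<pi>(1) x] lin_closed[OF \<pi>(1) y]] zH[OF lin_closed[OF c(1) x] lin_closed[OF c(1) y]]
      by simp
  qed
  define s where "s h = \<pi> (SOME x. x \<in> carrier L \<and> c x = h)" for h
  define p where "p y = c (SOME x. x \<in> carrier L \<and> \<pi> x = y)" for y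
  have s: "s (c x) = \<pi> x" if x: "x \<in> carrier L" for x
  proof -
    have "(SOME y. y \<in> carrier L \<and> c y = c x) \<in> carrier L \<and> c (SOME y. y \<in> carrier L \<and> c y = c x) = c x"
      by (rule someI[of "\<lambda>y. y \<in> carrier L \<and> c y = c x" x]) (simp add: x)
    then show ?thesis unfolding s_def using key[OF _ x] by blast
  qed
  have p: "p (\<pi> x) = c x" if x: "x \<in> carrier L" for x
  proof -
    have "(SOME y. y \<in> carrier L \<and> \<pi> y = \<pi> x) \<in> carrier L \<and> \<pi> (SOME y. y \<in> carrier L \<and> \<pi> y = \<pi> x) = \<pi> x"
      by (rule someI[of "\<lambda>y. y \<in> carrier L \<and> \<pi> y = \<pi> x" x]) (simp add: x)
    then show ?thesis unfolding p_def using key[OF _ x] by blast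
  qed
  have "s \<in> linear_maps A H M"
  proof (rule linear_mapsI; unfold c(2)[symmetric]; elim imageE)
    fix h x assume "h = c x" "x \<in> carrier L"
    then show "s h \<in> carrier M" by (simp add: s lin_closed[OF \<pi>(1)])
  next
    fix h h' x x' assume h: "h = c x" "x \<in> carrier L" "h' = c x'" "x' \<in> carrier L"
    then have "h \<oplus>\<^bsub>H\<^esub> h' = c (x \<oplus>\<^bsub>L\<^esub> x')" by (simp add: lin_add[OF c(1)])
    then show "s (h \<oplus>\<^bsub>H\<^esub> h') = s h \<oplus>\<^bsub>M\<^esub> s h'" using h by (simp add: s lin_add[OF \<pi>(1)])
  next
    fix h x a assume h: "h = c x" "x \<in> carrier L" "a \<in> carrier A"
    then have "h \<triangleleft>\<^bsub>H\<^esub> a = c (x \<triangleleft>\<^bsub>L\<^esub> a)" by (simp add: lin_smult[OF c(1)])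
    then show "s (h \<triangleleft>\<^bsub>H\<^esub> a) = s h \<triangleleft>\<^bsub>M\<^esub> a" using h by (simp add: s lin_smult[OF \<pi>(1)] L.rsmult_closed)
  qed
  moreover have "p \<in> linear_maps A M H"
  proof (rule linear_mapsI; unfold \<pi>(2)[symmetric]; elim imageE)
    fix h x assume "h = \<pi> x" "x \<in> carrier L"
    then show "p h \<in> carrier H" by (simp add: p lin_closed[OF c(1)])
  next
    fix h h' x x' assume h: "h = \<pi> x" "x \<in> carrier L" "h' = \<pi> x'" "x' \<in> carrier L"
    then have "h \<oplus>\<^bsub>M\<^esub> h' = \<pi> (x \<oplus>\<^bsub>L\<^esub> x')" by (simp add: lin_add[OF \<pi>(1)])
    then show "p (h \<oplus>\<^bsub>M\<^esub> h') = p h \<oplus>\<^bsub>H\<^esub> p h'" using h by (simp add: p lin_add[OF c(1)])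
  next
    fix h x a assume h: "h = \<pi> x" "x \<in> carrier L" "a \<in> carrier A"
    then have "h \<triangleleft>\<^bsub>M\<^esub> a = \<pi> (x \<triangleleft>\<^bsub>L\<^esub> a)" by (simp add: lin_smult[OF \<pi>(1)])
    then show "p (h \<triangleleft>\<^bsub>M\<^esub> a) = p h \<triangleleft>\<^bsub>H\<^esub> a" using h by (simp add: p lin_smult[OF c(1)] L.rsmult_closed)
  qed
  moreover have "\<forall>h\<in>carrier H. p (s h) = h" unfolding c(2)[symmetric] by (auto simp: s p)
  ultimately show ?thesis unfolding retract_of_def by blast
qed

context
  fixes A :: "('a, 'b) ring_scheme" and C :: "('a, 'm, 'c) cpx_scheme" and D :: "('a, 'n, 'd) cpx_scheme"
    and f :: "int \<Rightarrow> 'm \<Rightarrow> 'n"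
  assumes C: "A_complex A C" and D: "A_complex A D" and f: "A_map A f C D"
begin

abbreviation (input) image_sub where "image_sub i \<equiv> f i ` carrier (obj C i)"
abbreviation (input) image_coset where "image_coset i z \<equiv> image_sub i +>\<^bsub>obj D i\<^esub> z"

lemma image_submodule: "submodule A (obj D i) (image_sub i)"
  by (rule submodule_image[OF map_lin[OF f] cpx_module[OF C] cpx_module[OF D]])

lemma quotient_complex_simps:
  "obj (quotient_complex f C D) i = quotient_module (obj D i) (image_sub i)"
  "bdry (quotient_complex f C D) i K = image_sub (i - 1) <+>\<^bsub>obj D (i - 1)\<^esub> (bdry D i ` K)"
  by (simp_all add: quotient_complex_def)

lemma quotient_complex_carrier: "carrier (obj (quotient_complex f C D) i) = image_coset i ` carrier (obj D i)"
  unfolding quotient_complex_simps by (rule quotient_module_carrier[OF cpx_module[OF D] image_submodule])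

lemma quotient_complex_bdry:
  assumes z: "z \<in> carrier (obj D i)"
  shows "bdry (quotient_complex f C D) i (image_coset i z) = image_coset (i - 1) (bdry D i z)"
proof -
  have sub: "n \<in> carrier (obj D i)" if "n \<in> image_sub i" for n using that map_closed[OF f] by auto
  have "bdry D i ` image_sub i \<subseteq> image_sub (i - 1)"
    using map_bdry[OF f, symmetric] cpx_closed[OF C] by auto
  moreover have "\<zero>\<^bsub>obj D (i - 1)\<^esub> \<in> bdry D i ` image_sub i"
    using cpx_d_zero[OF D, of i, symmetric] image_submodule[of i] by (auto simp: submodule_def)
  moreover have "bdry D i ` image_coset i z = (bdry D i ` image_sub i) +>\<^bsub>obj D (i - 1)\<^esub> bdry D i z"
    by (simp add: a_r_coset_def' image_UN lin_add[OF cpx_lin[OF D] map_closed[OF f] z] cong: SUP_cong_simp)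
  ultimately show ?thesis
    unfolding quotient_complex_simps
    using coset_set_add[OF cpx_module[OF D] image_submodule cpx_closed[OF D z]] by simp
qed

lemma lin_image_coset: "(\<lambda>z. image_coset i z) \<in> linear_maps A (obj D i) (obj (quotient_complex f C D) i)"
  unfolding quotient_complex_simps by (rule lin_coset[OF cpx_module[OF D] image_submodule])

lemma image_coset_zero_iff:
  "z \<in> carrier (obj D i) \<Longrightarrow> image_coset i z = \<zero>\<^bsub>obj (quotient_complex f C D) i\<^esub> \<longleftrightarrow> z \<in> image_sub i"
  unfolding quotient_complex_simps by (rule coset_eq_zero_iff[OF cpx_module[OF D] image_submodule])

lemma quotient_complex_complex: "A_complex A (quotient_complex f C D)"
  unfolding A_complex_def
proof (intro conjI allI ballI impI)
  let ?K = "quotient_complex f C D"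
  fix i
  have mod: "right_module A (obj ?K i)" for i
    unfolding quotient_complex_simps by (rule right_module_quotient[OF cpx_module[OF D] image_submodule])
  then show "right_module A (obj ?K i)" .
  show "bdry ?K i \<in> linear_maps A (obj ?K i) (obj ?K (i - 1))"
  proof (rule linear_mapsI; unfold quotient_complex_carrier; elim imageE)
    fix K z assume "K = image_coset i z" "z \<in> carrier (obj D i)"
    then show "bdry ?K i K \<in> image_coset (i - 1) ` carrier (obj D (i - 1))"
      using cpx_closed[OF D] by (simp add: quotient_complex_bdry)
  next
    fix K K' z z' assume K: "K = image_coset i z" "z \<in> carrier (obj D i)" "K' = image_coset i z'" "z' \<in> carrier (obj D i)"
    have h: "K \<oplus>\<^bsub>obj ?K i\<^esub> K' = image_coset i (z \<oplus>\<^bsub>obj D i\<^esub> z')"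
      unfolding K(1,3) by (rule lin_add[OF lin_image_coset K(2,4), symmetric])
    show "bdry ?K i (K \<oplus>\<^bsub>obj ?K i\<^esub> K') = bdry ?K i K \<oplus>\<^bsub>obj ?K (i - 1)\<^esub> bdry ?K i K'"
      unfolding h unfolding K(1,3) quotient_complex_bdry[OF K(2)] quotient_complex_bdry[OF K(4)]
        quotient_complex_bdry[OF cpx_add_closed[OF D K(2,4)]] lin_add[OF cpx_lin[OF D] K(2,4)]
      by (rule lin_add[OF lin_image_coset cpx_closed[OF D K(2)] cpx_closed[OF D K(4)]])
  next
    fix K z a assume K: "K = image_coset i z" "z \<in> carrier (obj D i)" and a: "a \<in> carrier A"
    have h: "K \<triangleleft>\<^bsub>obj ?K i\<^esub> a = image_coset i (z \<triangleleft>\<^bsub>obj D i\<^esub> a)"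
      unfolding K(1) by (rule lin_smult[OF lin_image_coset K(2) a, symmetric])
    show "bdry ?K i (K \<triangleleft>\<^bsub>obj ?K i\<^esub> a) = bdry ?K i K \<triangleleft>\<^bsub>obj ?K (i - 1)\<^esub> a"
      unfolding h unfolding K(1) quotient_complex_bdry[OF K(2)]
        quotient_complex_bdry[OF right_module.rsmult_closed[OF cpx_module[OF D] K(2) a]] lin_smult[OF cpx_lin[OF D] K(2) a]
      by (rule lin_smult[OF lin_image_coset cpx_closed[OF D K(2)] a])
  qed
  show "zero_module (obj ?K i)" if "i < 0"
  proof -
    have "carrier (obj D i) = {\<zero>\<^bsub>obj D i\<^esub>}" using D that by (simp add: A_complex_def zero_module_def)
    moreover have "image_coset i \<zero>\<^bsub>obj D i\<^esub> = \<zero>\<^bsub>obj ?K i\<^esub>" by (rule lin_zero[OF lin_image_coset cpx_module[OF D] mod])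
    ultimately show ?thesis by (simp add: zero_module_def quotient_complex_carrier)
  qed
  fix K assume "K \<in> carrier (obj ?K i)"
  then obtain z where K: "K = image_coset i z" "z \<in> carrier (obj D i)" unfolding quotient_complex_carrier by blast
  show "bdry ?K (i - 1) (bdry ?K i K) = \<zero>\<^bsub>obj ?K (i - 2)\<^esub>"
    using lin_zero[OF lin_image_coset cpx_module[OF D] mod, of "i - 2"] K(2) cpx_dd[OF D K(2)]
    by (simp add: K(1) quotient_complex_bdry cpx_closed[OF D])
qed

text \<open>
  The homology of the quotient is computed from chains of \<open>D\<close> whose boundary lies in the image of \<open>f\<close>, modulo
  this image and the boundaries of \<open>D\<close>. The hypotheses say that \<open>\<pi>\<close> identifies it with \<open>M\<close> in degree \<open>q\<close> and that
  it vanishes in all other degrees; no cosets occur in them.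
\<close>

lemma quotient_complex_homology:
  assumes M: "right_module A M" and fgp: "fg_projective A M" and \<pi>: "\<pi> \<in> linear_maps A (obj D q) M"
    and surj: "\<And>y. y \<in> carrier M \<Longrightarrow> \<exists>z\<in>carrier (obj D q). bdry D q z \<in> image_sub (q - 1) \<and> \<pi> z = y"
    and ker: "\<And>z. \<lbrakk>z \<in> carrier (obj D q); bdry D q z \<in> image_sub (q - 1)\<rbrakk> \<Longrightarrow>
      \<pi> z = \<zero>\<^bsub>M\<^esub> \<longleftrightarrow> (\<exists>n\<in>image_sub q. \<exists>w\<in>carrier (obj D (q + 1)). z = n \<oplus>\<^bsub>obj D q\<^esub> bdry D (q + 1) w)"
    and other: "\<And>i z. \<lbrakk>i \<noteq> q; z \<in> carrier (obj D i); bdry D i z \<in> image_sub (i - 1)\<rbrakk> \<Longrightarrow>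
      \<exists>n\<in>image_sub i. \<exists>w\<in>carrier (obj D (i + 1)). z = n \<oplus>\<^bsub>obj D i\<^esub> bdry D (i + 1) w"
  shows "fg_projective_homology_in_degree A q (quotient_complex f C D)"
proof -
  let ?K = "quotient_complex f C D"
  note K = quotient_complex_complex
  have cyc: "image_coset i z \<in> cycles ?K i \<longleftrightarrow> bdry D i z \<in> image_sub (i - 1)" if "z \<in> carrier (obj D i)" for i z
    using that image_coset_zero_iff[OF cpx_closed[OF D that]]
    by (auto simp: cycles_def quotient_complex_carrier quotient_complex_bdry)
  have bd: "image_coset i z \<in> boundaries ?K i \<longleftrightarrow>
      (\<exists>n\<in>image_sub i. \<exists>w\<in>carrier (obj D (i + 1)). z = n \<oplus>\<^bsub>obj D i\<^esub> bdry D (i + 1) w)"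
    if z: "z \<in> carrier (obj D i)" for i z
  proof
    interpret right_module A "obj D i" by (rule cpx_module[OF D])
    assume "image_coset i z \<in> boundaries ?K i"
    then obtain w where w: "w \<in> carrier (obj D (i + 1))" "image_coset i z = image_coset i (bdry D (i + 1) w)"
      unfolding boundaries_def quotient_complex_carrier using quotient_complex_bdry[of _ "i + 1"] by auto
    then have "z \<ominus>\<^bsub>obj D i\<^esub> bdry D (i + 1) w \<in> image_sub i"
      using coset_eq_iff[OF cpx_module[OF D] image_submodule z cpx_closed'[OF D w(1)]] by simp
    moreover have "z = (z \<ominus>\<^bsub>obj D i\<^esub> bdry D (i + 1) w) \<oplus>\<^bsub>obj D i\<^esub> bdry D (i + 1) w"
      using z cpx_closed'[OF D w(1)] by algebra
    ultimately show "\<exists>n\<in>image_sub i. \<exists>w\<in>carrier (obj D (i + 1)). z = n \<oplus>\<^bsub>obj D i\<^esub> bdry D (i + 1) w"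
      using w(1) by blast
  next
    interpret right_module A "obj D i" by (rule cpx_module[OF D])
    assume "\<exists>n\<in>image_sub i. \<exists>w\<in>carrier (obj D (i + 1)). z = n \<oplus>\<^bsub>obj D i\<^esub> bdry D (i + 1) w"
    then obtain n w where n: "n \<in> image_sub i" and w: "w \<in> carrier (obj D (i + 1))" and zn: "z = n \<oplus>\<^bsub>obj D i\<^esub> bdry D (i + 1) w"
      by blast
    have nc: "n \<in> carrier (obj D i)" using n map_closed[OF f] by auto
    have "z \<ominus>\<^bsub>obj D i\<^esub> bdry D (i + 1) w = n" unfolding zn using nc cpx_closed'[OF D w] by algebra
    then have "image_coset i z = image_coset i (bdry D (i + 1) w)"
      using coset_eq_iff[OF cpx_module[OF D] image_submodule z cpx_closed'[OF D w]] n by simp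
    also have "\<dots> = bdry ?K (i + 1) (image_coset (i + 1) w)" using quotient_complex_bdry[OF w] by simp
    finally show "image_coset i z \<in> boundaries ?K i" using w unfolding boundaries_def quotient_complex_carrier by blast
  qed
  have zero: "zero_module (homology ?K i)" if "i \<noteq> q" for i
    unfolding zero_homology_iff[OF K]
  proof
    fix L assume L: "L \<in> cycles ?K i"
    then obtain z where z: "z \<in> carrier (obj D i)" "L = image_coset i z" by (auto simp: cycles_def quotient_complex_carrier)
    then show "L \<in> boundaries ?K i" using L cyc[OF z(1)] bd[OF z(1)] other[OF that z(1)] by blast
  qed
  define R where "R = {z \<in> carrier (obj D q). bdry D q z \<in> image_sub (q - 1)}"
  have R: "submodule A (obj D q) R"
    using image_submodule[of "q - 1"] cpx_zero_closed[OF D] cpx_d_zero[OF D] cpx_add_closed[OF D]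
      right_module.rsmult_closed[OF cpx_module[OF D]] lin_add[OF cpx_lin[OF D]] lin_smult[OF cpx_lin[OF D]]
    by (auto simp: submodule_def R_def)
  let ?R = "(obj D q)\<lparr>carrier := R\<rparr>"
  have RD: "R \<subseteq> carrier (obj D q)" by (auto simp: R_def)
  have "retract_of A (homology ?K q) M"
  proof (rule retract_of_same_kernel[OF right_module_restrict[OF cpx_module[OF D] R] M right_module_homology[OF K]])
    show "\<pi> \<in> linear_maps A ?R M" by (rule lin_restrict_dom[OF \<pi> RD])
    show "\<pi> ` carrier ?R = carrier M"
    proof
      show "\<pi> ` carrier ?R \<subseteq> carrier M" using lin_closed[OF \<pi>] by (auto simp: R_def)
      show "carrier M \<subseteq> \<pi> ` carrier ?R"
      proof
        fix y assume "y \<in> carrier M"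
        then obtain z where "z \<in> R" "\<pi> z = y" using surj unfolding R_def by blast
        then show "y \<in> \<pi> ` carrier ?R" by auto
      qed
    qed
    show "(\<lambda>z. hclass ?K q (image_coset q z)) \<in> linear_maps A ?R (homology ?K q)"
    proof (rule lin_comp[OF _ lin_hclass[OF K]])
      show "(\<lambda>z. image_coset q z) \<in> linear_maps A ?R ((obj ?K q)\<lparr>carrier := cycles ?K q\<rparr>)"
        by (rule lin_restrict_cod[OF lin_restrict_dom[OF lin_image_coset RD]]) (simp add: R_def cyc)
    qed
    show "(\<lambda>z. hclass ?K q (image_coset q z)) ` carrier ?R = carrier (homology ?K q)"
    proof -
      have "image_coset q ` R = cycles ?K q"
      proof
        show "image_coset q ` R \<subseteq> cycles ?K q" by (auto simp: R_def cyc)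
        show "cycles ?K q \<subseteq> image_coset q ` R"
        proof
          fix L assume L: "L \<in> cycles ?K q"
          then obtain z where z: "z \<in> carrier (obj D q)" "L = image_coset q z" by (auto simp: cycles_def quotient_complex_carrier)
          then show "L \<in> image_coset q ` R" using L cyc[OF z(1)] by (auto simp: R_def)
        qed
      qed
      then have "(\<lambda>z. hclass ?K q (image_coset q z)) ` R = hclass ?K q ` cycles ?K q" by (metis (no_types) image_image)
      then show ?thesis by (simp add: homology_carrier[OF K])
    qed
    fix z assume "z \<in> carrier ?R"
    then have z: "z \<in> carrier (obj D q)" "bdry D q z \<in> image_sub (q - 1)" by (auto simp: R_def)
    then show "\<pi> z = \<zero>\<^bsub>M\<^esub> \<longleftrightarrow> hclass ?K q (image_coset q z) = \<zero>\<^bsub>homology ?K q\<^esub>"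
      using hclass_eq_zero_iff[OF K, of "image_coset q z" q] cyc[OF z(1)] bd[OF z(1)] ker[OF z] by simp
  qed
  then have "fg_projective A (homology ?K q)"
    by (rule fg_projective_retract[OF fgp _ right_module_homology[OF K] M])
  then have "fg_projective A (homology ?K i)" for i
    using zero fg_projective_zero[OF right_module_homology[OF K]] by (cases "i = q") auto
  then show ?thesis using zero by (simp add: fg_projective_homology_in_degree_def)
qed

end

section \<open>Transport of structure\<close>

lemma weak_equiv_bij:
  assumes C: "A_complex A C" and D: "A_complex A D" and f: "A_map A f C D"
    and bij: "\<And>i. bij_betw (f i) (carrier (obj C i)) (carrier (obj D i))"
  shows "weak_equiv f C D"
  unfolding weak_equiv_def
proof (intro allI ballI impI)
  fix i x y assume x: "x \<in> carrier (obj C i)" and y: "y \<in> carrier (obj D (i + 1))" and eq: "f i x = bdry D (i + 1) y"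
  interpret D1: right_module A "obj D (i + 1)" by (rule cpx_module[OF D])
  obtain x' where x': "x' \<in> carrier (obj C (i + 1))" "y = f (i + 1) x'"
    using bij_betw_imp_surj_on[OF bij] y by (metis imageE)
  have "f i (bdry C (i + 1) x') = f i x" using map_bdry'[OF f x'(1)] x'(2) eq by simp
  then have "bdry C (i + 1) x' = x"
    using inj_onD[OF bij_betw_imp_inj_on[OF bij]] cpx_closed'[OF C x'(1)] x by metis
  moreover have "bdry D (i + 2) \<zero>\<^bsub>obj D (i + 2)\<^esub> = \<zero>\<^bsub>obj D (i + 1)\<^esub>"
    using cpx_d_zero[OF D, of "i + 2"] by (simp add: add.commute)
  ultimately show "\<exists>x'\<in>carrier (obj C (i + 1)). \<exists>y'\<in>carrier (obj D (i + 2)).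
      bdry C (i + 1) x' = x \<and> y = f (i + 1) x' \<oplus>\<^bsub>obj D (i + 1)\<^esub> bdry D (i + 2) y'"
    using x' y by (intro bexI[OF _ x'(1)] bexI[of _ "\<zero>\<^bsub>obj D (i + 2)\<^esub>"]) (auto simp: cpx_zero_closed[OF D])
qed

definition transport_module ::
  "('m \<Rightarrow> 'n) \<Rightarrow> ('a, 'm, 'c) rmodule_scheme \<Rightarrow> ('a, 'n) rmodule"
  where "transport_module \<iota> M = (let \<kappa> = inv_into (carrier M) \<iota> in
    \<lparr>carrier = \<iota> ` carrier M, mult = undefined, one = undefined, zero = \<iota> \<zero>\<^bsub>M\<^esub>,
     add = (\<lambda>x y. \<iota> (\<kappa> x \<oplus>\<^bsub>M\<^esub> \<kappa> y)), rsmult = (\<lambda>x a. \<iota> (\<kappa> x \<triangleleft>\<^bsub>M\<^esub> a))\<rparr>)"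

definition transport_cpx ::
  "(int \<Rightarrow> 'm \<Rightarrow> 'n) \<Rightarrow> ('a, 'm, 'c) cpx_scheme \<Rightarrow> ('a, 'n) cpx"
  where "transport_cpx \<iota> C = \<lparr>obj = (\<lambda>i. transport_module (\<iota> i) (obj C i)),
    bdry = (\<lambda>i x. \<iota> (i - 1) (bdry C i (inv_into (carrier (obj C i)) (\<iota> i) x)))\<rparr>"

lemma transport_module_lin:
  assumes "inj_on \<iota> (carrier M)" shows "\<iota> \<in> linear_maps A M (transport_module \<iota> M)"
  by (rule linear_mapsI) (auto simp: transport_module_def Let_def inv_into_f_f[OF assms])

lemma right_module_transport:
  assumes M: "right_module A M" and inj: "inj_on \<iota> (carrier M)"
  shows "right_module A (transport_module \<iota> M)"
  by (rule right_module_image[OF M, where q = \<iota>])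
     (auto simp: transport_module_def Let_def inv_into_f_f[OF inj])

lemma inverse_lin:
  assumes f: "f \<in> linear_maps A M N" and bij: "bij_betw f (carrier M) (carrier N)" and M: "right_module A M"
  shows "inv_into (carrier M) f \<in> linear_maps A N M"
proof -
  interpret right_module A M by fact
  have N: "carrier N = f ` carrier M" using bij by (simp add: bij_betw_def)
  have inv: "inv_into (carrier M) f (f x) = x" if "x \<in> carrier M" for x
    using bij_betw_imp_inj_on[OF bij] that by (rule inv_into_f_f)
  show ?thesis
  proof (rule linear_mapsI; unfold N; elim imageE)
    fix u x assume "u = f x" "x \<in> carrier M"
    then show "inv_into (carrier M) f u \<in> carrier M" by (simp add: inv)
  next
    fix u w x y assume *: "u = f x" "x \<in> carrier M" "w = f y" "y \<in> carrier M"
    then have "u \<oplus>\<^bsub>N\<^esub> w = f (x \<oplus>\<^bsub>M\<^esub> y)" by (simp add: lin_add[OF f])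
    then show "inv_into (carrier M) f (u \<oplus>\<^bsub>N\<^esub> w) = inv_into (carrier M) f u \<oplus>\<^bsub>M\<^esub> inv_into (carrier M) f w"
      using * by (simp add: inv)
  next
    fix u x a assume *: "u = f x" "x \<in> carrier M" "a \<in> carrier A"
    then have "u \<triangleleft>\<^bsub>N\<^esub> a = f (x \<triangleleft>\<^bsub>M\<^esub> a)" by (simp add: lin_smult[OF f])
    then show "inv_into (carrier M) f (u \<triangleleft>\<^bsub>N\<^esub> a) = inv_into (carrier M) f u \<triangleleft>\<^bsub>M\<^esub> a"
      using * by (simp add: inv rsmult_closed)
  qed
qed

context
  fixes A :: "('a, 'b) ring_scheme" and C :: "('a, 'm, 'c) cpx_scheme" and \<iota> :: "int \<Rightarrow> 'm \<Rightarrow> 'n"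
  assumes C: "A_complex A C" and inj: "\<And>i. inj_on (\<iota> i) (carrier (obj C i))"
begin

lemma transport_carrier: "carrier (obj (transport_cpx \<iota> C) i) = \<iota> i ` carrier (obj C i)"
  by (simp add: transport_cpx_def transport_module_def Let_def)

lemma transport_bdry: "x \<in> carrier (obj C i) \<Longrightarrow> bdry (transport_cpx \<iota> C) i (\<iota> i x) = \<iota> (i - 1) (bdry C i x)"
  by (simp add: transport_cpx_def inv_into_f_f[OF inj])

lemma transport_bij: "bij_betw (\<iota> i) (carrier (obj C i)) (carrier (obj (transport_cpx \<iota> C) i))"
  by (simp add: bij_betw_def inj transport_carrier)

lemma transport_lin: "\<iota> i \<in> linear_maps A (obj C i) (obj (transport_cpx \<iota> C) i)"
  using transport_module_lin[OF inj] by (simp add: transport_cpx_def)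

lemma transport_mod: "right_module A (obj (transport_cpx \<iota> C) i)"
  using right_module_transport[OF cpx_module[OF C] inj] by (simp add: transport_cpx_def)

lemma transport_inverse_lin:
  "inv_into (carrier (obj C i)) (\<iota> i) \<in> linear_maps A (obj (transport_cpx \<iota> C) i) (obj C i)"
  by (rule inverse_lin[OF transport_lin transport_bij cpx_module[OF C]])

lemma transport_complex: "A_complex A (transport_cpx \<iota> C)"
  unfolding A_complex_def
proof (intro conjI allI ballI impI)
  fix i
  show "right_module A (obj (transport_cpx \<iota> C) i)" by (rule transport_mod)
  show "bdry (transport_cpx \<iota> C) i \<in> linear_maps A (obj (transport_cpx \<iota> C) i) (obj (transport_cpx \<iota> C) (i - 1))"
    using lin_comp[OF lin_comp[OF transport_inverse_lin cpx_lin[OF C]] transport_lin] by (simp add: transport_cpx_def)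
  show "zero_module (obj (transport_cpx \<iota> C) i)" if "i < 0"
    using C that by (simp add: A_complex_def zero_module_def transport_cpx_def transport_module_def Let_def)
  fix u assume "u \<in> carrier (obj (transport_cpx \<iota> C) i)"
  then obtain x where x: "x \<in> carrier (obj C i)" "u = \<iota> i x" by (auto simp: transport_carrier)
  show "bdry (transport_cpx \<iota> C) (i - 1) (bdry (transport_cpx \<iota> C) i u) = \<zero>\<^bsub>obj (transport_cpx \<iota> C) (i - 2)\<^esub>"
    using transport_bdry[OF x(1)] transport_bdry[OF cpx_closed[OF C x(1)]] cpx_dd[OF C x(1)]
      lin_zero[OF transport_lin cpx_module[OF C] transport_mod, of "i - 2"] by (simp add: x(2))
qed

lemma transport_map: "A_map A \<iota> C (transport_cpx \<iota> C)"
  by (simp add: A_map_def transport_lin transport_bdry)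

lemma transport_inverse_map: "A_map A (\<lambda>i. inv_into (carrier (obj C i)) (\<iota> i)) (transport_cpx \<iota> C) C"
  unfolding A_map_def
proof (intro conjI allI ballI)
  fix i
  show "inv_into (carrier (obj C i)) (\<iota> i) \<in> linear_maps A (obj (transport_cpx \<iota> C) i) (obj C i)"
    by (rule transport_inverse_lin)
  fix u assume "u \<in> carrier (obj (transport_cpx \<iota> C) i)"
  then obtain x where x: "x \<in> carrier (obj C i)" "u = \<iota> i x" by (auto simp: transport_carrier)
  show "inv_into (carrier (obj C (i - 1))) (\<iota> (i - 1)) (bdry (transport_cpx \<iota> C) i u)
    = bdry C i (inv_into (carrier (obj C i)) (\<iota> i) u)"
    using x cpx_closed[OF C x(1)] by (simp add: transport_bdry inv_into_f_f[OF inj])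
qed

lemma transport_inverse_weak_equiv:
  "weak_equiv (\<lambda>i. inv_into (carrier (obj C i)) (\<iota> i)) (transport_cpx \<iota> C) C"
  by (rule weak_equiv_bij[OF transport_complex C transport_inverse_map bij_betw_inv_into[OF transport_bij]])

lemma transport_strictly_perfect:
  assumes "strictly_perfect A C" shows "strictly_perfect A (transport_cpx \<iota> C)"
proof -
  have "retract_of A (obj (transport_cpx \<iota> C) i) (obj C i)" for i
    unfolding retract_of_def
    by (rule bexI[OF _ transport_inverse_lin], rule bexI[OF _ transport_lin])
       (auto simp: transport_carrier inv_into_f_f[OF inj])
  then have "fg_projective A (obj (transport_cpx \<iota> C) i)" for i
    using assms fg_projective_retract[OF _ _ transport_mod cpx_module[OF C]] by (auto simp: strictly_perfect_def)
  moreover have "zero_module (obj (transport_cpx \<iota> C) i)" if "zero_module (obj C i)" for i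
    using that by (simp add: zero_module_def transport_cpx_def transport_module_def Let_def)
  ultimately show ?thesis using assms transport_complex unfolding strictly_perfect_def by blast
qed

end

lemma fg_projective_embedding:
  fixes M :: "('a, 'm, 'c) rmodule_scheme"
  assumes "right_module A M" "fg_projective A M"
  shows "\<exists>s :: 'm \<Rightarrow> nat \<Rightarrow> 'a. inj_on s (carrier M)"
proof -
  obtain n :: nat where "retract_of A M (free_module A {..<n})"
    using assms(2) retract_of_free_finite_rank[OF assms(1)] by blast
  then obtain s p where s: "s \<in> linear_maps A M (free_module A {..<n})" "\<forall>x\<in>carrier M. p (s x) = x"
    unfolding retract_of_def by blast
  have "inj_on s (carrier M)" by (rule inj_on_inverseI[of _ p]) (use s(2) in blast)
  then show ?thesis by blast
qed

text \<open>
  A strictly perfect complex embeds degreewise in finitely generated free modules, so it has a copy whose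
  elements are sequences in \<open>A\<close>. The first component of the pairs is a constant.
\<close>

lemma A_perfectI:
  fixes X :: "('a, 'm, 'c) cpx_scheme"
  assumes X: "A_complex A X" and R: "projectively_resolved A R X"
  shows "A_perfect TYPE('x \<times> (nat \<Rightarrow> 'a)) A X"
proof -
  obtain f where sR: "strictly_perfect A R" and f: "A_map A f R X" "weak_equiv f R X"
    using R unfolding projectively_resolved_def by blast
  have Rc: "A_complex A R" and proj: "\<And>i. fg_projective A (obj R i)" using sR by (auto simp: strictly_perfect_def)
  have "\<forall>i. \<exists>s :: _ \<Rightarrow> nat \<Rightarrow> 'a. inj_on s (carrier (obj R i))"
    using fg_projective_embedding[OF cpx_module[OF Rc] proj] by blast
  then obtain s :: "int \<Rightarrow> _ \<Rightarrow> nat \<Rightarrow> 'a" where s: "\<And>i. inj_on (s i) (carrier (obj R i))" by metis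
  define \<iota> :: "int \<Rightarrow> _ \<Rightarrow> 'x \<times> (nat \<Rightarrow> 'a)" where "\<iota> = (\<lambda>i x. (undefined, s i x))"
  have inj: "inj_on (\<iota> i) (carrier (obj R i))" for i using s[of i] by (auto simp: inj_on_def \<iota>_def)
  let ?R = "transport_cpx \<iota> R"
  note R' = transport_complex[OF Rc inj]
  have g: "A_map A (\<lambda>i x. f i (inv_into (carrier (obj R i)) (\<iota> i) x)) ?R X"
    by (rule map_comp[OF transport_inverse_map[OF Rc inj] f(1)])
  have "weak_equiv (\<lambda>i x. f i (inv_into (carrier (obj R i)) (\<iota> i) x)) ?R X"
    by (rule weak_equiv_comp[OF R' Rc X transport_inverse_map[OF Rc inj] transport_inverse_weak_equiv[OF Rc inj] f])
  then have "quasi_iso A (\<lambda>i x. f i (inv_into (carrier (obj R i)) (\<iota> i) x)) ?R X"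
    using quasi_iso_iff_weak_equiv[OF R' X g] by blast
  then have "qi_edge A X ?R" using R' X unfolding qi_edge_def by blast
  then show ?thesis unfolding A_perfect_def using transport_strictly_perfect[OF Rc inj sR] by blast
qed



section \<open>Attaching a cofibre to the source of a map\<close>

declare poly_module_simps [simp del]

definition cone ::
  "('a, 'b) ring_scheme \<Rightarrow> (int \<Rightarrow> 'm \<Rightarrow> 'n) \<Rightarrow> ('a, 'm, 'c) cpx_scheme \<Rightarrow> ('a, 'n, 'd) cpx_scheme \<Rightarrow> ('a, 'n \<times> 'm) cpx"
  where "cone A f C D = twisted (\<lambda>i. f (i - 1)) (shifted A C) D"

lemma cone_obj: "obj (cone A f C D) i = sum_module (obj D i) (obj C (i - 1))"
  by (simp add: cone_def)

lemma cone_bdry: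
  "A_complex A C \<Longrightarrow> x \<in> carrier (obj C (i - 1)) \<Longrightarrow> bdry (cone A f C D) i (y, x) =
    (bdry D i y \<oplus>\<^bsub>obj D (i - 1)\<^esub> f (i - 1) x, \<ominus>\<^bsub>obj C (i - 2)\<^esub> bdry C (i - 1) x)"
  using shifted_bdry[of A C x i] by (simp add: cone_def del: shifted_simps(2))

lemma cone_complex:
  "A_complex A C \<Longrightarrow> A_complex A D \<Longrightarrow> A_map A f C D \<Longrightarrow> A_complex A (cone A f C D)"
  unfolding cone_def by (intro twisted_complex shifted_complex twisting_of_map)

lemma homology_mapping_cone:
  assumes C: "A_complex A C" and D: "A_complex A D"
  shows "homology (mapping_cone f C D) i = homology (cone A f C D) i"
proof -
  have o: "obj (mapping_cone f C D) i = obj (cone A f C D) i" for i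
    by (simp add: mapping_cone_def cone_obj)
  have b: "bdry (mapping_cone f C D) i z = bdry (cone A f C D) i z" if "z \<in> carrier (obj (cone A f C D) i)" for i z
    using that cone_bdry[OF C, of "snd z" i f D "fst z"] by (cases z) (auto simp: mapping_cone_def cone_obj)
  have "cycles (mapping_cone f C D) i = cycles (cone A f C D) i"
    using b[of _ i] by (auto simp: cycles_def o)
  moreover have "boundaries (mapping_cone f C D) i = boundaries (cone A f C D) i"
    unfolding boundaries_def o by (rule image_cong) (auto simp: b)
  ultimately show ?thesis by (simp add: homology_def o)
qed

context
  fixes A :: "('a, 'b) ring_scheme" and X :: "('a, 'x, 'c) cpx_scheme" and Y :: "('a, 'y, 'd) cpx_scheme"
    and T :: "('a, 't, 'e) cpx_scheme" and \<phi> g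
  assumes X: "A_complex A X" and Y: "A_complex A Y" and T: "A_complex A T"
    and \<phi>: "A_map A \<phi> X Y" and g: "A_map A g T (cone A \<phi> X Y)"
begin

abbreviation (input) attach_twist where
  "attach_twist i z \<equiv> snd (g i z) \<triangleleft>\<^bsub>obj X (i - 1)\<^esub> (\<ominus>\<^bsub>A\<^esub> \<one>\<^bsub>A\<^esub>)"

abbreviation (input) attach_map where
  "attach_map i z \<equiv> \<phi> i (fst z) \<oplus>\<^bsub>obj Y i\<^esub> fst (g i (snd z))"

lemma cone_map_lin: "g i \<in> linear_maps A (obj T i) (sum_module (obj Y i) (obj X (i - 1)))"
  using map_lin[OF g, of i] by (simp add: cone_obj)

lemma cone_map_components:
  assumes z: "z \<in> carrier (obj T i)"
  shows "fst (g i z) \<in> carrier (obj Y i)" "snd (g i z) \<in> carrier (obj X (i - 1))"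
    and "fst (g (i - 1) (bdry T i z)) = bdry Y i (fst (g i z)) \<oplus>\<^bsub>obj Y (i - 1)\<^esub> \<phi> (i - 1) (snd (g i z))"
    and "snd (g (i - 1) (bdry T i z)) = \<ominus>\<^bsub>obj X (i - 2)\<^esub> bdry X (i - 1) (snd (g i z))"
proof -
  have c: "g i z \<in> carrier (sum_module (obj Y i) (obj X (i - 1)))" using map_closed[OF g z] by (simp add: cone_obj)
  then show "fst (g i z) \<in> carrier (obj Y i)" and x: "snd (g i z) \<in> carrier (obj X (i - 1))" by auto
  show "fst (g (i - 1) (bdry T i z)) = bdry Y i (fst (g i z)) \<oplus>\<^bsub>obj Y (i - 1)\<^esub> \<phi> (i - 1) (snd (g i z))"
    "snd (g (i - 1) (bdry T i z)) = \<ominus>\<^bsub>obj X (i - 2)\<^esub> bdry X (i - 1) (snd (g i z))"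
    using map_bdry[OF g z] cone_bdry[OF X x, of \<phi> Y "fst (g i z)"] by auto
qed

lemma attach_twist_eq:
  "z \<in> carrier (obj T i) \<Longrightarrow> attach_twist i z = \<ominus>\<^bsub>obj X (i - 1)\<^esub> snd (g i z)"
  by (rule cpx_neg[OF X cone_map_components(2)])

lemma attach_twisting: "twisting A (\<lambda>i z. attach_twist i z) T X"
  unfolding twisting_def
proof (intro conjI allI ballI)
  fix i
  have "(\<lambda>z. snd (g i z)) \<in> linear_maps A (obj T i) (obj X (i - 1))"
    by (rule lin_comp[OF cone_map_lin lin_snd])
  then show "(\<lambda>z. attach_twist i z) \<in> linear_maps A (obj T i) (obj X (i - 1))"
    by (rule lin_neg[OF _ cpx_module[OF X]])
  fix z assume z: "z \<in> carrier (obj T i)"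
  interpret right_module A "obj X (i - 2)" by (rule cpx_module[OF X])
  note c = cone_map_components[OF z]
  have d: "bdry X (i - 1) (snd (g i z)) \<in> carrier (obj X (i - 2))" by (rule cpx_closed2[OF X c(2)])
  have "attach_twist (i - 1) (bdry T i z) = \<ominus>\<^bsub>obj X (i - 2)\<^esub> (\<ominus>\<^bsub>obj X (i - 2)\<^esub> bdry X (i - 1) (snd (g i z)))"
    using attach_twist_eq[OF cpx_closed[OF T z]] c(4) by simp
  moreover have "bdry X (i - 1) (attach_twist i z) = \<ominus>\<^bsub>obj X (i - 2)\<^esub> bdry X (i - 1) (snd (g i z))"
    using attach_twist_eq[OF z] cpx_bdry_minus[OF X c(2)] by simp
  ultimately show "bdry X (i - 1) (attach_twist i z) \<oplus>\<^bsub>obj X (i - 2)\<^esub> attach_twist (i - 1) (bdry T i z) = \<zero>\<^bsub>obj X (i - 2)\<^esub>"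
    using d by (simp add: M.l_neg)
qed

lemma attach_map_chain: "A_map A (\<lambda>i z. attach_map i z) (twisted (\<lambda>i z. attach_twist i z) T X) Y"
  unfolding A_map_def
proof (intro conjI allI ballI)
  let ?E = "twisted (\<lambda>i z. attach_twist i z) T X"
  fix i
  have "(\<lambda>z. fst (g i z)) \<in> linear_maps A (obj T i) (obj Y i)"
    by (rule lin_comp[OF cone_map_lin lin_fst])
  then show "(\<lambda>z. attach_map i z) \<in> linear_maps A (obj ?E i) (obj Y i)"
    unfolding twisted_simps by (intro lin_plus lin_on_fst lin_on_snd map_lin[OF \<phi>] cpx_module[OF Y])
  fix e assume "e \<in> carrier (obj ?E i)"
  then obtain x z where e: "e = (x, z)" and x: "x \<in> carrier (obj X i)" and z: "z \<in> carrier (obj T i)" by auto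
  interpret right_module A "obj Y (i - 1)" by (rule cpx_module[OF Y])
  note c = cone_map_components[OF z]
  have cl: "bdry Y i (\<phi> i x) \<in> carrier (obj Y (i - 1))" "\<phi> (i - 1) (snd (g i z)) \<in> carrier (obj Y (i - 1))"
    "bdry Y i (fst (g i z)) \<in> carrier (obj Y (i - 1))"
    using cpx_closed[OF Y map_closed[OF \<phi> x]] map_closed[OF \<phi> c(2)] cpx_closed[OF Y c(1)] by auto
  have "\<phi> (i - 1) (bdry X i x \<oplus>\<^bsub>obj X (i - 1)\<^esub> attach_twist i z)
      = bdry Y i (\<phi> i x) \<oplus>\<^bsub>obj Y (i - 1)\<^esub> \<ominus>\<^bsub>obj Y (i - 1)\<^esub> \<phi> (i - 1) (snd (g i z))"
    unfolding attach_twist_eq[OF z] lin_add[OF map_lin[OF \<phi>] cpx_closed[OF X x] cpx_minus_closed[OF X c(2)]]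
      lin_minus[OF map_lin[OF \<phi>] cpx_module[OF X] cpx_module[OF Y] c(2)] map_bdry[OF \<phi> x] ..
  then have "attach_map (i - 1) (bdry ?E i e) =
      (bdry Y i (\<phi> i x) \<oplus>\<^bsub>obj Y (i - 1)\<^esub> \<ominus>\<^bsub>obj Y (i - 1)\<^esub> \<phi> (i - 1) (snd (g i z)))
      \<oplus>\<^bsub>obj Y (i - 1)\<^esub> (bdry Y i (fst (g i z)) \<oplus>\<^bsub>obj Y (i - 1)\<^esub> \<phi> (i - 1) (snd (g i z)))"
    by (simp add: e c(3))
  also have "\<dots> = bdry Y i (\<phi> i x) \<oplus>\<^bsub>obj Y (i - 1)\<^esub> bdry Y i (fst (g i z))"
    using cl by algebra
  also have "\<dots> = bdry Y i (attach_map i e)"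
    unfolding e fst_conv snd_conv lin_add[OF cpx_lin[OF Y] map_closed[OF \<phi> x] c(1)] ..
  finally show "attach_map (i - 1) (bdry ?E i e) = bdry Y i (attach_map i e)" .
qed

text \<open>
  If \<open>(x, z)\<close> is a cycle of the attached complex whose image is the boundary of \<open>y\<close>, then \<open>z\<close> is a cycle whose image
  in the cone is the boundary of \<open>(y, - x)\<close>. Solving this equation for the quasi-isomorphism \<open>g\<close> solves the given one.
\<close>

lemma attach_map_weak_equiv:
  assumes we: "weak_equiv g T (cone A \<phi> X Y)"
  shows "weak_equiv (\<lambda>i z. attach_map i z) (twisted (\<lambda>i z. attach_twist i z) T X) Y"
  unfolding weak_equiv_def
proof (intro allI ballI impI)
  let ?E = "twisted (\<lambda>i z. attach_twist i z) T X" and ?C = "cone A \<phi> X Y"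
  fix i e y assume "e \<in> carrier (obj ?E i)" and y: "y \<in> carrier (obj Y (i + 1))"
    and "bdry ?E i e = \<zero>\<^bsub>obj ?E (i - 1)\<^esub>" and "attach_map i e = bdry Y (i + 1) y"
  then obtain x z where e: "e = (x, z)" and x: "x \<in> carrier (obj X i)" and z: "z \<in> carrier (obj T i)"
    and dx: "bdry X i x \<oplus>\<^bsub>obj X (i - 1)\<^esub> attach_twist i z = \<zero>\<^bsub>obj X (i - 1)\<^esub>"
    and dz: "bdry T i z = \<zero>\<^bsub>obj T (i - 1)\<^esub>"
    and eq: "\<phi> i x \<oplus>\<^bsub>obj Y i\<^esub> fst (g i z) = bdry Y (i + 1) y" by auto
  interpret X1: right_module A "obj X (i - 1)" by (rule cpx_module[OF X])
  interpret X0: right_module A "obj X i" by (rule cpx_module[OF X])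
  interpret Y0: right_module A "obj Y i" by (rule cpx_module[OF Y])
  interpret Y1: right_module A "obj Y (i + 1)" by (rule cpx_module[OF Y])
  note c = cone_map_components[OF z]
  have gz2: "snd (g i z) = bdry X i x"
    using dx X1.M.minus_eq_zeroD[of "bdry X i x" "snd (g i z)"] cpx_closed[OF X x] c(2)
    unfolding attach_twist_eq[OF z] by (simp add: X1.M.minus_eq)
  have \<phi>x: "\<phi> i x \<in> carrier (obj Y i)" by (rule map_closed[OF \<phi> x])
  let ?c = "(y, \<ominus>\<^bsub>obj X i\<^esub> x)"
  have mx: "\<ominus>\<^bsub>obj X i\<^esub> x \<in> carrier (obj X (i + 1 - 1))" using cpx_minus_closed[OF X x] by simp
  have cc: "?c \<in> carrier (obj ?C (i + 1))" using y mx by (simp add: cone_obj)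
  have 1: "bdry Y (i + 1) y \<oplus>\<^bsub>obj Y i\<^esub> \<ominus>\<^bsub>obj Y i\<^esub> \<phi> i x = fst (g i z)"
    unfolding eq[symmetric] using \<phi>x c(1) by algebra
  have "bdry ?C (i + 1) ?c = (fst (g i z), bdry X i x)"
    using cone_bdry[OF X mx, of \<phi> Y y] 1 lin_minus[OF map_lin[OF \<phi>] cpx_module[OF X] cpx_module[OF Y] x]
      cpx_bdry_minus[OF X x] cpx_minus_minus[OF X cpx_closed[OF X x]] by simp
  then have "g i z = bdry ?C (i + 1) ?c" using gz2 by (simp add: prod_eq_iff)
  from weak_equivD[OF we z cc dz this]
  obtain z' c' where z': "z' \<in> carrier (obj T (i + 1))" "bdry T (i + 1) z' = z"
    and c': "c' \<in> carrier (obj ?C (i + 2))" "?c = g (i + 1) z' \<oplus>\<^bsub>obj ?C (i + 1)\<^esub> bdry ?C (i + 2) c'" by metis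
  obtain y' x' where yx: "c' = (y', x')" "y' \<in> carrier (obj Y (i + 2))" "x' \<in> carrier (obj X (i + 2 - 1))"
    using c'(1) by (auto simp: cone_obj)
  have x': "x' \<in> carrier (obj X (i + 1))" using yx(3) by (simp add: add.commute)
  note cz' = cone_map_components[OF z'(1)]
  have gz': "snd (g (i + 1) z') \<in> carrier (obj X i)" using cz'(2) by simp
  have idx: "i + 2 - 1 = i + 1" "i + 2 - 2 = i" "i + 1 - 1 = i" by auto
  have dc': "bdry ?C (i + 2) c' = (bdry Y (i + 2) y' \<oplus>\<^bsub>obj Y (i + 1)\<^esub> \<phi> (i + 1) x', \<ominus>\<^bsub>obj X i\<^esub> bdry X (i + 1) x')"
    using cone_bdry[OF X yx(3), of \<phi> Y y'] unfolding yx(1) idx .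
  have oC: "obj ?C (i + 1) = sum_module (obj Y (i + 1)) (obj X i)" by (simp add: cone_obj)
  have y_eq: "y = fst (g (i + 1) z') \<oplus>\<^bsub>obj Y (i + 1)\<^esub> (bdry Y (i + 2) y' \<oplus>\<^bsub>obj Y (i + 1)\<^esub> \<phi> (i + 1) x')"
    and x_eq: "\<ominus>\<^bsub>obj X i\<^esub> x = snd (g (i + 1) z') \<oplus>\<^bsub>obj X i\<^esub> \<ominus>\<^bsub>obj X i\<^esub> bdry X (i + 1) x'"
    using c'(2) unfolding dc' oC by (cases "g (i + 1) z'", simp)+
  have dx': "bdry X (i + 1) x' \<in> carrier (obj X i)" by (rule cpx_closed'[OF X x'])
  have "x = \<ominus>\<^bsub>obj X i\<^esub> (snd (g (i + 1) z') \<oplus>\<^bsub>obj X i\<^esub> \<ominus>\<^bsub>obj X i\<^esub> bdry X (i + 1) x')"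
    unfolding x_eq[symmetric] using x by simp
  also have "\<dots> = bdry X (i + 1) x' \<oplus>\<^bsub>obj X i\<^esub> \<ominus>\<^bsub>obj X i\<^esub> snd (g (i + 1) z')"
    using dx' gz' by algebra
  finally have "bdry X (i + 1) x' \<oplus>\<^bsub>obj X i\<^esub> attach_twist (i + 1) z' = x"
    using attach_twist_eq[OF z'(1)] by simp
  then have 2: "bdry ?E (i + 1) (x', z') = e" using z'(2) by (simp add: e)
  have 3: "y = attach_map (i + 1) (x', z') \<oplus>\<^bsub>obj Y (i + 1)\<^esub> bdry Y (i + 2) y'"
    using y_eq cz'(1) cpx_closed''[OF Y yx(2)] map_closed[OF \<phi> x'] by (simp add: Y1.M.a_ac)
  show "\<exists>x'\<in>carrier (obj ?E (i + 1)). \<exists>y'\<in>carrier (obj Y (i + 2)).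
      bdry ?E (i + 1) x' = e \<and> y = attach_map (i + 1) x' \<oplus>\<^bsub>obj Y (i + 1)\<^esub> bdry Y (i + 2) y'"
    using 2 3 x' z'(1) yx(2) by (intro bexI[of _ "(x', z')"] bexI[of _ y'] conjI) auto
qed

end

section \<open>Skeletal filtration of the attached telescope\<close>

lemma sum_restrict:
  "sum_module (M\<lparr>carrier := S\<rparr>) (N\<lparr>carrier := S'\<rparr>) = (sum_module M N)\<lparr>carrier := S \<times> S'\<rparr>"
  by (simp add: sum_module_def)

lemma char_map_restrict: "char_map A (M\<lparr>carrier := S\<rparr>) = char_map A M"
  by (auto simp: fun_eq_iff char_map_def poly_shift_def poly_module_simps split: nat.split)

lemma poly_module_zero_restrict:
  "poly_module (M\<lparr>carrier := {\<zero>\<^bsub>M\<^esub>}\<rparr>) = (poly_module M)\<lparr>carrier := {\<zero>\<^bsub>poly_module M\<^esub>}\<rparr>"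
  by (auto simp: poly_module_def)

lemma twisted_subcpx:
  "twisted v (subcpx S Q) X = subcpx (\<lambda>i. carrier (obj X i) \<times> S i) (twisted v Q X)"
  by (simp add: twisted_def subcpx_def sum_module_def)

definition skeleton :: "int \<Rightarrow> ('a, 'm, 'c) cpx_scheme \<Rightarrow> ('a, 'm) cpx"
  where "skeleton q P = subcpx (\<lambda>i. if i \<le> q then carrier (obj P i) else {\<zero>\<^bsub>obj P i\<^esub>}) P"

definition skeletal_polys :: "int \<Rightarrow> ('a, 'm, 'c) cpx_scheme \<Rightarrow> int \<Rightarrow> (nat \<Rightarrow> 'm) set"
  where "skeletal_polys q P i =
    (if i \<le> q then carrier (poly_module (obj P i)) else {\<zero>\<^bsub>poly_module (obj P i)\<^esub>})"

lemma skeletal_polys_sub: "A_complex A P \<Longrightarrow> skeletal_polys q P i \<subseteq> carrier (poly_module (obj P i))"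
  using cpx_zero_closed[OF poly_cpx_complex[of A P], of i] by (auto simp: skeletal_polys_def)

lemma skeletal_polys_zero: "A_complex A P \<Longrightarrow> \<zero>\<^bsub>poly_module (obj P i)\<^esub> \<in> skeletal_polys q P i"
  using cpx_zero_closed[OF poly_cpx_complex[of A P], of i] by (auto simp: skeletal_polys_def)

lemma skeletal_polys_mono: "A_complex A P \<Longrightarrow> q \<le> q' \<Longrightarrow> skeletal_polys q P i \<subseteq> skeletal_polys q' P i"
  using skeletal_polys_sub[of A P q i] skeletal_polys_zero[of A P i q'] by (auto simp: skeletal_polys_def)

lemma skeleton_sub:
  assumes P: "A_complex A P"
  shows "submodule A (obj P i) (if i \<le> q then carrier (obj P i) else {\<zero>\<^bsub>obj P i\<^esub>})"
  using submodule_zero[OF cpx_module[OF P]] right_module.rsmult_closed[OF cpx_module[OF P]]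
    cpx_zero_closed[OF P] cpx_add_closed[OF P] by (auto simp: submodule_def)

lemma skeleton_complex: "A_complex A P \<Longrightarrow> A_complex A (skeleton q P)"
  unfolding skeleton_def
  by (rule subcpx_complex[OF _ skeleton_sub]) (auto simp: cpx_closed cpx_d_zero cpx_zero_closed split: if_splits)

lemma skeleton_strictly_perfect:
  assumes P: "A_complex A P" and proj: "\<And>i. fg_projective A (obj P i)"
  shows "strictly_perfect A (skeleton q P)"
proof -
  have z: "zero_module (obj (skeleton q P) i)" if "i > q" for i
    using that by (simp add: skeleton_def zero_module_def)
  have "fg_projective A (obj (skeleton q P) i)" for i
    using fg_projective_zero[OF cpx_module[OF skeleton_complex[OF P]] z] proj by (cases "i \<le> q") (auto simp: skeleton_def)
  then show ?thesis unfolding strictly_perfect_def using z skeleton_complex[OF P] by blast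
qed

lemma poly_skeleton:
  "poly_module (obj (skeleton q P) i) = (poly_module (obj P i))\<lparr>carrier := skeletal_polys q P i\<rparr>"
  by (auto simp: skeleton_def skeletal_polys_def poly_module_zero_restrict)

text \<open>
  The operations of the two sides are given by the same formulas, so the telescope of a skeleton is literally a
  subcomplex of the telescope. The maps between the stages of the filtration can therefore be identities.
\<close>

lemma telescope_skeleton:
  "telescope A \<tau> (skeleton q P)
    = subcpx (\<lambda>i. skeletal_polys q P i \<times> skeletal_polys q P (i - 1)) (telescope A \<tau> P)"
proof -
  have "obj (telescope A \<tau> (skeleton q P)) = obj (subcpx (\<lambda>i. skeletal_polys q P i \<times> skeletal_polys q P (i - 1)) (telescope A \<tau> P))"
    by (rule ext) (simp add: telescope_def poly_skeleton sum_restrict)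
  moreover have "char_map A (obj (skeleton q P) i) = char_map A (obj P i)" for i
    by (simp add: skeleton_def char_map_restrict)
  then have "bdry (telescope A \<tau> (skeleton q P)) = bdry (subcpx (\<lambda>i. skeletal_polys q P i \<times> skeletal_polys q P (i - 1)) (telescope A \<tau> P))"
    by (intro ext) (simp add: telescope_def poly_skeleton, simp add: skeleton_def)
  ultimately show ?thesis by simp
qed

context
  fixes A :: "('a, 'b) ring_scheme" and P :: "('a, 'p) cpx" and \<tau>
  assumes P: "A_complex A P" and \<tau>: "A_map A \<tau> P P"
begin

lemma skeleton_endo: "A_map A \<tau> (skeleton q P) (skeleton q P)"
proof -
  have \<tau>0: "\<tau> i \<zero>\<^bsub>obj P i\<^esub> = \<zero>\<^bsub>obj P i\<^esub>" for i by (rule lin_zero[OF map_lin[OF \<tau>] cpx_module[OF P] cpx_module[OF P]])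
  have "\<tau> i \<in> linear_maps A (obj (skeleton q P) i) (obj (skeleton q P) i)" for i
    unfolding skeleton_def subcpx_simps
    by (rule lin_restrict_cod[OF lin_restrict_dom[OF map_lin[OF \<tau>]]])
       (use skeleton_sub[OF P, of i q] \<tau>0 map_closed[OF \<tau>] in \<open>auto simp: submodule_def split: if_splits\<close>)
  moreover have "x \<in> carrier (obj P i)" if "x \<in> carrier (obj (skeleton q P) i)" for x i
    using that skeleton_sub[OF P, of i q] by (auto simp: skeleton_def submodule_def split: if_splits)
  ultimately show ?thesis using map_bdry[OF \<tau>] by (simp add: A_map_def skeleton_def)
qed

lemma telescope_skeleton_resolved:
  assumes proj: "\<And>i. fg_projective A (obj P i)"
  shows "projectively_resolved A (skeleton q P) (telescope A \<tau> (skeleton q P))"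
  unfolding projectively_resolved_def
  using skeleton_strictly_perfect[OF P proj] telescope_incl_map[OF skeleton_complex[OF P] skeleton_endo]
    telescope_incl_weak_equiv[OF skeleton_complex[OF P] skeleton_endo] by blast

end



context
  fixes A :: "('a, 'b) ring_scheme" and M :: "('a, 'm, 'c) rmodule_scheme" and \<tau>
  assumes M: "right_module A M" and \<tau>: "\<tau> \<in> linear_maps A M M"
begin

lemma lin_poly_eval: "poly_extend M M (\<lambda>x. x) \<tau> \<in> linear_maps A (poly_module M) M"
  by (rule lin_poly_extend[OF M M lin_id \<tau>])

lemma poly_eval_const: "x \<in> carrier M \<Longrightarrow> poly_extend M M (\<lambda>x. x) \<tau> (poly_const M x) = x"
  by (rule poly_extend_const[OF M M lin_id \<tau>])

lemma poly_eval_char_map: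
  assumes r: "r \<in> carrier (poly_module M)"
  shows "poly_extend M M (\<lambda>x. x) \<tau> (char_map A M \<tau> r) = \<zero>\<^bsub>M\<^esub>"
proof (rule poly_maps_eq[OF M M lin_comp[OF lin_char_map[OF M \<tau>] lin_poly_eval] lin_const_zero[OF M] _ _ _ r])
  let ?\<epsilon> = "poly_extend M M (\<lambda>x. x) \<tau>"
  note shift = poly_extend_shift[OF M M lin_id \<tau>]
  fix p assume p: "p \<in> carrier (poly_module M)"
  show "?\<epsilon> (char_map A M \<tau> (poly_shift M p)) = \<tau> (?\<epsilon> (char_map A M \<tau> p))"
    unfolding char_map_shift[OF M \<tau> p] by (rule shift[OF lin_closed[OF lin_char_map[OF M \<tau>] p]])
  show "\<zero>\<^bsub>M\<^esub> = \<tau> \<zero>\<^bsub>M\<^esub>" by (rule lin_zero[OF \<tau> M M, symmetric])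
next
  interpret M: right_module A M by (rule M)
  interpret PM: right_module A "poly_module M" by (rule right_module_poly[OF M])
  let ?\<epsilon> = "poly_extend M M (\<lambda>x. x) \<tau>"
  note shift = poly_extend_shift[OF M M lin_id \<tau>]
  fix x assume x: "x \<in> carrier M"
  have \<tau>x: "\<tau> x \<in> carrier M" by (rule lin_closed[OF \<tau> x])
  have m: "poly_map \<tau> (poly_const M x) = poly_const M (\<tau> x)"
    by (rule poly_map_const) (rule lin_zero[OF \<tau> M M])
  have "char_map A M \<tau> (poly_const M x) = poly_shift M (poly_const M x) \<ominus>\<^bsub>poly_module M\<^esub> poly_const M (\<tau> x)"
    unfolding char_map_def m PM.rsmult_minus_one[OF poly_const_closed[OF M \<tau>x]] a_minus_def ..
  then have "?\<epsilon> (char_map A M \<tau> (poly_const M x)) = \<tau> x \<ominus>\<^bsub>M\<^esub> \<tau> x"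
    using lin_diff[OF lin_poly_eval right_module_poly[OF M] M poly_shift_closed[OF M poly_const_closed[OF M x]] poly_const_closed[OF M \<tau>x]]
      shift[OF poly_const_closed[OF M x]] poly_eval_const x \<tau>x by simp
  then show "?\<epsilon> (char_map A M \<tau> (poly_const M x)) = \<zero>\<^bsub>M\<^esub>"
    using \<tau>x by (simp add: M.M.minus_eq M.M.r_neg)
qed

lemma poly_eval_zeroD:
  assumes p: "p \<in> carrier (poly_module M)" and 0: "poly_extend M M (\<lambda>x. x) \<tau> p = \<zero>\<^bsub>M\<^esub>"
  obtains r where "r \<in> carrier (poly_module M)" "p = char_map A M \<tau> r"
proof -
  interpret M: right_module A M by (rule M)
  interpret PM: right_module A "poly_module M" by (rule right_module_poly[OF M])
  obtain x r where x: "x \<in> carrier M" and r: "r \<in> carrier (poly_module M)"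
    and p_eq: "p = poly_const M x \<oplus>\<^bsub>poly_module M\<^esub> char_map A M \<tau> r"
    using poly_division[OF M \<tau> p] by blast
  have "poly_extend M M (\<lambda>x. x) \<tau> p = x"
    using lin_add[OF lin_poly_eval poly_const_closed[OF M x] lin_closed[OF lin_char_map[OF M \<tau>] r]]
    unfolding p_eq poly_eval_const[OF x] poly_eval_char_map[OF r] using x by simp
  then have "poly_const M x = \<zero>\<^bsub>poly_module M\<^esub>"
    using 0 lin_zero[OF lin_poly_const[OF M] M right_module_poly[OF M]] by simp
  then have "p = char_map A M \<tau> r" using p_eq lin_closed[OF lin_char_map[OF M \<tau>] r] by simp
  then show ?thesis using that r by blast
qed

end

definition stage_set ::
  "int \<Rightarrow> ('a, 'm, 'c) cpx_scheme \<Rightarrow> ('a, 'p, 'd) cpx_scheme \<Rightarrow> int \<Rightarrow> ('m \<times> (nat \<Rightarrow> 'p) \<times> (nat \<Rightarrow> 'p)) set"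
  where "stage_set q X P i = carrier (obj X i) \<times> skeletal_polys q P i \<times> skeletal_polys q P (i - 1)"

lemma twisting_subcpx:
  assumes v: "twisting A v Q X" and S: "\<And>i. S i \<subseteq> carrier (obj Q i)"
  shows "twisting A v (subcpx S Q) X"
  unfolding twisting_def subcpx_simps
proof (intro conjI allI ballI)
  fix i
  show "v i \<in> linear_maps A ((obj Q i)\<lparr>carrier := S i\<rparr>) (obj X (i - 1))"
    by (rule lin_restrict_dom[OF twisting_lin[OF v] S])
  fix z assume "z \<in> carrier ((obj Q i)\<lparr>carrier := S i\<rparr>)"
  then show "bdry X (i - 1) (v i z) \<oplus>\<^bsub>obj X (i - 2)\<^esub> v (i - 1) (bdry Q i z) = \<zero>\<^bsub>obj X (i - 2)\<^esub>"
    using v S[of i] by (auto simp: twisting_def)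
qed

context
  fixes A :: "('a, 'b) ring_scheme" and X :: "('a, 'x, 'c) cpx_scheme" and P :: "('a, 'p) cpx" and \<tau> v
  assumes X: "A_complex A X" and P: "A_complex A P" and \<tau>: "A_map A \<tau> P P"
    and v: "twisting A v (telescope A \<tau> P) X"
begin

abbreviation (input) attached_cpx where "attached_cpx \<equiv> twisted v (telescope A \<tau> P) X"

lemma attached_complex: "A_complex A attached_cpx"
  by (rule twisted_complex[OF X telescope_complex[OF P \<tau>] v])

lemma attached_obj:
  "obj attached_cpx i = sum_module (obj X i) (sum_module (poly_module (obj P i)) (poly_module (obj P (i - 1))))"
  by (simp add: telescope_obj[OF P \<tau>])

lemma attached_bdry:
  assumes "r \<in> carrier (poly_module (obj P (i - 1)))"
  shows "bdry attached_cpx i (x, p, r) = (bdry X i x \<oplus>\<^bsub>obj X (i - 1)\<^esub> v i (p, r),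
    poly_map (bdry P i) p \<oplus>\<^bsub>poly_module (obj P (i - 1))\<^esub> char_map A (obj P (i - 1)) (\<tau> (i - 1)) r,
    \<ominus>\<^bsub>poly_module (obj P (i - 2))\<^esub> poly_map (bdry P (i - 1)) r)"
  by (simp add: telescope_bdry[OF P \<tau> assms])

lemma stage_sub: "stage_set q X P i \<subseteq> carrier (obj attached_cpx i)"
  unfolding attached_obj stage_set_def sum_module_simps
  by (intro Sigma_mono skeletal_polys_sub[OF P] subset_refl)

lemma stage_mono: "q \<le> q' \<Longrightarrow> stage_set q X P i \<subseteq> stage_set q' X P i"
  unfolding stage_set_def by (intro Sigma_mono skeletal_polys_mono[OF P] subset_refl)

lemma stage_eq: "twisted v (telescope A \<tau> (skeleton q P)) X = subcpx (stage_set q X P) attached_cpx"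
  unfolding telescope_skeleton twisted_subcpx stage_set_def[abs_def] ..

lemma stage_twisting: "twisting A v (telescope A \<tau> (skeleton q P)) X"
  unfolding telescope_skeleton
  by (rule twisting_subcpx[OF v]) (unfold telescope_obj[OF P \<tau>] sum_module_simps, intro Sigma_mono skeletal_polys_sub[OF P])

lemma stage_complex: "A_complex A (subcpx (stage_set q X P) attached_cpx)"
  unfolding stage_eq[symmetric]
  by (rule twisted_complex[OF X telescope_complex[OF skeleton_complex[OF P] skeleton_endo[OF P \<tau>]] stage_twisting])

lemma stage_resolved:
  assumes proj: "\<And>i. fg_projective A (obj P i)" and R: "projectively_resolved A R X"
  shows "\<exists>u. projectively_resolved A (twisted u (skeleton q P) R) (subcpx (stage_set q X P) attached_cpx)"
  unfolding stage_eq[symmetric]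
  by (rule twisted_resolved[OF X telescope_complex[OF skeleton_complex[OF P] skeleton_endo[OF P \<tau>]] stage_twisting R
        telescope_skeleton_resolved[OF P \<tau> proj]])

lemma stage_bdry: "e \<in> stage_set q X P i \<Longrightarrow> bdry attached_cpx i e \<in> stage_set q X P (i - 1)"
  using cpx_closed[OF stage_complex, of e q i] by simp

text \<open>
  Consequently the boundary of every chain of degree \<open>q\<close> in the \<open>q\<close>-th stage already lies in the preceding stage.
\<close>

lemma stage_below: "i \<le> q \<Longrightarrow> stage_set q X P i = stage_set (q + 1) X P i"
  by (simp add: stage_set_def skeletal_polys_def)

abbreviation (input) stage_eval where
  "stage_eval q e \<equiv> poly_extend (obj P q) (obj P q) (\<lambda>x. x) (\<tau> q) (fst (snd e))"

lemma stage_surj: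
  assumes y: "y \<in> carrier (obj P q)"
  shows "\<exists>e\<in>stage_set q X P q. bdry attached_cpx q e \<in> stage_set (q - 1) X P (q - 1) \<and> stage_eval q e = y"
proof (intro bexI conjI)
  let ?e = "(\<zero>\<^bsub>obj X q\<^esub>, poly_const (obj P q) y, \<zero>\<^bsub>poly_module (obj P (q - 1))\<^esub>)"
  show e: "?e \<in> stage_set q X P q"
    using cpx_zero_closed[OF X] poly_const_closed[OF cpx_module[OF P] y] skeletal_polys_zero[OF P]
    by (simp add: stage_set_def skeletal_polys_def[of q P q])
  show "stage_eval q ?e = y" using poly_eval_const[OF cpx_module[OF P] map_lin[OF \<tau>] y] by simp
  show "bdry attached_cpx q ?e \<in> stage_set (q - 1) X P (q - 1)"
    using stage_bdry[OF e] stage_below[of "q - 1" "q - 1"] by simp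
qed

text \<open>
  The homology of the quotient of two stages in degree \<open>q\<close> is the cokernel of \<open>t - \<tau>\<close> on \<open>P\<^sub>q[t]\<close>, and evaluation
  at \<open>\<tau>\<close> identifies this cokernel with \<open>P\<^sub>q\<close>.
\<close>

lemma stage_kernel:
  assumes e: "e \<in> stage_set q X P q"
  shows "stage_eval q e = \<zero>\<^bsub>obj P q\<^esub> \<longleftrightarrow>
    (\<exists>n\<in>stage_set (q - 1) X P q. \<exists>w\<in>stage_set q X P (q + 1). e = n \<oplus>\<^bsub>obj attached_cpx q\<^esub> bdry attached_cpx (q + 1) w)"
proof
  note modP = cpx_module[OF P]
  interpret E: right_module A "obj attached_cpx q" by (rule cpx_module[OF attached_complex])
  interpret PM: right_module A "poly_module (obj P q)" by (rule right_module_poly[OF modP])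
  interpret PM1: right_module A "poly_module (obj P (q - 1))" by (rule right_module_poly[OF modP])
  note \<theta> = lin_char_map[OF modP map_lin[OF \<tau>]]
  obtain x p r where exp: "e = (x, p, r)" and x: "x \<in> carrier (obj X q)" and p: "p \<in> carrier (poly_module (obj P q))"
    and r: "r \<in> carrier (poly_module (obj P (q - 1)))"
  proof -
    have "e \<in> carrier (obj X q) \<times> carrier (poly_module (obj P q)) \<times> carrier (poly_module (obj P (q - 1)))"
      using e stage_sub[of q q] unfolding attached_obj sum_module_simps by blast
    then show ?thesis using that by blast
  qed
  have d0: "poly_map (bdry P (q + 1)) \<zero>\<^bsub>poly_module (obj P (q + 1))\<^esub> = \<zero>\<^bsub>poly_module (obj P q)\<^esub>"
    using cpx_d_zero[OF poly_cpx_complex[OF P], of "q + 1"] by simp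
  {
    assume "stage_eval q e = \<zero>\<^bsub>obj P q\<^esub>"
    then obtain r' where r': "r' \<in> carrier (poly_module (obj P q))" and pr: "p = char_map A (obj P q) (\<tau> q) r'"
      using poly_eval_zeroD[OF modP map_lin[OF \<tau>] p] by (auto simp: exp)
    let ?w = "(\<zero>\<^bsub>obj X (q + 1)\<^esub>, \<zero>\<^bsub>poly_module (obj P (q + 1))\<^esub>, r')"
    have w: "?w \<in> stage_set q X P (q + 1)"
      using r' cpx_zero_closed[OF X] by (simp add: stage_set_def skeletal_polys_def)
    have r1: "r' \<in> carrier (poly_module (obj P (q + 1 - 1)))" using r' by simp
    let ?dw = "bdry attached_cpx (q + 1) ?w"
    have dw: "?dw \<in> carrier (obj attached_cpx q)"
      using cpx_closed'[OF attached_complex] w stage_sub by blast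
    have ec: "e \<in> carrier (obj attached_cpx q)" using e stage_sub by blast
    let ?n = "e \<ominus>\<^bsub>obj attached_cpx q\<^esub> ?dw"
    have dwp: "fst (snd ?dw) = p"
      using attached_bdry[OF r1, of "\<zero>\<^bsub>obj X (q + 1)\<^esub>" "\<zero>\<^bsub>poly_module (obj P (q + 1))\<^esub>"] d0
        lin_closed[OF \<theta> r'] pr by simp
    have "?n \<in> carrier (obj attached_cpx q)" by (rule E.M.minus_closed[OF ec dw])
    moreover have "fst (snd ?n) = \<zero>\<^bsub>poly_module (obj P q)\<^esub>"
    proof -
      have l: "(\<lambda>z. fst (snd z)) \<in> linear_maps A (obj attached_cpx q) (poly_module (obj P q))"
        unfolding attached_obj by (rule lin_on_snd[OF lin_fst])
      have "fst (snd ?n) = p \<ominus>\<^bsub>poly_module (obj P q)\<^esub> p"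
        using lin_diff[OF l cpx_module[OF attached_complex] right_module_poly[OF modP] ec dw] dwp by (simp add: exp)
      then show ?thesis using p by (simp add: PM.M.minus_eq PM.M.r_neg)
    qed
    moreover have "n \<in> stage_set (q - 1) X P q"
      if "n \<in> carrier (obj attached_cpx q)" "fst (snd n) = \<zero>\<^bsub>poly_module (obj P q)\<^esub>" for n
      using that unfolding attached_obj by (auto simp: stage_set_def skeletal_polys_def)
    ultimately have "?n \<in> stage_set (q - 1) X P q" by blast
    moreover have "e = ?n \<oplus>\<^bsub>obj attached_cpx q\<^esub> ?dw" using ec dw by algebra
    ultimately show "\<exists>n\<in>stage_set (q - 1) X P q. \<exists>w\<in>stage_set q X P (q + 1).
        e = n \<oplus>\<^bsub>obj attached_cpx q\<^esub> bdry attached_cpx (q + 1) w" using w by blast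
  }
  assume "\<exists>n\<in>stage_set (q - 1) X P q. \<exists>w\<in>stage_set q X P (q + 1).
      e = n \<oplus>\<^bsub>obj attached_cpx q\<^esub> bdry attached_cpx (q + 1) w"
  then obtain n w where n: "n \<in> stage_set (q - 1) X P q" and w: "w \<in> stage_set q X P (q + 1)"
    and eq: "e = n \<oplus>\<^bsub>obj attached_cpx q\<^esub> bdry attached_cpx (q + 1) w" by blast
  obtain x' r' where w': "w = (x', \<zero>\<^bsub>poly_module (obj P (q + 1))\<^esub>, r')" and r': "r' \<in> carrier (poly_module (obj P q))"
    using w by (auto simp: stage_set_def skeletal_polys_def)
  have r1: "r' \<in> carrier (poly_module (obj P (q + 1 - 1)))" using r' by simp
  obtain y s where n': "n = (y, \<zero>\<^bsub>poly_module (obj P q)\<^esub>, s)" using n by (auto simp: stage_set_def skeletal_polys_def)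
  have "fst (snd e) = char_map A (obj P q) (\<tau> q) r'"
    unfolding eq w' n' attached_bdry[OF r1] attached_obj using d0 lin_closed[OF \<theta> r'] by simp
  then show "stage_eval q e = \<zero>\<^bsub>obj P q\<^esub>"
    using poly_eval_char_map[OF modP map_lin[OF \<tau>] r'] by simp
qed

text \<open>
  The quotient of two stages lives in degrees \<open>q\<close> and \<open>q + 1\<close>, and in degree \<open>q + 1\<close> it has no cycles because
  multiplication by \<open>t - \<tau>\<close> is injective.
\<close>

lemma stage_other:
  assumes iq: "i \<noteq> q" and e: "e \<in> stage_set q X P i"
    and de: "bdry attached_cpx i e \<in> stage_set (q - 1) X P (i - 1)"
  shows "\<exists>n\<in>stage_set (q - 1) X P i. \<exists>w\<in>stage_set q X P (i + 1).
    e = n \<oplus>\<^bsub>obj attached_cpx i\<^esub> bdry attached_cpx (i + 1) w"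
proof -
  note modP = cpx_module[OF P]
  interpret E: right_module A "obj attached_cpx i" by (rule cpx_module[OF attached_complex])
  have "e \<in> stage_set (q - 1) X P i"
  proof (cases "i = q + 1")
    case True
    interpret PM: right_module A "poly_module (obj P q)" by (rule right_module_poly[OF modP])
    obtain x r where exp: "e = (x, \<zero>\<^bsub>poly_module (obj P i)\<^esub>, r)" and x: "x \<in> carrier (obj X i)"
      and r: "r \<in> carrier (poly_module (obj P (i - 1)))"
      using e True by (auto simp: stage_set_def skeletal_polys_def)
    have r0: "r \<in> carrier (poly_module (obj P q))" using r True by simp
    have c: "char_map A (obj P q) (\<tau> q) r \<in> carrier (poly_module (obj P q))"
      by (rule lin_closed[OF lin_char_map[OF modP map_lin[OF \<tau>]] r0])
    have "poly_map (bdry P i) \<zero>\<^bsub>poly_module (obj P i)\<^esub> = \<zero>\<^bsub>poly_module (obj P q)\<^esub>"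
      using cpx_d_zero[OF poly_cpx_complex[OF P], of i] True by simp
    then have "char_map A (obj P q) (\<tau> q) r = \<zero>\<^bsub>poly_module (obj P q)\<^esub>"
      using de unfolding exp attached_bdry[OF r] using True c by (simp add: stage_set_def skeletal_polys_def)
    then have "poly_const (obj P q) \<zero>\<^bsub>obj P q\<^esub> = char_map A (obj P q) (\<tau> q) r"
      using lin_zero[OF lin_poly_const[OF modP] modP right_module_poly[OF modP], of q] by simp
    then have "r = \<zero>\<^bsub>poly_module (obj P q)\<^esub>"
      using poly_division_unique(2)[OF modP map_lin[OF \<tau>] cpx_zero_closed[OF P] r0] by simp
    then show ?thesis using x True by (simp add: exp stage_set_def skeletal_polys_def)
  next
    case False
    then show ?thesis using e iq by (auto simp: stage_set_def skeletal_polys_def split: if_splits)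
  qed
  moreover have "\<zero>\<^bsub>obj attached_cpx (i + 1)\<^esub> \<in> stage_set q X P (i + 1)"
    using cpx_zero_closed[OF stage_complex[of q], of "i + 1"] by simp
  moreover have "e = e \<oplus>\<^bsub>obj attached_cpx i\<^esub> bdry attached_cpx (i + 1) \<zero>\<^bsub>obj attached_cpx (i + 1)\<^esub>"
  proof -
    have ec: "e \<in> carrier (obj attached_cpx i)" using e stage_sub by blast
    show ?thesis
      unfolding cpx_d_zero[OF attached_complex] add_diff_cancel_right' by (rule E.M.r_zero[OF ec, symmetric])
  qed
  ultimately show ?thesis by blast
qed

end

section \<open>Stages as complexes on a prescribed type\<close>

text \<open>
  All stages use one transport, that of the ambient complex \<open>C\<close>; so their operations agree on common elements.
\<close>

definition stage_cpx ::
  "(int \<Rightarrow> 'm \<Rightarrow> 'n) \<Rightarrow> (int \<Rightarrow> 'm \<Rightarrow> 'm) \<Rightarrow> ('a, 'm, 'c) cpx_scheme \<Rightarrow> (int \<Rightarrow> 'm set) \<Rightarrow> ('a, 'n) tcpx"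
  where "stage_cpx \<iota> t C S =
    \<lparr>obj = obj (subcpx (\<lambda>i. \<iota> i ` S i) (transport_cpx \<iota> C)), bdry = bdry (transport_cpx \<iota> C),
     tact = (\<lambda>i u. \<iota> i (t i (inv_into (carrier (obj C i)) (\<iota> i) u)))\<rparr>"

lemma stage_cpx_simps [simp]:
  "obj (stage_cpx \<iota> t C S) i = (obj (transport_cpx \<iota> C) i)\<lparr>carrier := \<iota> i ` S i\<rparr>"
  "bdry (stage_cpx \<iota> t C S) = bdry (transport_cpx \<iota> C)"
  "tact (stage_cpx \<iota> t C S) i u = \<iota> i (t i (inv_into (carrier (obj C i)) (\<iota> i) u))"
  by (simp_all add: stage_cpx_def)

context
  fixes A :: "('a, 'b) ring_scheme" and C :: "('a, 'm, 'c) cpx_scheme" and \<iota> :: "int \<Rightarrow> 'm \<Rightarrow> 'n"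
    and t :: "int \<Rightarrow> 'm \<Rightarrow> 'm"
  assumes C: "A_complex A C" and inj: "\<And>i. inj_on (\<iota> i) (carrier (obj C i))" and t: "A_map A t C C"
begin

context
  fixes S :: "int \<Rightarrow> 'm set"
  assumes S: "A_complex A (subcpx S C)" and sub: "\<And>i. S i \<subseteq> carrier (obj C i)"
    and tS: "\<And>i x. x \<in> S i \<Longrightarrow> t i x \<in> S i"
begin

lemma stage_inv: "x \<in> S i \<Longrightarrow> inv_into (carrier (obj C i)) (\<iota> i) (\<iota> i x) = x"
  using inv_into_f_f[OF inj] sub by blast

lemma stage_iota_lin: "\<iota> i \<in> linear_maps A ((obj C i)\<lparr>carrier := S i\<rparr>) (obj (transport_cpx \<iota> C) i)"
  by (rule lin_restrict_dom[OF transport_lin[OF C inj] sub])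

lemma stage_cpx_complex: "A_complex A (stage_cpx \<iota> t C S)"
proof -
  have "A_complex A (subcpx (\<lambda>i. \<iota> i ` S i) (transport_cpx \<iota> C))"
  proof (rule subcpx_complex[OF transport_complex[OF C inj]])
    fix i
    have "right_module A ((obj C i)\<lparr>carrier := S i\<rparr>)" using cpx_module[OF S, of i] by simp
    from submodule_image[OF stage_iota_lin this transport_mod[OF C inj]]
    show "submodule A (obj (transport_cpx \<iota> C) i) (\<iota> i ` S i)" by simp
    fix u assume "u \<in> \<iota> i ` S i"
    then obtain x where x: "x \<in> S i" "u = \<iota> i x" by blast
    have "bdry C i x \<in> S (i - 1)" using cpx_closed[OF S, of x i] x(1) by simp
    then show "bdry (transport_cpx \<iota> C) i u \<in> \<iota> (i - 1) ` S (i - 1)"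
      using transport_bdry[OF C inj, of x i] x sub by blast
  qed
  then show ?thesis by (simp add: A_complex_def)
qed

lemma stage_cpx_At: "At_complex A (stage_cpx \<iota> t C S)"
proof -
  let ?\<kappa> = "\<lambda>i. inv_into (carrier (obj C i)) (\<iota> i)"
  have m: "A_map A (\<lambda>i u. \<iota> i (t i (?\<kappa> i u))) (transport_cpx \<iota> C) (transport_cpx \<iota> C)"
    by (rule map_comp[OF map_comp[OF transport_inverse_map[OF C inj] t] transport_map[OF C inj]])
  have sub': "\<iota> i ` S i \<subseteq> carrier (obj (transport_cpx \<iota> C) i)" for i
    using sub by (auto simp: transport_carrier[OF C inj])
  have "tact (stage_cpx \<iota> t C S) i \<in> linear_maps A (obj (stage_cpx \<iota> t C S) i) (obj (stage_cpx \<iota> t C S) i)" for i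
  proof -
    have "(\<lambda>u. \<iota> i (t i (?\<kappa> i u))) \<in> linear_maps A
        ((obj (transport_cpx \<iota> C) i)\<lparr>carrier := \<iota> i ` S i\<rparr>) ((obj (transport_cpx \<iota> C) i)\<lparr>carrier := \<iota> i ` S i\<rparr>)"
      by (rule lin_restrict_cod[OF lin_restrict_dom[OF map_lin[OF m] sub']]) (auto simp: stage_inv tS)
    then show ?thesis by (simp add: stage_cpx_def)
  qed
  then have "A_map A (tact (stage_cpx \<iota> t C S)) (stage_cpx \<iota> t C S) (stage_cpx \<iota> t C S)"
    unfolding A_map_def
  proof (intro conjI allI ballI)
    fix i u assume "u \<in> carrier (obj (stage_cpx \<iota> t C S) i)"
    then have "u \<in> carrier (obj (transport_cpx \<iota> C) i)" using sub' by auto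
    from map_bdry[OF m this]
    show "tact (stage_cpx \<iota> t C S) (i - 1) (bdry (stage_cpx \<iota> t C S) i u)
        = bdry (stage_cpx \<iota> t C S) i (tact (stage_cpx \<iota> t C S) i u)" by simp
  qed
  then show ?thesis using stage_cpx_complex by (simp add: At_complex_def)
qed

lemma stage_cpx_iso:
  "A_map A \<iota> (subcpx S C) (stage_cpx \<iota> t C S)" "weak_equiv \<iota> (subcpx S C) (stage_cpx \<iota> t C S)"
proof -
  have "\<iota> i \<in> linear_maps A ((obj C i)\<lparr>carrier := S i\<rparr>) ((obj (transport_cpx \<iota> C) i)\<lparr>carrier := \<iota> i ` S i\<rparr>)" for i
    by (rule lin_restrict_cod[OF stage_iota_lin]) simp
  then show m: "A_map A \<iota> (subcpx S C) (stage_cpx \<iota> t C S)"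
    unfolding A_map_def
  proof (intro conjI allI ballI)
    fix i x assume "x \<in> carrier (obj (subcpx S C) i)"
    then have "x \<in> carrier (obj C i)" using sub by auto
    from transport_bdry[OF C inj this]
    show "\<iota> (i - 1) (bdry (subcpx S C) i x) = bdry (stage_cpx \<iota> t C S) i (\<iota> i x)" by simp
  qed simp
  show "weak_equiv \<iota> (subcpx S C) (stage_cpx \<iota> t C S)"
    by (rule weak_equiv_bij[OF S stage_cpx_complex m]) (use inj_on_subset[OF inj sub] in \<open>simp add: bij_betw_def\<close>)
qed

lemma stage_cpx_resolved:
  assumes R: "projectively_resolved A R (subcpx S C)"
  shows "projectively_resolved A R (stage_cpx \<iota> t C S)"
proof -
  obtain f where sR: "strictly_perfect A R" and f: "A_map A f R (subcpx S C)" "weak_equiv f R (subcpx S C)"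
    using R unfolding projectively_resolved_def by blast
  have "A_complex A R" using sR by (simp add: strictly_perfect_def)
  then show ?thesis
    using sR map_comp[OF f(1) stage_cpx_iso(1)] weak_equiv_comp[OF _ S stage_cpx_complex f stage_cpx_iso]
    unfolding projectively_resolved_def by blast
qed

lemma stage_filtration_step:
  fixes D :: "('a, 'k) tcpx"
  assumes D: "At_complex A D" and f: "At_map A f D (stage_cpx \<iota> t C S)"
    and finj: "\<And>i. inj_on (f i) (carrier (obj D i))"
    and im: "\<And>i. f i ` carrier (obj D i) = \<iota> i ` S' i" and S': "\<And>i. S' i \<subseteq> S i"
    and M: "right_module A M" and fgp: "fg_projective A M" and \<pi>: "\<pi> \<in> linear_maps A (obj C q) M"
    and surj: "\<And>y. y \<in> carrier M \<Longrightarrow> \<exists>z\<in>S q. bdry C q z \<in> S' (q - 1) \<and> \<pi> z = y"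
    and ker: "\<And>z. z \<in> S q \<Longrightarrow> \<pi> z = \<zero>\<^bsub>M\<^esub> \<longleftrightarrow> (\<exists>n\<in>S' q. \<exists>w\<in>S (q + 1). z = n \<oplus>\<^bsub>obj C q\<^esub> bdry C (q + 1) w)"
    and other: "\<And>i z. \<lbrakk>i \<noteq> q; z \<in> S i; bdry C i z \<in> S' (i - 1)\<rbrakk> \<Longrightarrow>
      \<exists>n\<in>S' i. \<exists>w\<in>S (i + 1). z = n \<oplus>\<^bsub>obj C i\<^esub> bdry C (i + 1) w"
  shows "filtration_step A q f D (stage_cpx \<iota> t C S)"
proof -
  let ?Z = "stage_cpx \<iota> t C S" and ?\<kappa> = "\<lambda>i. inv_into (carrier (obj C i)) (\<iota> i)"
  have Dc: "A_complex A D" and fm: "A_map A f D ?Z" using D f by (auto simp: At_complex_def At_map_def)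
  have Sc: "z \<in> carrier (obj C i)" if "z \<in> S i" for z i using that sub by blast
  have dS: "bdry C i z \<in> S (i - 1)" if "z \<in> S i" for z i using cpx_closed[OF S, of z i] that by simp
  have dS': "bdry C (i + 1) z \<in> S i" if "z \<in> S (i + 1)" for z i using dS[OF that] by simp
  have d: "bdry ?Z i (\<iota> i z) = \<iota> (i - 1) (bdry C i z)" if "z \<in> S i" for z i
    using transport_bdry[OF C inj Sc[OF that]] by simp
  have dim: "bdry ?Z i (\<iota> i z) \<in> \<iota> (i - 1) ` S' (i - 1) \<longleftrightarrow> bdry C i z \<in> S' (i - 1)" if "z \<in> S i" for z i
    unfolding d[OF that] using inj_on_image_mem_iff[OF inj[of "i - 1"] Sc[OF dS[OF that]], of "S' (i - 1)"] S'[of "i - 1"] sub[of "i - 1"]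
    by blast
  have add: "\<iota> i (n \<oplus>\<^bsub>obj C i\<^esub> bdry C (i + 1) w) = \<iota> i n \<oplus>\<^bsub>obj ?Z i\<^esub> bdry ?Z (i + 1) (\<iota> (i + 1) w)"
    if "n \<in> S i" "w \<in> S (i + 1)" for n w i
    using lin_add[OF transport_lin[OF C inj] Sc[OF that(1)] Sc[OF dS'[OF that(2)]]] d[OF that(2)] by simp
  have sum: "(\<exists>n\<in>\<iota> i ` S' i. \<exists>w\<in>\<iota> (i + 1) ` S (i + 1). \<iota> i z = n \<oplus>\<^bsub>obj ?Z i\<^esub> bdry ?Z (i + 1) w)
      \<longleftrightarrow> (\<exists>n\<in>S' i. \<exists>w\<in>S (i + 1). z = n \<oplus>\<^bsub>obj C i\<^esub> bdry C (i + 1) w)" if z: "z \<in> S i" for z i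
  proof
    assume "\<exists>n\<in>\<iota> i ` S' i. \<exists>w\<in>\<iota> (i + 1) ` S (i + 1). \<iota> i z = n \<oplus>\<^bsub>obj ?Z i\<^esub> bdry ?Z (i + 1) w"
    then obtain n w where n: "n \<in> S' i" "w \<in> S (i + 1)" "\<iota> i z = \<iota> i n \<oplus>\<^bsub>obj ?Z i\<^esub> bdry ?Z (i + 1) (\<iota> (i + 1) w)"
      by blast
    have nS: "n \<in> S i" using n(1) S' by blast
    have "n \<oplus>\<^bsub>obj C i\<^esub> bdry C (i + 1) w \<in> carrier (obj C i)"
      by (rule cpx_add_closed[OF C Sc[OF nS] Sc[OF dS'[OF n(2)]]])
    then have "z = n \<oplus>\<^bsub>obj C i\<^esub> bdry C (i + 1) w"
      using n(3) add[OF nS n(2)] inj_onD[OF inj] Sc[OF z] by metis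
    then show "\<exists>n\<in>S' i. \<exists>w\<in>S (i + 1). z = n \<oplus>\<^bsub>obj C i\<^esub> bdry C (i + 1) w" using n by blast
  next
    assume "\<exists>n\<in>S' i. \<exists>w\<in>S (i + 1). z = n \<oplus>\<^bsub>obj C i\<^esub> bdry C (i + 1) w"
    then obtain n w where n: "n \<in> S' i" "w \<in> S (i + 1)" "z = n \<oplus>\<^bsub>obj C i\<^esub> bdry C (i + 1) w" by blast
    have "n \<in> S i" using n(1) S' by blast
    from add[OF this n(2)] n
    show "\<exists>n\<in>\<iota> i ` S' i. \<exists>w\<in>\<iota> (i + 1) ` S (i + 1). \<iota> i z = n \<oplus>\<^bsub>obj ?Z i\<^esub> bdry ?Z (i + 1) w" by blast
  qed
  have carr: "carrier (obj ?Z i) = \<iota> i ` S i" for i by simp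
  have "fg_projective_homology_in_degree A q (quotient_complex f D ?Z)"
  proof (rule quotient_complex_homology[OF Dc stage_cpx_complex fm M fgp, where \<pi> = "\<lambda>u. \<pi> (?\<kappa> q u)"], unfold im carr)
    have "\<iota> q ` S q \<subseteq> carrier (obj (transport_cpx \<iota> C) q)" using sub by (auto simp: transport_carrier[OF C inj])
    from lin_restrict_dom[OF lin_comp[OF transport_inverse_lin[OF C inj] \<pi>] this]
    show "(\<lambda>u. \<pi> (?\<kappa> q u)) \<in> linear_maps A (obj ?Z q) M" by simp
    fix y assume "y \<in> carrier M"
    then obtain z where z: "z \<in> S q" "bdry C q z \<in> S' (q - 1)" "\<pi> z = y" using surj by blast
    then show "\<exists>u\<in>\<iota> q ` S q. bdry ?Z q u \<in> \<iota> (q - 1) ` S' (q - 1) \<and> \<pi> (?\<kappa> q u) = y"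
      using dim[OF z(1)] stage_inv[OF z(1)] by (intro bexI[of _ "\<iota> q z"]) auto
  next
    fix u assume "u \<in> \<iota> q ` S q"
    then obtain z where z: "z \<in> S q" "u = \<iota> q z" by blast
    show "\<pi> (?\<kappa> q u) = \<zero>\<^bsub>M\<^esub> \<longleftrightarrow>
        (\<exists>n\<in>\<iota> q ` S' q. \<exists>w\<in>\<iota> (q + 1) ` S (q + 1). u = n \<oplus>\<^bsub>obj ?Z q\<^esub> bdry ?Z (q + 1) w)"
      unfolding z(2) sum[OF z(1)] stage_inv[OF z(1)] by (rule ker[OF z(1)])
  next
    fix i u assume i: "i \<noteq> q" and "u \<in> \<iota> i ` S i" and du: "bdry ?Z i u \<in> \<iota> (i - 1) ` S' (i - 1)"
    then obtain z where z: "z \<in> S i" "u = \<iota> i z" by blast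
    have "bdry C i z \<in> S' (i - 1)" using du dim[OF z(1)] unfolding z(2) by blast
    then show "\<exists>n\<in>\<iota> i ` S' i. \<exists>w\<in>\<iota> (i + 1) ` S (i + 1). u = n \<oplus>\<^bsub>obj ?Z i\<^esub> bdry ?Z (i + 1) w"
      unfolding z(2) sum[OF z(1)] by (rule other[OF i z(1)])
  qed
  then show ?thesis using f finj by (simp add: filtration_step_def)
qed

end

end



section \<open>The factorization\<close>

text \<open>
  Two double sequences, such as the coefficients of two polynomials over modules embedded in sequences, are stored
  in a single sequence, one at the even and one at the odd positions.
\<close>

definition interleave :: "(nat \<Rightarrow> nat \<Rightarrow> 'a) \<Rightarrow> (nat \<Rightarrow> nat \<Rightarrow> 'a) \<Rightarrow> nat \<Rightarrow> 'a"
  where "interleave a b l =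
    (if even l then a (fst (prod_decode (l div 2))) (snd (prod_decode (l div 2)))
     else b (fst (prod_decode (l div 2))) (snd (prod_decode (l div 2))))"

lemma interleave_inject:
  assumes eq: "interleave a b = interleave a' b'" shows "a = a'" "b = b'"
proof -
  have "a k j = a' k j" for k j
    using fun_cong[OF eq, of "2 * prod_encode (k, j)"] by (simp add: interleave_def)
  then show "a = a'" by blast
  have "b k j = b' k j" for k j
    using fun_cong[OF eq, of "2 * prod_encode (k, j) + 1"] by (simp add: interleave_def)
  then show "b = b'" by blast
qed

lemma poly_zero_module:
  assumes "zero_module M" shows "carrier (poly_module M) = {\<zero>\<^bsub>poly_module M\<^esub>}"
  using assms by (auto simp: poly_carrier poly_module_simps zero_module_def)

lemma attached_embedding:
  fixes A :: "('a, 'b) ring_scheme" and X :: "('a, 'x, 'c) cpx_scheme" and P :: "('a, 'p) cpx"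
  assumes P: "A_complex A P" and proj: "\<And>i. fg_projective A (obj P i)" and \<tau>: "A_map A \<tau> P P"
  obtains \<iota> :: "int \<Rightarrow> 'x \<times> (nat \<Rightarrow> 'p) \<times> (nat \<Rightarrow> 'p) \<Rightarrow> ('a, 'x) attached"
  where "\<And>i. inj_on (\<iota> i) (carrier (obj (twisted v (telescope A \<tau> P) X) i))"
proof -
  have "\<forall>i. \<exists>s :: 'p \<Rightarrow> nat \<Rightarrow> 'a. inj_on s (carrier (obj P i))"
    using fg_projective_embedding[OF cpx_module[OF P] proj] by blast
  then obtain s :: "int \<Rightarrow> 'p \<Rightarrow> nat \<Rightarrow> 'a" where s: "\<And>i. inj_on (s i) (carrier (obj P i))" by metis
  have sp: "p = p'"
    if "p \<in> carrier (poly_module (obj P i))" "p' \<in> carrier (poly_module (obj P i))" "(\<lambda>k. s i (p k)) = (\<lambda>k. s i (p' k))"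
    for p p' i
    using inj_onD[OF s fun_cong[OF that(3)] poly_coeff[OF that(1)] poly_coeff[OF that(2)]] by (simp add: fun_eq_iff)
  define \<iota> where "\<iota> i = (\<lambda>(x :: 'x, p, r). (x, interleave (\<lambda>k. s i (p k)) (\<lambda>k. s (i - 1) (r k))))" for i
  have "inj_on (\<iota> i) (carrier (obj (twisted v (telescope A \<tau> P) X) i))" for i
  proof (rule inj_onI)
    fix e e' assume "e \<in> carrier (obj (twisted v (telescope A \<tau> P) X) i)" "e' \<in> carrier (obj (twisted v (telescope A \<tau> P) X) i)"
      and eq: "\<iota> i e = \<iota> i e'"
    then obtain x p r x' p' r' where e: "e = (x, p, r)" "e' = (x', p', r')"
      and p: "p \<in> carrier (poly_module (obj P i))" "p' \<in> carrier (poly_module (obj P i))"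
      and r: "r \<in> carrier (poly_module (obj P (i - 1)))" "r' \<in> carrier (poly_module (obj P (i - 1)))"
      by (auto simp: telescope_obj[OF P \<tau>])
    have xx: "x = x'" and i: "interleave (\<lambda>k. s i (p k)) (\<lambda>k. s (i - 1) (r k)) = interleave (\<lambda>k. s i (p' k)) (\<lambda>k. s (i - 1) (r' k))"
      using eq by (auto simp: \<iota>_def e)
    show "e = e'" unfolding e xx using sp[OF p interleave_inject(1)[OF i]] sp[OF r interleave_inject(2)[OF i]] by simp
  qed
  then show ?thesis by (rule that)
qed

lemma attached_filtration_step:
  fixes X :: "('a, 'x, 'c) cpx_scheme" and P :: "('a, 'p) cpx" and D :: "('a, 'k) tcpx"
  assumes X: "A_complex A X" and P: "A_complex A P" and proj: "\<And>i. fg_projective A (obj P i)"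
    and \<tau>: "A_map A \<tau> P P" and v: "twisting A v (telescope A \<tau> P) X"
    and inj: "\<And>i. inj_on (\<iota> i) (carrier (obj (twisted v (telescope A \<tau> P) X) i))"
    and t: "A_map A t (twisted v (telescope A \<tau> P) X) (twisted v (telescope A \<tau> P) X)"
    and tS: "\<forall>i q. \<forall>e\<in>stage_set q X P i. t i e \<in> stage_set q X P i"
    and D: "At_complex A D"
    and k: "At_map A k D (stage_cpx \<iota> t (twisted v (telescope A \<tau> P) X) (stage_set q X P))"
    and kinj: "\<And>i. inj_on (k i) (carrier (obj D i))"
    and im: "\<And>i. k i ` carrier (obj D i) = \<iota> i ` stage_set (q - 1) X P i"
  shows "filtration_step A q k D (stage_cpx \<iota> t (twisted v (telescope A \<tau> P) X) (stage_set q X P))"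
proof -
  have \<pi>: "(\<lambda>e. poly_extend (obj P q) (obj P q) (\<lambda>x. x) (\<tau> q) (fst (snd e)))
      \<in> linear_maps A (obj (twisted v (telescope A \<tau> P) X) q) (obj P q)"
    unfolding attached_obj[OF X P \<tau> v]
    by (rule lin_comp[OF lin_on_snd[OF lin_fst] lin_poly_eval[OF cpx_module[OF P] map_lin[OF \<tau>]]])
  show ?thesis
  proof (rule stage_filtration_step[OF attached_complex[OF X P \<tau> v] inj t stage_complex[OF X P \<tau> v]
        stage_sub[OF X P \<tau> v] _ D k kinj im _ cpx_module[OF P] proj \<pi>])
    show "stage_set (q - 1) X P i \<subseteq> stage_set q X P i" for i by (rule stage_mono[OF X P \<tau> v]) simp
    show "t i e \<in> stage_set q X P i" if "e \<in> stage_set q X P i" for i e using tS that by blast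
  qed (fact stage_surj[OF X P \<tau> v] stage_kernel[OF X P \<tau> v] stage_other[OF X P \<tau> v])+
qed

lemma shifted_resolved:
  assumes X: "A_complex A X" and P: "projectively_resolved A P X"
  shows "projectively_resolved A (shifted A P) (shifted A X)"
proof -
  obtain f where sP: "strictly_perfect A P" and f: "A_map A f P X" "weak_equiv f P X"
    using P unfolding projectively_resolved_def by blast
  have Pc: "A_complex A P" using sP by (simp add: strictly_perfect_def)
  show ?thesis unfolding projectively_resolved_def
    using shifted_strictly_perfect[OF sP] shifted_map[OF Pc X f(1)] shifted_weak_equiv[OF Pc X f] by blast
qed

theorem propositionC7:
  fixes A :: "('a, 'b) ring_scheme"
    and X :: "('a, 'x) tcpx" and Y :: "('a, 'y) tcpx"
    and \<phi> :: "int \<Rightarrow> 'x \<Rightarrow> 'y" and m :: int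
  assumes "ring A"
    and "At_complex A X" and "A_perfect TYPE('z) A X"
    and "At_complex A Y" and "A_perfect TYPE('w) A Y"
    and "At_map A \<phi> X Y" and "connected_map m \<phi> X Y"
  shows "\<exists>(n :: int) (Z :: int \<Rightarrow> ('a, ('a, 'x) attached) tcpx)
      (j :: int \<Rightarrow> 'x \<Rightarrow> ('a, 'x) attached)
      (k :: int \<Rightarrow> int \<Rightarrow> ('a, 'x) attached \<Rightarrow> ('a, 'x) attached)
      (\<psi> :: int \<Rightarrow> ('a, 'x) attached \<Rightarrow> 'y).
      m < n
      \<and> (\<forall>q. m < q \<and> q \<le> n \<longrightarrow> At_complex A (Z q))
      \<and> filtration_step A (m + 1) j X (Z (m + 1))
      \<and> (\<forall>q. m + 1 < q \<and> q \<le> n \<longrightarrow> filtration_step A q (k q) (Z (q - 1)) (Z q))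
      \<and> At_map A \<psi> (Z n) Y \<and> quasi_iso A \<psi> (Z n) Y
      \<and> (\<forall>i. \<forall>x\<in>carrier (obj X i).
            \<psi> i (fold (\<lambda>q. k q i) [m + 2..n] (j i x)) = \<phi> i x)
      \<and> (\<forall>q. m < q \<and> q \<le> n \<longrightarrow> A_perfect TYPE(('a, 'x) attached) A (Z q))"
proof -
  have X: "A_complex A X" and tX: "A_map A (tact X) X X" and Y: "A_complex A Y" and tY: "A_map A (tact Y) Y Y"
    using assms by (auto simp: At_complex_def)
  have \<phi>: "A_map A \<phi> X Y" and t\<phi>: "\<And>i x. x \<in> carrier (obj X i) \<Longrightarrow> \<phi> i (tact X i x) = tact Y i (\<phi> i x)"
    using assms by (auto simp: At_map_def)
  let ?C = "cone A \<phi> X Y"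
  have C: "A_complex A ?C" by (rule cone_complex[OF X Y \<phi>])
  define tC where "tC i z = (tact Y i (fst z), tact X (i - 1) (snd z))" for i z
  have tC: "A_map A tC ?C ?C"
    unfolding cone_def tC_def[abs_def]
    by (rule twisted_map_strict[OF Y shifted_complex[OF X] twisting_of_map[OF X Y \<phi>] tY shifted_map[OF X X tX]])
       (simp add: t\<phi>)
  obtain PX :: "('a, 'z) cpx" and PY :: "('a, 'w) cpx"
    where PX: "projectively_resolved A PX X" and PY: "projectively_resolved A PY Y"
    using A_perfect_resolved[OF assms(3)] A_perfect_resolved[OF assms(5)] by blast
  obtain PC :: "('a, 'w \<times> 'z) cpx" where PC: "projectively_resolved A PC ?C"
    using twisted_resolved[OF Y shifted_complex[OF X] twisting_of_map[OF X Y \<phi>] PY shifted_resolved[OF X PX]]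
    unfolding cone_def by blast
  have "cycles ?C i \<subseteq> boundaries ?C i" if "i \<le> m" for i
    using assms(7) that unfolding connected_map_def homology_mapping_cone[OF X Y] zero_homology_iff[OF C] by blast
  then obtain P :: "('a, 'w \<times> 'z) cpx" where rP: "projectively_resolved A P ?C"
    and low: "\<And>i. i \<le> m \<Longrightarrow> zero_module (obj P i)"
    using truncated_resolution[OF PC C] by metis
  obtain f where sP: "strictly_perfect A P" and f: "A_map A f P ?C" "weak_equiv f P ?C"
    using rP unfolding projectively_resolved_def by blast
  have P: "A_complex A P" and proj: "\<And>i. fg_projective A (obj P i)" using sP by (auto simp: strictly_perfect_def)
  obtain d where d: "\<And>i. i > d \<Longrightarrow> zero_module (obj P i)" using sP by (auto simp: strictly_perfect_def)
  \<comment> \<open>\<open>t\<close> acts on \<open>P\<close> only up to homotopy.\<close>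
  obtain \<tau> h where \<tau>: "A_map A \<tau> P P" and h: "\<And>i. h i \<in> linear_maps A (obj P i) (obj ?C (i + 1))"
    and htpy: "\<And>i z. z \<in> carrier (obj P i) \<Longrightarrow>
      f i (\<tau> i z) \<oplus>\<^bsub>obj ?C i\<^esub> h (i - 1) (bdry P i z) \<oplus>\<^bsub>obj ?C i\<^esub> bdry ?C (i + 1) (h i z) = tC i (f i z)"
    using lift_through_weak_equiv[OF P P C proj f map_comp[OF f(1) tC]] by blast
  let ?T = "telescope A \<tau> P"
  have T: "A_complex A ?T" by (rule telescope_complex[OF P \<tau>])
  define g where "g = telescope_map P ?C f h tC"
  have g: "A_map A g ?T ?C" unfolding g_def by (rule telescope_map_chain[OF P \<tau> C f(1) tC h htpy])
  have gw: "weak_equiv g ?T ?C" unfolding g_def by (rule telescope_map_weak_equiv[OF P \<tau> C f(1) tC h htpy f(2)])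
  have gt: "g i (telescope_shift P i z) = tC i (g i z)" if "z \<in> carrier (obj ?T i)" for i z
    unfolding g_def by (rule telescope_map_shift[OF P \<tau> C f(1) tC h htpy that])
  define v where "v i z = snd (g i z) \<triangleleft>\<^bsub>obj X (i - 1)\<^esub> (\<ominus>\<^bsub>A\<^esub> \<one>\<^bsub>A\<^esub>)" for i z
  have v: "twisting A v ?T X" unfolding v_def[abs_def] by (rule attach_twisting[OF X Y T \<phi> g])
  let ?E = "twisted v ?T X"
  have E: "A_complex A ?E" by (rule twisted_complex[OF X T v])
  define \<psi>E where "\<psi>E i e = \<phi> i (fst e) \<oplus>\<^bsub>obj Y i\<^esub> fst (g i (snd e))" for i e
  have \<psi>E: "A_map A \<psi>E ?E Y" unfolding \<psi>E_def[abs_def] v_def[abs_def] by (rule attach_map_chain[OF X Y T \<phi> g])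
  have \<psi>Ew: "weak_equiv \<psi>E ?E Y"
    unfolding \<psi>E_def[abs_def] v_def[abs_def] by (rule attach_map_weak_equiv[OF X Y T \<phi> g gw])
  define tE where "tE i e = (tact X i (fst e), telescope_shift P i (snd e))" for i e
  have tE: "A_map A tE ?E ?E"
    unfolding tE_def[abs_def]
  proof (rule twisted_map_strict[OF X T v tX telescope_shift_map[OF P \<tau>]])
    fix i z assume z: "z \<in> carrier (obj ?T i)"
    interpret A: ring A by fact
    have "\<ominus>\<^bsub>A\<^esub> \<one>\<^bsub>A\<^esub> \<in> carrier A" by simp
    then show "tact X (i - 1) (v i z) = v i (telescope_shift P i z)"
      unfolding v_def gt[OF z] using lin_smult[OF map_lin[OF tX] cone_map_components(2)[OF X Y T \<phi> g z]] by (simp add: tC_def)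
  qed
  obtain \<iota> :: "int \<Rightarrow> 'x \<times> (nat \<Rightarrow> 'w \<times> 'z) \<times> (nat \<Rightarrow> 'w \<times> 'z) \<Rightarrow> ('a, 'x) attached"
    where inj: "\<And>i. inj_on (\<iota> i) (carrier (obj ?E i))"
    using attached_embedding[OF P proj \<tau>] by blast
  let ?\<kappa> = "\<lambda>i. inv_into (carrier (obj ?E i)) (\<iota> i)"
  let ?S = "\<lambda>q. stage_set q X P"
  note S = stage_complex[OF X P \<tau> v] and sub = stage_sub[OF X P \<tau> v]
  have tS: "tE i e \<in> ?S q i" if "e \<in> ?S q i" for i e q
  proof -
    have "poly_shift (obj P i) p \<in> skeletal_polys q P i" if p: "p \<in> skeletal_polys q P i" for p i
      using p poly_shift_closed[OF cpx_module[OF P], of p i]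
        lin_zero[OF lin_poly_shift[OF cpx_module[OF P]] right_module_poly[OF cpx_module[OF P]] right_module_poly[OF cpx_module[OF P]], of i]
      by (auto simp: skeletal_polys_def split: if_splits)
    then show ?thesis using that map_closed[OF tX] by (auto simp: stage_set_def tE_def telescope_shift_def)
  qed
  define Z where "Z q = stage_cpx \<iota> tE ?E (?S q)" for q
  have ZAt: "At_complex A (Z q)" for q
    unfolding Z_def by (rule stage_cpx_At[OF E inj tE S sub tS])
  have ZA: "A_complex A (Z q)" for q using ZAt by (simp add: At_complex_def)
  have perf: "A_perfect TYPE(('a, 'x) attached) A (Z q)" for q
  proof -
    obtain R :: "('a, 'z \<times> 'w \<times> 'z) cpx" where "projectively_resolved A R (subcpx (?S q) ?E)"
      using stage_resolved[OF X P \<tau> v proj PX] by blast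
    from stage_cpx_resolved[OF E inj tE S sub tS this] show ?thesis
      unfolding Z_def[symmetric] by (rule A_perfectI[OF ZA])
  qed
  have tS': "\<forall>i q. \<forall>e\<in>?S q i. tE i e \<in> ?S q i" using tS by blast
  note step = attached_filtration_step[OF X P proj \<tau> v inj tE tS', folded Z_def]
  \<comment> \<open>Above degree \<open>d\<close> the skeleta no longer grow, so the last stage is the whole attached complex.\<close>
  define n where "n = max (m + 1) d"
  define j where "j i x = \<iota> i (x, \<zero>\<^bsub>obj ?T i\<^esub>)" for i x
  define \<psi> where "\<psi> i u = \<psi>E i (?\<kappa> i u)" for i u
  have jS: "(x, \<zero>\<^bsub>obj ?T i\<^esub>) \<in> ?S m i" if "x \<in> carrier (obj X i)" for i x
    using that skeletal_polys_zero[OF P] by (simp add: stage_set_def telescope_obj[OF P \<tau>])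
  have jE: "(x, \<zero>\<^bsub>obj ?T i\<^esub>) \<in> carrier (obj ?E i)" if "x \<in> carrier (obj X i)" for i x
    using jS[OF that] sub by blast
  have skel_low: "skeletal_polys m P i = {\<zero>\<^bsub>poly_module (obj P i)\<^esub>}" for i
    using poly_zero_module[OF low, of i] by (simp add: skeletal_polys_def)
  \<comment> \<open>\<open>P\<close> vanishes up to degree \<open>m\<close>, so stage \<open>m\<close> is \<open>X\<close> itself.\<close>
  have first: "filtration_step A (m + 1) j X (Z (m + 1))"
  proof (rule step[OF assms(2)])
    have jm: "A_map A (\<lambda>i x. (x, \<zero>\<^bsub>obj ?T i\<^esub>)) X ?E"
      unfolding A_map_def
    proof (intro conjI allI ballI)
      fix i
      show "(\<lambda>x. (x, \<zero>\<^bsub>obj ?T i\<^esub>)) \<in> linear_maps A (obj X i) (obj ?E i)"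
        unfolding twisted_simps by (rule lin_pair[OF lin_id lin_const_zero[OF cpx_module[OF T]]])
      fix x assume x: "x \<in> carrier (obj X i)"
      interpret right_module A "obj X (i - 1)" by (rule cpx_module[OF X])
      show "(bdry X i x, \<zero>\<^bsub>obj ?T (i - 1)\<^esub>) = bdry ?E i (x, \<zero>\<^bsub>obj ?T i\<^esub>)"
        using lin_zero[OF twisting_lin[OF v] cpx_module[OF T] cpx_module[OF X]] cpx_closed[OF X x]
        by (simp add: cpx_d_zero[OF T])
    qed
    have jm': "A_map A j X (transport_cpx \<iota> ?E)"
      unfolding j_def[abs_def] by (rule map_comp[OF jm transport_map[OF E inj]])
    have jS': "j i x \<in> \<iota> i ` ?S (m + 1) i" if "x \<in> carrier (obj X i)" for i x
      unfolding j_def using jS[OF that] stage_mono[OF X P \<tau> v, of m "m + 1" i] by (intro imageI) auto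
    have lin: "j i \<in> linear_maps A (obj X i) (obj (Z (m + 1)) i)" for i
      unfolding Z_def stage_cpx_simps
      by (rule lin_restrict_cod[OF map_lin[OF jm'] jS'])
    have "j i (tact X i x) = tact (Z (m + 1)) i (j i x)" if x: "x \<in> carrier (obj X i)" for i x
    proof -
      have "telescope_shift P i \<zero>\<^bsub>obj ?T i\<^esub> = \<zero>\<^bsub>obj ?T i\<^esub>"
        by (rule lin_zero[OF map_lin[OF telescope_shift_map[OF P \<tau>]] cpx_module[OF T] cpx_module[OF T]])
      then show ?thesis using inv_into_f_f[OF inj jE[OF x]] by (simp add: j_def Z_def tE_def)
    qed
    then show "At_map A j X (Z (m + 1))"
      using lin map_bdry[OF jm'] by (simp add: At_map_def A_map_def Z_def)
    show "inj_on (j i) (carrier (obj X i))" for i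
      using inj_onD[OF inj _ jE jE] unfolding j_def by (intro inj_onI) blast
    show "j i ` carrier (obj X i) = \<iota> i ` ?S (m + 1 - 1) i" for i
    proof -
      have "?S m i = (\<lambda>x. (x, \<zero>\<^bsub>obj ?T i\<^esub>)) ` carrier (obj X i)"
        by (auto simp: stage_set_def skel_low telescope_obj[OF P \<tau>])
      then show ?thesis by (simp add: j_def image_image)
    qed
  qed
  have later: "filtration_step A q (\<lambda>i u. u) (Z (q - 1)) (Z q)" for q
  proof (rule step[OF ZAt])
    have "(\<lambda>u. u) \<in> linear_maps A (obj (Z (q - 1)) i) (obj (Z q) i)" for i
      using stage_mono[OF X P \<tau> v, of "q - 1" q i] by (auto simp: linear_maps_def Z_def)
    then show "At_map A (\<lambda>i u. u) (Z (q - 1)) (Z q)" by (simp add: At_map_def A_map_def Z_def)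
  qed (auto simp: Z_def)
  have top: "obj (Z n) = obj (transport_cpx \<iota> ?E)"
  proof
    fix i
    have "skeletal_polys n P i = carrier (poly_module (obj P i))" for i
      using poly_zero_module[OF d, of i] by (auto simp: skeletal_polys_def n_def)
    then have "?S n i = carrier (obj ?E i)"
      by (simp add: stage_set_def telescope_obj[OF P \<tau>])
    then have "\<iota> i ` ?S n i = carrier (obj (transport_cpx \<iota> ?E) i)" by (simp only: transport_carrier[OF E inj])
    then show "obj (Z n) i = obj (transport_cpx \<iota> ?E) i" by (simp add: Z_def)
  qed
  have \<psi>m: "A_map A \<psi> (transport_cpx \<iota> ?E) Y"
    unfolding \<psi>_def[abs_def] by (rule map_comp[OF transport_inverse_map[OF E inj] \<psi>E])
  have "weak_equiv \<psi> (transport_cpx \<iota> ?E) Y"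
    unfolding \<psi>_def[abs_def]
    by (rule weak_equiv_comp[OF transport_complex[OF E inj] E Y transport_inverse_map[OF E inj]
          transport_inverse_weak_equiv[OF E inj] \<psi>E \<psi>Ew])
  then have \<psi>w: "weak_equiv \<psi> (Z n) Y" by (simp add: weak_equiv_def top) (simp add: Z_def)
  have \<psi>Z: "A_map A \<psi> (Z n) Y" using \<psi>m by (simp add: A_map_def top) (simp add: Z_def)
  have "\<psi> i (tact (Z n) i u) = tact Y i (\<psi> i u)" if u: "u \<in> carrier (obj (Z n) i)" for i u
  proof -
    obtain x z where xz: "(x, z) \<in> carrier (obj ?E i)" "u = \<iota> i (x, z)"
      using u unfolding top transport_carrier[OF E inj] by auto
    then have x: "x \<in> carrier (obj X i)" and z: "z \<in> carrier (obj ?T i)" by auto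
    have "tE i (x, z) \<in> carrier (obj ?E i)" by (rule map_closed[OF tE xz(1)])
    then have "\<psi> i (tact (Z n) i u) = \<psi>E i (tE i (x, z))"
      using inv_into_f_f[OF inj xz(1)] inv_into_f_f[OF inj] by (simp add: \<psi>_def Z_def xz(2))
    also have "\<dots> = tact Y i (\<psi>E i (x, z))"
      using gt[OF z] t\<phi>[OF x] lin_add[OF map_lin[OF tY] map_closed[OF \<phi> x] cone_map_components(1)[OF X Y T \<phi> g z]]
      by (simp add: \<psi>E_def tE_def tC_def)
    also have "\<dots> = tact Y i (\<psi> i u)" using inv_into_f_f[OF inj xz(1)] by (simp add: \<psi>_def xz(2))
    finally show ?thesis .
  qed
  then have \<psi>At: "At_map A \<psi> (Z n) Y" using \<psi>Z by (simp add: At_map_def)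
  have qi: "quasi_iso A \<psi> (Z n) Y" using quasi_iso_iff_weak_equiv[OF ZA Y \<psi>Z] \<psi>w by blast
  have "\<psi> i (fold (\<lambda>q u. u) [m + 2..n] (j i x)) = \<phi> i x" if x: "x \<in> carrier (obj X i)" for i x
  proof -
    interpret right_module A "obj Y i" by (rule cpx_module[OF Y])
    have "fold (\<lambda>q u. u) xs y = y" for xs :: "int list" and y :: "('a, 'x) attached" by (induction xs) auto
    moreover have "g i \<zero>\<^bsub>obj ?T i\<^esub> = \<zero>\<^bsub>obj ?C i\<^esub>"
      by (rule lin_zero[OF map_lin[OF g] cpx_module[OF T] cpx_module[OF C]])
    ultimately show ?thesis
      using inv_into_f_f[OF inj jE[OF x]] map_closed[OF \<phi> x] by (simp add: \<psi>_def \<psi>E_def j_def cone_obj)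
  qed
  moreover have "m < n" by (simp add: n_def)
  ultimately show ?thesis
    using ZAt first later \<psi>At qi perf
    by (intro exI[of _ n] exI[of _ Z] exI[of _ j] exI[of _ "\<lambda>q i u. u"] exI[of _ \<psi>]) auto
qed

end
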